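(* Let $G$ be a group of cardinality at most $\aleph_1$ and let $(X,\mu)$ be a standard non-atomic Borel probability space. Then every measure preserving near-action $\eta$ of $G$ on $(X,\mu)$ has a spatial model acting by Borel measure preserving automorphisms. Equivalently, for every group homomorphism $f:G\to\mathrm{Aut}(X,\mu)$ there is a group homomorphism $h:G\to G_{\mathrm{mp}}(X,\mu)$ with $\bar\varphi\circ h=f$. In particular, if CH holds then every measure preserving near-action of any group on $(X,\mu)$ has a spatial model acting by Borel measure preserving automorphisms.
   Context: $G_{\mathrm{mp}}(X,\mu)$ is the group of Borel bijections $f:X\to X$ with $\mu(f^{-1}(A))=\mu(A)$ for all Borel $A$; $I_{\mathrm{mp}}(X,\mu)$ is its normal subgroup of those $f$ with $f(x)=x$ for $\mu$-a.e. $x$; $\mathrm{Aut}(X,\mu)=G_{\mathrm{mp}}(X,\mu)/I_{\mathrm{mp}}(X,\mu)$ and $\bar\varphi$ is the quotient map. A measure preserving near-action of $G$ is a map $\eta:G\times X\to X$, writing $\eta(g)(x)=\eta(g,x)$, such that: (1) $\eta(e)(x)=x$ for almost all $x$; (2) for all $g,h\in G$, $\eta(gh)(x)=\eta(g)(\eta(h)(x))$ for almost all $x$; (3) for every Borel $B\subseteq X$ and $g\in G$, $\eta(g)(B)$ is $\mu$-measurable and $\mu(\eta(g)(B))=\mu(B)$. A spatial model of $\eta$ is an action $\rho:G\times X\to X$ of $G$ on $X$ (in the usual sense) which is measure preserving (each $\rho(g)(B)$, $B$ Borel, is $\mu$-measurable with $\mu(\rho(g)(B))=\mu(B)$) and such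 that for each $g\in G$, $\eta(g,x)=\rho(g,x)$ for $\mu$-a.e. $x$. It acts by Borel automorphisms if each $x\mapsto\rho(g,x)$ is Borel. *)

theory Defs
  imports "HOL-Probability.Probability" "HOL-Algebra.Coset" "HOL-Algebra.Group_Action"
begin

unbundle cardinal_syntax

definition polish_topology :: "'x topology \<Rightarrow> bool" where
  "polish_topology T \<longleftrightarrow> completely_metrizable_space T \<and> separable_space T"

definition standard_borel :: "'x measure \<Rightarrow> bool" where
  "standard_borel M \<longleftrightarrow>
    (\<exists>T. polish_topology T \<and> space M = topspace T
       \<and> sets M = sigma_sets (topspace T) {U. openin T U})"

definition measure_atom :: "'x measure \<Rightarrow> 'x set \<Rightarrow> bool" where
  "measure_atom M A \<longleftrightarrow>
    A \<in> sets M \<and> emeasure M A > 0 \<and>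
    (\<forall>B\<in>sets M. B \<subseteq> A \<longrightarrow> emeasure M B = 0 \<or> emeasure M B = emeasure M A)"

definition nonatomic :: "'x measure \<Rightarrow> bool" where
  "nonatomic M \<longleftrightarrow> (\<nexists>A. measure_atom M A)"

definition card_le_aleph1 :: "'a set \<Rightarrow> bool" where
  "card_le_aleph1 A \<longleftrightarrow> |A| \<le>o cardSuc natLeq"

definition continuum_hypothesis :: bool where
  "continuum_hypothesis \<longleftrightarrow> |UNIV :: nat set set| =o cardSuc natLeq"

text \<open>As in \<^const>\<open>BijGroup\<close>, a self-map of the space is represented by the function that is
  \<^const>\<open>undefined\<close> off the space, so that distinct elements are distinct as maps on it.\<close>

definition G_mp :: "'x measure \<Rightarrow> ('x \<Rightarrow> 'x) monoid" where
  "G_mp M = BijGroup (space M)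
     \<lparr>carrier := {f \<in> Bij (space M). f \<in> M \<rightarrow>\<^sub>M M \<and>
        (\<forall>A\<in>sets M. emeasure M (f -` A \<inter> space M) = emeasure M A)}\<rparr>"

definition I_mp :: "'x measure \<Rightarrow> ('x \<Rightarrow> 'x) set" where
  "I_mp M = {f \<in> carrier (G_mp M). AE x in M. f x = x}"

definition Aut_mp :: "'x measure \<Rightarrow> ('x \<Rightarrow> 'x) set monoid" where
  "Aut_mp M = G_mp M Mod I_mp M"

definition quotient_mp :: "'x measure \<Rightarrow> ('x \<Rightarrow> 'x) \<Rightarrow> ('x \<Rightarrow> 'x) set" where
  "quotient_mp M f = I_mp M #>\<^bsub>G_mp M\<^esub> f"

text \<open>Being \<open>\<mu>\<close>-measurable means belonging to the completion of the Borel \<open>\<sigma>\<close>-algebra.\<close>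

definition image_measure_preserving :: "'x measure \<Rightarrow> ('x \<Rightarrow> 'x) \<Rightarrow> bool" where
  "image_measure_preserving M f \<longleftrightarrow>
    (\<forall>B\<in>sets M. f ` B \<in> sets (completion M) \<and> emeasure (completion M) (f ` B) = emeasure M B)"

definition mp_near_action ::
    "('g, 'b) monoid_scheme \<Rightarrow> 'x measure \<Rightarrow> ('g \<Rightarrow> 'x \<Rightarrow> 'x) \<Rightarrow> bool" where
  "mp_near_action G M \<eta> \<longleftrightarrow>
    (\<forall>g\<in>carrier G. \<eta> g \<in> space M \<rightarrow> space M) \<and>
    (AE x in M. \<eta> \<one>\<^bsub>G\<^esub> x = x) \<and>
    (\<forall>g\<in>carrier G. \<forall>h\<in>carrier G. AE x in M. \<eta> (g \<otimes>\<^bsub>G\<^esub> h) x = \<eta> g (\<eta> h x)) \<and>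
    (\<forall>g\<in>carrier G. image_measure_preserving M (\<eta> g))"

definition spatial_model ::
    "('g, 'b) monoid_scheme \<Rightarrow> 'x measure \<Rightarrow> ('g \<Rightarrow> 'x \<Rightarrow> 'x) \<Rightarrow> ('g \<Rightarrow> 'x \<Rightarrow> 'x) \<Rightarrow> bool" where
  "spatial_model G M \<eta> \<rho> \<longleftrightarrow>
    group_action G (space M) \<rho> \<and>
    (\<forall>g\<in>carrier G. image_measure_preserving M (\<rho> g)) \<and>
    (\<forall>g\<in>carrier G. AE x in M. \<eta> g x = \<rho> g x)"

definition acts_by_borel_automorphisms ::
    "('g, 'b) monoid_scheme \<Rightarrow> 'x measure \<Rightarrow> ('g \<Rightarrow> 'x \<Rightarrow> 'x) \<Rightarrow> bool" where
  "acts_by_borel_automorphisms G M \<rho> \<longleftrightarrow> (\<forall>g\<in>carrier G. \<rho> g \<in> M \<rightarrow>\<^sub>M M)"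

end

theory Submission
  imports Defs "HOL-Algebra.Generated_Groups" "HOL-Library.Countable_Set_Type"
begin

text \<open>
  Write \<open>G\<close> as a union of countable subgroups along a well-order of type at most \<open>\<omega>\<^sub>1\<close>
  and lift the near-action pointwise along the chain. To extend a lift from \<open>H\<close> to a countable
  \<open>K \<supseteq> H\<close>, choose Borel representatives for all of \<open>K\<close>; off a null set \<open>N\<close> they form a genuine action
  of \<open>K\<close> that agrees with the given lift on \<open>H\<close>, so only the Borel \<open>H\<close>-space \<open>N\<close> has to be extended to
  a \<open>K\<close>-space. This works as soon as \<open>N\<close> contains an invariant Borel copy \<open>D\<close> of the shift of \<open>H\<close> on
  \<open>(2\<^sup>\<nat>)\<^sup>K\<close>: every Borel \<open>H\<close>-space embeds equivariantly into \<open>D\<close>, so \<open>N \<cong> D\<close> by an equivariant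
  Schroeder-Bernstein argument, and on \<open>D\<close> the shift of \<open>K\<close> is available.

  The difficulty is to have such a \<open>D\<close> also at limit stages. Fix a null Cantor set whose points code
  a sequence \<open>\<phi> \<in> (2\<^sup>\<nat>)\<^sup>\<nat>\<close> together with countably many pairs of a name of a group element (the
  elements of \<open>G\<close> have distinct names in \<open>2\<^sup>\<nat>\<close>) and a binary relation on \<open>\<nat>\<close>. Whenever the
  relations named by the elements of \<open>H\<close> define an action of \<open>H\<close> on \<open>\<nat>\<close>, the lift on \<open>H\<close> is required
  to permute the coordinates of \<open>\<phi>\<close> accordingly. These requirements are coherent as \<open>H\<close> grows, hence pass
  to unions, and codes that name exactly the elements of \<open>H\<close> provide \<open>D\<close>.
\<close>

section \<open>Standard Borel spaces and the Cantor space\<close>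

text \<open>At a limit stage the null set left over by a union of lifts is not under control and
  might contain no copy of a shift, so the room for the next step has to be set aside before any
  stage is reached. Codes do this for all countable subgroups at once. A code whose rows name
  exactly the elements of \<open>H\<close> is bound by the requirement for \<open>H\<close>; for a
  larger \<open>K\<close> it lacks a row, is invalid, and so becomes free at that very step. Its
  rows may still be the restriction to \<open>H\<close> of an action of \<open>K\<close> on the
  naturals, so that \<open>K\<close> can act on the freed codes as well. The bound on the
  cardinality enters twice. Proper initial segments are countable, which keeps the exceptional sets
  null and Borel; and there are at most continuum many elements, which leaves a distinct name for
  each. Under CH the group may have any size because Aut(X,\<mu>) has at most continuum many
  elements: the kernel is factored out first.\<close>

abbreviation cantor :: "('i \<Rightarrow> bool) measure" where
  "cantor \<equiv> Pi\<^sub>M UNIV (\<lambda>_. count_space UNIV)"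

lemma space_cantor [simp]: "space cantor = UNIV"
  by (simp add: space_PiM)

lemma measurable_cantorI:
  assumes "\<And>i. Measurable.pred N (\<lambda>x. f x i)"
  shows "f \<in> N \<rightarrow>\<^sub>M cantor"
proof -
  have "(\<lambda>x i. (\<lambda>i x. f x i) i x) \<in> N \<rightarrow>\<^sub>M cantor"
    by (rule measurable_PiM_single') (use assms in auto)
  then show ?thesis by simp
qed

lemma measurable_cantorD [measurable (raw)]:
  "f \<in> N \<rightarrow>\<^sub>M cantor \<Longrightarrow> Measurable.pred N (\<lambda>x. f x i)"
  by simp

lemma pred_cantor_coord [measurable]: "Measurable.pred cantor (\<lambda>b. b i)"
  by simp

section \<open>Coding the points of a Polish space by bits\<close>

locale polish_measure = Metric_space S d for S :: "'x set" and d +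
  fixes M :: "'x measure" and den :: "nat \<Rightarrow> 'x"
  assumes complete: mcomplete
    and dense: "\<And>x r. x \<in> S \<Longrightarrow> r > 0 \<Longrightarrow> \<exists>n. d x (den n) < r"
    and den_in: "\<And>n. den n \<in> S"
    and space_M: "space M = S"
    and sets_M: "sets M = sigma_sets S {U. openin mtopology U}"
begin

lemma mball_sets [measurable]: "mball x r \<in> sets M"
  unfolding sets_M by (auto intro: sigma_sets.Basic)

lemma closed_sets: "closedin mtopology C \<Longrightarrow> C \<in> sets M"
proof -
  assume C: "closedin mtopology C"
  then have "S - C \<in> sets M"
    unfolding sets_M by (intro sigma_sets.Basic) (auto simp: closedin_def)
  then have "space M - (S - C) \<in> sets M" by blast
  moreover have "space M - (S - C) = C"
    using closedin_subset[OF C] by (auto simp: space_M)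
  ultimately show ?thesis by simp
qed

lemma measurable_into_M:
  assumes "f \<in> space N \<rightarrow> S" and "\<And>U. openin mtopology U \<Longrightarrow> {x \<in> space N. f x \<in> U} \<in> sets N"
  shows "f \<in> N \<rightarrow>\<^sub>M M"
proof (rule measurable_sigma_sets[OF sets_M])
  show "{U. openin mtopology U} \<subseteq> Pow S"
    using openin_subset by fastforce
  fix U assume "U \<in> {U. openin mtopology U}"
  then show "f -` U \<inter> space N \<in> sets N"
    using assms(2)[of U] by (simp add: vimage_def Collect_conj_eq Int_commute)
qed (use assms in auto)

text \<open>The strict inequality makes each bit the indicator of an open ball.
  \<open>decode\<close> asks for the closed inequality instead, which survives the passage to a
  limit of centres.\<close>

definition code :: "'x \<Rightarrow> nat \<times> nat \<Rightarrow> bool" where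
  "code x = (\<lambda>(n, k). d x (den n) < 1 / real (Suc k))"

text \<open>Compatibility is expressed by the centres alone, which makes it a condition on countably
  many bits; it still forces one centre per radius to form a Cauchy sequence.\<close>

definition good :: "(nat \<times> nat \<Rightarrow> bool) \<Rightarrow> bool" where
  "good b \<longleftrightarrow> (\<forall>k. \<exists>n. b (n, k)) \<and>
    (\<forall>n k m l. b (n, k) \<longrightarrow> b (m, l) \<longrightarrow> d (den n) (den m) \<le> 1 / real (Suc k) + 1 / real (Suc l))"

text \<open>On a good code the chosen point is unique by the argument of \<open>near_eq\<close>; the
  constant value elsewhere keeps the map Borel on the whole Cantor space.\<close>

definition decode :: "(nat \<times> nat \<Rightarrow> bool) \<Rightarrow> 'x" where
  "decode b = (if good b then SOME x. x \<in> S \<and> (\<forall>n k. b (n, k) \<longrightarrow> d x (den n) \<le> 1 / real (Suc k))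
     else den 0)"

lemma good_limit:
  assumes "good b"
  shows "\<exists>x\<in>S. \<forall>n k. b (n, k) \<longrightarrow> d x (den n) \<le> 1 / real (Suc k)"
proof -
  have "\<forall>k. \<exists>n. b (n, k)"
    using assms unfolding good_def by blast
  then obtain s where s: "\<And>k. b (s k, k)"
    by metis
  have bd: "d (den n) (den m) \<le> 1 / real (Suc k) + 1 / real (Suc l)" if "b (n,k)" "b (m,l)" for n m k l
    using assms that unfolding good_def by blast
  have inv_small: "\<exists>N. \<forall>n\<ge>N. 1 / real (Suc n) < e" if "e > 0" for e :: real
  proof -
    obtain N where N: "1 / real (Suc N) < e"
      by (rule nat_approx_posE[OF \<open>e > 0\<close>])
    have "1 / real (Suc n) < e" if "n \<ge> N" for n
    proof -
      have "1 / real (Suc n) \<le> 1 / real (Suc N)"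
        using that by (intro divide_left_mono) auto
      then show ?thesis using N by linarith
    qed
    then show ?thesis by blast
  qed
  have "MCauchy (\<lambda>k. den (s k))"
    unfolding MCauchy_def
  proof (intro conjI allI impI)
    show "range (\<lambda>k. den (s k)) \<subseteq> S" using den_in by auto
    fix e :: real assume "e > 0"
    then obtain N where N: "\<forall>n\<ge>N. 1 / real (Suc n) < e/2"
      using inv_small[of "e/2"] by auto
    show "\<exists>N. \<forall>n n'. N \<le> n \<longrightarrow> N \<le> n' \<longrightarrow> d (den (s n)) (den (s n')) < e"
    proof (intro exI allI impI)
      fix n n' assume "N \<le> n" "N \<le> n'"
      then have "1 / real (Suc n) < e/2" "1 / real (Suc n') < e/2" using N by auto
      then show "d (den (s n)) (den (s n')) < e"
        using bd[OF s s, of n n'] by linarith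
    qed
  qed
  then obtain x where x: "limitin mtopology (\<lambda>k. den (s k)) x sequentially"
    using complete unfolding mcomplete_def by blast
  then have xS: "x \<in> S" by (simp add: limitin_metric)
  have "d x (den n) \<le> 1 / real (Suc k)" if b: "b (n, k)" for n k
  \<comment> \<open>The limit is compared with \<open>den n\<close> through a centre
    \<open>den (s l)\<close> so late that its radius and its distance to the limit are both below
    \<open>e/2\<close>.\<close>
  proof (rule field_le_epsilon)
    fix e :: real assume e: "e > 0"
    obtain N1 where N1: "\<forall>l\<ge>N1. d (den (s l)) x < e/2"
      using x half_gt_zero[OF e] unfolding limit_metric_sequentially by blast
    obtain N2 where N2: "\<forall>n\<ge>N2. 1 / real (Suc n) < e/2"
      using inv_small[of "e/2"] e by auto
    define l where "l = max N1 N2"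
    have "d x (den n) \<le> d x (den (s l)) + d (den (s l)) (den n)"
      using triangle xS den_in by blast
    moreover have "d x (den (s l)) < e/2" using N1 commute[of x] by (simp add: l_def)
    moreover have "d (den (s l)) (den n) \<le> 1 / real (Suc l) + 1 / real (Suc k)"
      using bd[OF s b] .
    moreover have "1 / real (Suc l) < e/2" using N2 by (simp add: l_def)
    ultimately show "d x (den n) \<le> 1 / real (Suc k) + e" by linarith
  qed
  then show ?thesis using xS by blast
qed

lemma decode_good:
  assumes "good b"
  shows "decode b \<in> S" and "\<And>n k. b (n, k) \<Longrightarrow> d (decode b) (den n) \<le> 1 / real (Suc k)"
  using someI_ex[OF good_limit[OF assms, unfolded Bex_def]] assms unfolding decode_def by auto

lemma decode_in: "decode b \<in> S"
  using decode_good(1)[of b] den_in by (cases "good b") (auto simp: decode_def)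

lemma code_good: assumes "x \<in> S" shows "good (code x)"
  unfolding good_def
proof (intro conjI allI impI)
  fix k show "\<exists>n. code x (n, k)"
    using dense[OF assms, of "1 / real (Suc k)"] by (auto simp: code_def)
next
  fix n k m l assume "code x (n, k)" "code x (m, l)"
  then show "d (den n) (den m) \<le> 1 / real (Suc k) + 1 / real (Suc l)"
    using triangle[OF den_in assms den_in, of n m] commute[of x] by (simp add: code_def)
qed

lemma near_eq:
  assumes "x \<in> S" "y \<in> S" "\<And>k. \<exists>n. d x (den n) \<le> 1 / real (Suc k) \<and> d y (den n) \<le> 1 / real (Suc k)"
  shows "x = y"
proof (rule ccontr)
  assume "x \<noteq> y"
  then have "d x y > 0" using assms by (simp add: mdist_pos_eq)
  then obtain k where k: "1 / real (Suc k) < d x y / 2"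
    using nat_approx_posE[of "d x y / 2"] by auto
  obtain n where "d x (den n) \<le> 1 / real (Suc k)" "d y (den n) \<le> 1 / real (Suc k)"
    using assms(3) by blast
  then show False
    using triangle[OF assms(1) den_in assms(2), of n] commute[of y] k by simp
qed

lemma decode_code: assumes "x \<in> S" shows "decode (code x) = x"
proof (rule near_eq)
  fix k
  obtain n where n: "code x (n, k)"
    using code_good[OF assms] unfolding good_def by blast
  then have "d x (den n) \<le> 1 / real (Suc k)" by (simp add: code_def)
  then show "\<exists>n. d (decode (code x)) (den n) \<le> 1 / real (Suc k) \<and> d x (den n) \<le> 1 / real (Suc k)"
    using decode_good(2)[OF code_good[OF assms] n] by blast
qed (use assms decode_in in auto)

lemma code_measurable: "code \<in> M \<rightarrow>\<^sub>M cantor"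
proof (rule measurable_cantorI)
  fix i :: "nat \<times> nat"
  obtain n k where i: "i = (n, k)" by (cases i)
  have "{x \<in> space M. code x i} = mball (den n) (1 / real (Suc k))"
    using den_in by (auto simp: i code_def space_M commute)
  then show "Measurable.pred M (\<lambda>x. code x i)"
    by (simp add: pred_def mball_sets)
qed

text \<open>The factor 2 is slack: a decoded point satisfies only the closed inequality, but it does
  lie in the open ball of twice the radius. The right-hand side is a countable union of conditions
  on single bits, whence measurability.\<close>

lemma decode_open_iff:
  assumes "good b" "openin mtopology U"
  shows "decode b \<in> U \<longleftrightarrow> (\<exists>n k. b (n, k) \<and> mball (den n) (2 / real (Suc k)) \<subseteq> U)"
proof
  assume "decode b \<in> U"
  then obtain r where r: "r > 0" "mball (decode b) r \<subseteq> U"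
    using assms(2) unfolding openin_mtopology by blast
  obtain k where k: "1 / real (Suc k) < r / 3"
    using nat_approx_posE[of "r/3"] r by auto
  obtain n where n: "b (n, k)" using assms(1) unfolding good_def by blast
  have "mball (den n) (2 / real (Suc k)) \<subseteq> mball (decode b) r"
  proof
    fix y assume y: "y \<in> mball (den n) (2 / real (Suc k))"
    then have "d (decode b) y \<le> d (decode b) (den n) + d (den n) y"
      using triangle decode_in den_in by auto
    also have "\<dots> < 1 / real (Suc k) + 2 / real (Suc k)"
      using decode_good(2)[OF assms(1) n] y by (intro add_le_less_mono) auto
    also have "\<dots> = 3 * (1 / real (Suc k))" by (simp add: add_divide_distrib [symmetric])
    also have "\<dots> < r" using k by linarith
    finally show "y \<in> mball (decode b) r" using y decode_in by simp
  qed
  then show "\<exists>n k. b (n, k) \<and> mball (den n) (2 / real (Suc k)) \<subseteq> U"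
    using n r by blast
next
  assume "\<exists>n k. b (n, k) \<and> mball (den n) (2 / real (Suc k)) \<subseteq> U"
  then obtain n k where nk: "b (n, k)" "mball (den n) (2 / real (Suc k)) \<subseteq> U" by blast
  have "d (den n) (decode b) \<le> 1 / real (Suc k)"
    using decode_good(2)[OF assms(1) nk(1)] commute[of "den n"] by simp
  also have "\<dots> < 2 / real (Suc k)" by (simp add: divide_strict_right_mono)
  finally show "decode b \<in> U" using nk(2) den_in decode_in by auto
qed

lemma decode_measurable: "decode \<in> cantor \<rightarrow>\<^sub>M M"
proof (rule measurable_into_M)
  fix U assume U: "openin mtopology U"
  have "{x \<in> space cantor. decode x \<in> U} =
     {x \<in> space cantor. (if good x then (\<exists>n k. x (n, k) \<and> mball (den n) (2 / real (Suc k)) \<subseteq> U) else den 0 \<in> U)}"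
    using decode_open_iff[OF _ U] by (auto simp: decode_def)
  also have "\<dots> \<in> sets cantor"
    unfolding good_def by measurable
  finally show "{x \<in> space cantor. decode x \<in> U} \<in> sets cantor" .
qed (use decode_in in auto)

end

section \<open>A Cantor scheme in the support of the measure\<close>

context polish_measure
begin

lemma singleton_sets: "x \<in> S \<Longrightarrow> {x} \<in> sets M"
  by (intro closed_sets) (simp add: closedin_t1_singleton t1_space_mtopology)

text \<open>Almost every point lies in the closed support, and when points are null the support has
  no isolated points. So each of its points can be split into two within the support, which is what
  a Cantor scheme requires.\<close>

definition supp :: "'x set" where
  "supp = {x \<in> S. \<forall>r>0. emeasure M (mball x r) > 0}"

text \<open>Every point off the support lies in a null ball taken from the countable family with
  centres \<open>den n\<close> and radii 1/(k+1).\<close>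

lemma outside_supp_null:
  "\<exists>N\<in>null_sets M. S - supp \<subseteq> N"
proof -
  define J where "J = {(n, k). emeasure M (mball (den n) (1 / real (Suc k))) = 0}"
  define N where "N = (\<Union>(n, k)\<in>J. mball (den n) (1 / real (Suc k)))"
  have "countable J" by simp
  then have "N \<in> null_sets M"
    unfolding N_def by (intro null_sets_UN') (auto simp: J_def null_sets_def mball_sets)
  moreover have "x \<in> N" if x: "x \<in> S - supp" for x
  proof -
    obtain r where r: "r > 0" "emeasure M (mball x r) = 0"
      using x by (auto simp: supp_def zero_less_iff_neq_zero)
    obtain k where k: "1 / real (Suc k) < r / 2"
      using nat_approx_posE[of "r/2"] r by auto
    obtain n where n: "d x (den n) < 1 / real (Suc k)"
      using dense[of x "1 / real (Suc k)"] x by auto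
    have sub: "mball (den n) (1 / real (Suc k)) \<subseteq> mball x r"
    proof
      fix y assume y: "y \<in> mball (den n) (1 / real (Suc k))"
      then show "y \<in> mball x r"
        using triangle[of x "den n" y] n k x den_in by auto
    qed
    have "emeasure M (mball (den n) (1 / real (Suc k))) \<le> 0"
      using emeasure_mono[OF sub mball_sets] r by simp
    then have "(n, k) \<in> J" by (simp add: J_def)
    moreover have "x \<in> mball (den n) (1 / real (Suc k))"
      using n x den_in commute[of x] by simp
    ultimately show ?thesis unfolding N_def by blast
  qed
  ultimately show ?thesis by blast
qed

text \<open>Otherwise a ball around \<open>x\<close> would consist of \<open>x\<close> and of points
  off the support, and would be null.\<close>

lemma supp_no_isolated:
  assumes null: "\<And>x. x \<in> S \<Longrightarrow> emeasure M {x} = 0" and x: "x \<in> supp" and r: "r > 0"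
  shows "\<exists>y\<in>supp. 0 < d x y \<and> d x y < r"
proof (rule ccontr)
  assume c: "\<not> (\<exists>y\<in>supp. 0 < d x y \<and> d x y < r)"
  have xS: "x \<in> S" using x by (simp add: supp_def)
  obtain N where N: "N \<in> null_sets M" "S - supp \<subseteq> N" using outside_supp_null by blast
  have "{x} \<in> null_sets M" using null[OF xS] singleton_sets[OF xS] by (simp add: null_sets_def)
  then have nul: "{x} \<union> N \<in> null_sets M" using N(1) by (rule null_sets.Un)
  have sub: "mball x r \<subseteq> {x} \<union> N"
  proof
    fix y assume y: "y \<in> mball x r"
    then have "y = x \<or> d x y > 0" using mdist_pos_eq by auto
    then show "y \<in> {x} \<union> N" using c y N(2) by auto
  qed
  have "emeasure M (mball x r) \<le> 0"
    using emeasure_mono[OF sub, of M] nul by (auto simp: null_sets_def)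
  then show False using x r by (auto simp: supp_def)
qed

lemma supp_nonempty:
  assumes "emeasure M S \<noteq> 0"
  shows "supp \<noteq> {}"
proof
  assume "supp = {}"
  then obtain N where N: "N \<in> null_sets M" "S \<subseteq> N" using outside_supp_null by auto
  then have "emeasure M S \<le> 0"
    using emeasure_mono[of S N M] by (auto simp: null_sets_def)
  then show False using assms by simp
qed

definition nb :: "'x \<Rightarrow> real \<Rightarrow> 'x" where
  "nb x r = (SOME y. y \<in> supp \<and> 0 < d x y \<and> d x y < r / 2)"

text \<open>A node is the centre and radius of a closed ball; the newest bit is the head of the
  list. The second centre \<open>y\<close> is closer to \<open>x\<close> than half the radius r. The
  new radius d(x,y)/3 makes the two children disjoint, keeps them inside the parent (4/3 times r/2
  is less than r), and is less than half of r.\<close>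

primrec node :: "bool list \<Rightarrow> 'x \<times> real" where
  "node [] = (SOME x. x \<in> supp, 1)"
| "node (b # s) =
    (let x = fst (node s); y = nb x (snd (node s)) in (if b then y else x, d x y / 3))"

definition cell :: "bool list \<Rightarrow> 'x set" where
  "cell s = mcball (fst (node s)) (snd (node s))"

primrec initial :: "(nat \<Rightarrow> bool) \<Rightarrow> nat \<Rightarrow> bool list" where
  "initial b 0 = []"
| "initial b (Suc n) = b n # initial b n"

lemma length_initial [simp]: "length (initial b n) = n"
  by (induction n) auto

context
  assumes point_null: "\<And>x. x \<in> S \<Longrightarrow> emeasure M {x} = 0" and total: "emeasure M S \<noteq> 0"
begin

lemma nb_props:
  assumes "x \<in> supp" "r > 0"
  shows "nb x r \<in> supp" "0 < d x (nb x r)" "d x (nb x r) < r / 2"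
  using someI_ex[OF supp_no_isolated[OF point_null assms(1), of "r/2", unfolded Bex_def]] assms(2)
  unfolding nb_def by auto

lemma node_props: "fst (node s) \<in> supp \<and> 0 < snd (node s) \<and> snd (node s) \<le> (1/2) ^ length s"
proof (induction s)
  case Nil
  then show ?case using supp_nonempty[OF total] some_in_eq by auto
next
  case (Cons b s)
  note nb = nb_props[of "fst (node s)" "snd (node s)"]
  show ?case using Cons nb by (auto simp: Let_def)
qed

lemma node_in: "fst (node s) \<in> S"
  using node_props[of s] by (simp add: supp_def)

lemma cell_Cons_subset: "cell (b # s) \<subseteq> cell s"
proof
  fix z assume z: "z \<in> cell (b # s)"
  define x r y where "x = fst (node s)" and "r = snd (node s)" and "y = nb x r"
  have p: "x \<in> supp" "r > 0" using node_props[of s] by (auto simp: x_def r_def)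
  note nb = nb_props[OF p, folded y_def]
  have S: "x \<in> S" "y \<in> S" "z \<in> S" using p nb z by (auto simp: supp_def cell_def)
  have "d (if b then y else x) z \<le> d x y / 3"
    using z by (simp add: cell_def Let_def x_def y_def r_def split: if_splits)
  moreover have "d x z \<le> d x y + d y z" using triangle S by blast
  ultimately have "d x z \<le> r" using nb p(2) by (auto split: if_splits)
  then show "z \<in> cell s" using S by (simp add: cell_def x_def r_def)
qed

lemma cell_disjoint_children: "cell (True # s) \<inter> cell (False # s) = {}"
proof -
  define x r y where "x = fst (node s)" and "r = snd (node s)" and "y = nb x r"
  have p: "x \<in> supp" "r > 0" using node_props[of s] by (auto simp: x_def r_def)
  note nb = nb_props[OF p, folded y_def]
  have S: "x \<in> S" "y \<in> S" using p nb by (auto simp: supp_def)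
  have False if z: "z \<in> cell (True # s)" "z \<in> cell (False # s)" for z
  proof -
    have "d y z \<le> d x y / 3" "d x z \<le> d x y / 3" "z \<in> S"
      using z by (auto simp: cell_def Let_def x_def y_def r_def)
    then show False using triangle[OF S(1) _ S(2), of z] commute[of z y] nb(2) by auto
  qed
  then show ?thesis by blast
qed

lemma cell_unique:
  "length s = length t \<Longrightarrow> z \<in> cell s \<Longrightarrow> z \<in> cell t \<Longrightarrow> s = t"
proof (induction s t rule: list_induct2)
  case (Cons x xs y ys)
  then have "xs = ys" using cell_Cons_subset by blast
  then show ?case using Cons.prems cell_disjoint_children[of ys] by (cases x; cases y) auto
qed simp

lemma cell_small: "x \<in> cell s \<Longrightarrow> y \<in> cell s \<Longrightarrow> d x y \<le> 2 * (1/2) ^ length s"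
proof -
  assume "x \<in> cell s" "y \<in> cell s"
  then have "d x y \<le> 2 * snd (node s)"
    using triangle[of x "fst (node s)" y] commute[of x] unfolding cell_def by auto
  then show ?thesis using node_props[of s] by linarith
qed

definition embed :: "(nat \<Rightarrow> bool) \<Rightarrow> 'x" where
  "embed b = (SOME x. \<forall>n. x \<in> cell (initial b n))"

lemma embed_cell: "embed b \<in> cell (initial b n)"
proof -
  have "(\<Inter>n. cell (initial b n)) \<noteq> {}"
  \<comment> \<open>Completeness in the form of Cantor's intersection theorem, for the nested balls
    along one branch.\<close>
  proof (rule complete[unfolded mcomplete_nest, rule_format], intro conjI allI impI)
    show "closedin mtopology (cell (initial b n))" for n by (simp add: cell_def)
    show "cell (initial b n) \<noteq> {}" for n
      using node_in[of "initial b n"] node_props[of "initial b n"] unfolding cell_def mcball_eq_empty by auto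
    show "decseq (\<lambda>n. cell (initial b n))"
      by (intro decseq_SucI) (use cell_Cons_subset in simp)
    fix e :: real assume "e > 0"
    then obtain n where n: "(1/2) ^ n < e" using real_arch_pow_inv[of e "1/2"] by auto
    then have "cell (initial b n) \<subseteq> mcball (fst (node (initial b n))) e"
      using node_props[of "initial b n"] unfolding cell_def by (intro mcball_subset_concentric) auto
    then show "\<exists>n a. cell (initial b n) \<subseteq> mcball a e" by blast
  qed
  then have "\<exists>x. \<forall>n. x \<in> cell (initial b n)" by blast
  from someI_ex[OF this] show ?thesis unfolding embed_def by blast
qed

text \<open>A left inverse of \<open>embed\<close> given by membership in closed cells, so that it
  is defined and Borel on the whole space and not only on the image.\<close>

definition unembed :: "'x \<Rightarrow> nat \<Rightarrow> bool" where
  "unembed x n \<longleftrightarrow> (\<exists>s. length s = n \<and> x \<in> cell (True # s))"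

lemma unembed_embed: "unembed (embed b) = b"
proof
  fix n
  have e: "embed b \<in> cell (b n # initial b n)" using embed_cell[of b "Suc n"] by simp
  show "unembed (embed b) n = b n"
  proof
    assume "unembed (embed b) n"
    then obtain s where s: "length s = n" "embed b \<in> cell (True # s)" by (auto simp: unembed_def)
    then have "True # s = b n # initial b n" using e by (intro cell_unique) auto
    then show "b n" by simp
  next
    assume "b n"
    then show "unembed (embed b) n" using e unfolding unembed_def by (intro exI[of _ "initial b n"]) simp
  qed
qed

lemma cell_sets [measurable]: "cell s \<in> sets M"
  unfolding cell_def by (rule closed_sets) simp

lemma unembed_measurable: "unembed \<in> M \<rightarrow>\<^sub>M cantor"
  unfolding unembed_def by (rule measurable_cantorI) measurable

lemma embed_in: "embed b \<in> S"
  using embed_cell[of b 0] by (auto simp: cell_def)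

lemma initial_pred [measurable]: "Measurable.pred cantor (\<lambda>b. initial b n = s)"
proof (induction n arbitrary: s)
  case (Suc n)
  show ?case
  proof (cases s)
    case (Cons c t)
    note Suc.IH[measurable]
    show ?thesis unfolding Cons by simp
  qed simp
qed simp

text \<open>Cells along a branch shrink to its point, so an open set around the point contains one
  of them. There are countably many cells, and following one is a condition on finitely many
  bits.\<close>

lemma embed_open_iff:
  assumes U: "openin mtopology U"
  shows "embed b \<in> U \<longleftrightarrow> (\<exists>s. cell s \<subseteq> U \<and> initial b (length s) = s)"
proof
  assume "embed b \<in> U"
  then obtain r where r: "r > 0" "mball (embed b) r \<subseteq> U"
    using U unfolding openin_mtopology by blast
  obtain n where n: "(1/2) ^ n < r / 2" using real_arch_pow_inv[of "r/2" "1/2"] r by auto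
  have "cell (initial b n) \<subseteq> mball (embed b) r"
  proof
    fix y assume y: "y \<in> cell (initial b n)"
    have "d (embed b) y \<le> 2 * (1/2) ^ n" using cell_small[OF embed_cell y] by simp
    then show "y \<in> mball (embed b) r" using n embed_in y by (auto simp: cell_def)
  qed
  then show "\<exists>s. cell s \<subseteq> U \<and> initial b (length s) = s"
    using r by (intro exI[of _ "initial b n"]) auto
next
  assume "\<exists>s. cell s \<subseteq> U \<and> initial b (length s) = s"
  then show "embed b \<in> U" using embed_cell by (metis subsetD)
qed

lemma embed_measurable: "embed \<in> cantor \<rightarrow>\<^sub>M M"
proof (rule measurable_into_M)
  fix U assume U: "openin mtopology U"
  show "{x \<in> space cantor. embed x \<in> U} \<in> sets cantor"
    unfolding embed_open_iff[OF U] by measurable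
qed (use embed_in in auto)

end

end

section \<open>Standard Borel spaces as Borel retracts of the Cantor space\<close>

lemma standard_borel_polish_measure:
  assumes "standard_borel M" "space M \<noteq> {}"
  obtains d den where "polish_measure (space M) d M den"
proof -
  obtain T where T: "polish_topology T" "space M = topspace T"
    "sets M = sigma_sets (topspace T) {U. openin T U}"
    using assms unfolding standard_borel_def by blast
  then obtain S d where S: "Metric_space S d" "Metric_space.mcomplete S d" "T = Metric_space.mtopology S d"
    unfolding polish_topology_def completely_metrizable_space_def by blast
  interpret Metric_space S d by fact
  have sp: "space M = S" using T S by simp
  obtain C where C: "countable C" "C \<subseteq> S" "mtopology closure_of C = S"
    using T S unfolding polish_topology_def separable_space_def by auto
  have "C \<noteq> {}" using C assms(2) sp by auto
  define den where "den = from_nat_into C"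
  have "polish_measure S d M den"
  proof unfold_locales
    show mcomplete by fact
    show "den n \<in> S" for n using from_nat_into[OF \<open>C \<noteq> {}\<close>] C by (auto simp: den_def)
    show "\<exists>n. d x (den n) < r" if xr: "x \<in> S" "r > 0" for x r
    proof -
      obtain y where "y \<in> C" "d x y < r" using xr C(3) unfolding metric_closure_of by auto
      then show ?thesis using from_nat_into_surj[OF C(1)] unfolding den_def by metis
    qed
    show "sets M = sigma_sets S {U. openin mtopology U}" using T S sp by simp
  qed fact
  then show ?thesis using that sp by simp
qed

lemma measurable_cantor_reindex: "(\<lambda>b. b \<circ> f) \<in> cantor \<rightarrow>\<^sub>M cantor"
  by (rule measurable_cantorI) simp

text \<open>\<open>e\<close> writes a point as bits and \<open>c\<close> reads it back. Both maps
  are total, so maps and sets move between the space and the Cantor space by plain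
  composition.\<close>

lemma standard_borel_coding:
  fixes M :: "'x measure"
  assumes "standard_borel M" "space M \<noteq> {}"
  shows "\<exists>(e :: 'x \<Rightarrow> nat \<Rightarrow> bool) c.
    e \<in> M \<rightarrow>\<^sub>M cantor \<and> c \<in> cantor \<rightarrow>\<^sub>M M \<and> (\<forall>x\<in>space M. c (e x) = x)"
proof -
  obtain d den where "polish_measure (space M) d M den"
    using standard_borel_polish_measure assms by blast
  then interpret polish_measure "space M" d M den .
  show ?thesis
  proof (intro exI conjI ballI)
    show "(\<lambda>x. code x \<circ> prod_decode) \<in> M \<rightarrow>\<^sub>M cantor"
      using measurable_compose[OF code_measurable measurable_cantor_reindex] .
    show "(\<lambda>b. decode (b \<circ> prod_encode)) \<in> cantor \<rightarrow>\<^sub>M M"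
      using measurable_compose[OF measurable_cantor_reindex decode_measurable] .
    show "decode ((code x \<circ> prod_decode) \<circ> prod_encode) = x" if "x \<in> space M" for x
      using decode_code[OF that] by (simp add: comp_def)
  qed
qed

lemma (in polish_measure) nonatomic_point_null:
  assumes "nonatomic M" "x \<in> S"
  shows "emeasure M {x} = 0"
proof (rule ccontr)
  assume a: "emeasure M {x} \<noteq> 0"
  have "measure_atom M {x}"
    unfolding measure_atom_def using a singleton_sets[OF assms(2)]
    by (auto simp: zero_less_iff_neq_zero subset_singleton_iff)
  then show False using assms(1) by (auto simp: nonatomic_def)
qed

lemma uncountable_bool_sequences: "uncountable (UNIV :: (nat \<Rightarrow> bool) set)"
proof
  assume "countable (UNIV :: (nat \<Rightarrow> bool) set)"
  then obtain f :: "nat \<Rightarrow> nat \<Rightarrow> bool" where "range f = UNIV"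
    using uncountable_def[of "UNIV :: (nat \<Rightarrow> bool) set"] by auto
  then obtain n where "f n = (\<lambda>k. \<not> f k k)" by (metis UNIV_I imageE)
  then show False by (metis (full_types))
qed

text \<open>The copies of the Cantor set indexed by the first half of the bits are disjoint, and only
  countably many of them can have positive measure.\<close>

lemma null_cantor_set:
  fixes M :: "'x measure"
  assumes "prob_space M" "standard_borel M" "nonatomic M"
  shows "\<exists>(\<iota> :: ('i::countable \<Rightarrow> bool) \<Rightarrow> 'x) \<delta> N. \<iota> \<in> cantor \<rightarrow>\<^sub>M M \<and> \<delta> \<in> M \<rightarrow>\<^sub>M cantor \<and>
    (\<forall>b. \<delta> (\<iota> b) = b) \<and> N \<in> null_sets M \<and> range \<iota> \<subseteq> N"
proof -
  interpret prob_space M by fact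
  obtain d den where "polish_measure (space M) d M den"
    using standard_borel_polish_measure assms not_empty by blast
  then interpret polish_measure "space M" d M den .
  have ctx: "\<And>x. x \<in> space M \<Longrightarrow> emeasure M {x} = 0" "emeasure M (space M) \<noteq> 0"
    using nonatomic_point_null assms(3) emeasure_space_1 by auto
  note meas = embed_measurable[OF ctx] unembed_measurable[OF ctx]
  have ue: "unembed (embed b) = b" for b by (rule unembed_embed[OF ctx])
  define left where "left x = unembed x \<circ> (\<lambda>n. 2 * n)" for x
  have left[measurable]: "left \<in> M \<rightarrow>\<^sub>M cantor"
    unfolding left_def using measurable_compose[OF meas(2) measurable_cantor_reindex] .
  have sing: "{a} \<in> sets cantor" for a :: "nat \<Rightarrow> bool"
  proof -
    have "{a} = {b \<in> space cantor. \<forall>k. b k = a k}" by auto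
    also have "\<dots> \<in> sets cantor" by measurable
    finally show ?thesis .
  qed
  interpret D: prob_space "distr M cantor left" by (rule prob_space_distr[OF left])
  have "countable {a. measure (distr M cantor left) {a} \<noteq> 0}" by (rule D.countable_support)
  then obtain a where a: "measure (distr M cantor left) {a} = 0"
    using uncountable_bool_sequences by (metis (mono_tags, lifting) countable_subset mem_Collect_eq subsetI)
  define N where "N = left -` {a} \<inter> space M"
  have N: "N \<in> null_sets M"
    using a sing[of a] left unfolding N_def
    by (auto simp: null_sets_def measure_distr emeasure_eq_measure intro: measurable_sets)
  \<comment> \<open>The even bits spell \<open>a\<close>, which puts the point into the null fibre
    over \<open>a\<close>; the odd bits carry \<open>b\<close> along an enumeration of its
    indices.\<close>
  define mix where "mix b n = (if even n then a (n div 2) else b (from_nat (n div 2)))" for b :: "'i \<Rightarrow> bool" and n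
  have mix: "mix \<in> cantor \<rightarrow>\<^sub>M cantor"
    unfolding mix_def by (rule measurable_cantorI) simp
  show ?thesis
  proof (intro exI conjI allI)
    show "(\<lambda>b. embed (mix b)) \<in> cantor \<rightarrow>\<^sub>M M" using measurable_compose[OF mix meas(1)] .
    show "(\<lambda>x. unembed x \<circ> (\<lambda>i. 2 * to_nat i + 1)) \<in> M \<rightarrow>\<^sub>M cantor"
      using measurable_compose[OF meas(2) measurable_cantor_reindex] .
    show "unembed (embed (mix b)) \<circ> (\<lambda>i. 2 * to_nat i + 1) = b" for b
      by (rule ext) (simp add: ue mix_def)
    show "N \<in> null_sets M" by fact
    show "range (\<lambda>b. embed (mix b)) \<subseteq> N"
      using embed_in[OF ctx] by (auto simp: N_def left_def ue mix_def)
  qed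
qed

section \<open>Analytic sets and Borel bijections\<close>

definition seq_closed :: "(nat \<Rightarrow> nat) set \<Rightarrow> bool" where
  "seq_closed C \<longleftrightarrow> (\<forall>x. (\<forall>n. \<exists>y\<in>C. \<forall>i<n. y i = x i) \<longrightarrow> x \<in> C)"

definition parity :: "(nat \<Rightarrow> nat) \<Rightarrow> nat \<Rightarrow> bool" where
  "parity x = (\<lambda>k. odd (x k))"

text \<open>Images of closed sets of Baire space under the one map \<open>parity\<close> already
  give all analytic sets: a point of any closed set can be stored in the halves of the coordinates,
  and the parities are then free to hold its value under a continuous map.\<close>

definition analytic :: "(nat \<Rightarrow> bool) set \<Rightarrow> bool" where
  "analytic A \<longleftrightarrow> (\<exists>C. seq_closed C \<and> A = parity ` C)"

lemma seq_closed_Inter: "(\<And>C. C \<in> \<C> \<Longrightarrow> seq_closed C) \<Longrightarrow> seq_closed (\<Inter>\<C>)"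
  unfolding seq_closed_def by (meson InterE InterI)

lemma seq_closed_Int: "seq_closed C \<Longrightarrow> seq_closed D \<Longrightarrow> seq_closed (C \<inter> D)"
  unfolding seq_closed_def by (meson IntE IntI)

lemma seq_closed_all: "(\<And>n. seq_closed {x. P n x}) \<Longrightarrow> seq_closed {x. \<forall>n. P n x}"
  using seq_closed_Inter[of "range (\<lambda>n. {x. P n x})"] by (auto simp: INTER_eq)

lemma seq_closed_finite_dep:
  assumes "\<And>x y. (\<forall>i<N. y i = x i) \<Longrightarrow> P y \<longleftrightarrow> P x"
  shows "seq_closed {x. P x}"
  unfolding seq_closed_def
proof (intro allI impI)
  fix x assume "\<forall>n. \<exists>y\<in>{x. P x}. \<forall>i<n. y i = x i"
  then obtain y where "P y" "\<forall>i<N. y i = x i" by blast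
  then show "x \<in> {x. P x}" using assms by blast
qed

lemma seq_closed_vimage:
  assumes "seq_closed C"
  shows "seq_closed {x. (\<lambda>j. f j (x (\<tau> j))) \<in> C}"
  unfolding seq_closed_def
proof (intro allI impI)
  fix x assume x: "\<forall>n. \<exists>y\<in>{x. (\<lambda>j. f j (x (\<tau> j))) \<in> C}. \<forall>i<n. y i = x i"
  have "\<exists>z\<in>C. \<forall>j<n. z j = f j (x (\<tau> j))" for n
  proof -
    define N where "N = Suc (\<Sum>j<n. \<tau> j)"
    obtain y where y: "(\<lambda>j. f j (y (\<tau> j))) \<in> C" "\<forall>i<N. y i = x i" using x by blast
    have "\<tau> j < N" if "j < n" for j
      using member_le_sum[of j "{..<n}" \<tau>] that by (simp add: N_def)
    then show ?thesis using y by (intro bexI[OF _ y(1)]) auto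
  qed
  then show "x \<in> {x. (\<lambda>j. f j (x (\<tau> j))) \<in> C}"
    using assms[unfolded seq_closed_def, rule_format, of "\<lambda>j. f j (x (\<tau> j))"] by simp
qed

text \<open>The first coordinate splits Baire space into clopen pieces, and a sequence can only be
  approximated from within its own piece.\<close>

lemma seq_closed_cases:
  assumes "\<And>i. seq_closed {x. P i x}"
  shows "seq_closed {x. P (f (x 0)) x}"
  unfolding seq_closed_def
proof (intro allI impI)
  fix x assume x: "\<forall>n. \<exists>y\<in>{x. P (f (x 0)) x}. \<forall>i<n. y i = x i"
  have "\<exists>y\<in>{y. P (f (x 0)) y}. \<forall>i<n. y i = x i" for n
  proof -
    obtain y where "P (f (y 0)) y" "\<forall>i<Suc n. y i = x i" using x by blast
    then show ?thesis by (intro bexI[of _ y]) auto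
  qed
  then show "x \<in> {x. P (f (x 0)) x}"
    using assms[of "f (x 0)"] unfolding seq_closed_def by blast
qed

lemma analytic_coordinate: "analytic {b. b k = v}"
proof -
  have "seq_closed {x. odd (x k) = v}"
    by (rule seq_closed_finite_dep[of "Suc k"]) auto
  moreover have "b \<in> parity ` {x. odd (x k) = v}" if "b k = v" for b
    using that by (intro image_eqI[of _ _ "\<lambda>k. if b k then 1 else 0"]) (auto simp: parity_def)
  then have "{b. b k = v} = parity ` {x. odd (x k) = v}"
    by (auto simp: parity_def)
  ultimately show ?thesis unfolding analytic_def by blast
qed

text \<open>In the following closure properties the bits of the new point are the parities of the
  coordinates, and the witnesses are stored in the halves of the coordinates.\<close>

lemma analytic_INT:
  assumes "\<And>n::nat. analytic (A n)"
  shows "analytic (\<Inter>n. A n)"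
proof -
  obtain C where C: "\<And>n. seq_closed (C n)" "\<And>n. A n = parity ` C n"
    using assms unfolding analytic_def by metis
  define w where "w n x = (\<lambda>m. x (prod_encode (n, m)) div 2)" for n and x :: "nat \<Rightarrow> nat"
  define E where "E = {x. \<forall>n. w n x \<in> C n} \<inter> {x. \<forall>n m. odd (w n x m) = odd (x m)}"
  have "seq_closed {x. w n x \<in> C n}" for n
    unfolding w_def by (rule seq_closed_vimage[OF C(1)])
  moreover have "seq_closed {x. odd (w n x m) = odd (x m)}" for n m
    by (rule seq_closed_finite_dep[of "Suc (prod_encode (n, m) + m)"]) (auto simp: w_def)
  ultimately have "seq_closed E"
    unfolding E_def by (intro seq_closed_Int seq_closed_all)
  moreover have "(\<Inter>n. A n) = parity ` E"
  proof (intro equalityI subsetI)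
    fix b assume "b \<in> (\<Inter>n. A n)"
    then have "\<forall>n. \<exists>x. x \<in> C n \<and> parity x = b" using C(2) by auto
    then obtain x where x: "\<And>n. x n \<in> C n" "\<And>n. parity (x n) = b" by metis
    define y where "y k = of_bool (b k) + 2 * (case prod_decode k of (n, m) \<Rightarrow> x n m)" for k
    have wy: "w n y = x n" for n by (auto simp: w_def y_def)
    have "parity y = b" by (auto simp: parity_def y_def)
    moreover have "y \<in> E"
    proof -
      have "odd (x n m) = odd (y m)" for n m
        using x(2)[of n] \<open>parity y = b\<close> unfolding parity_def by metis
      then show ?thesis unfolding E_def using x(1) by (simp add: wy)
    qed
    ultimately show "b \<in> parity ` E" by blast
  next
    fix b assume "b \<in> parity ` E"
    then obtain y where y: "y \<in> E" "b = parity y" by blast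
    have "b \<in> A n" for n
    proof -
      have "w n y \<in> C n" "parity (w n y) = b"
        using y by (auto simp: E_def parity_def)
      then show ?thesis using C(2) by blast
    qed
    then show "b \<in> (\<Inter>n. A n)" by blast
  qed
  ultimately show ?thesis unfolding analytic_def by blast
qed

lemma analytic_UN:
  assumes "\<And>n::nat. analytic (A n)"
  shows "analytic (\<Union>n. A n)"
proof -
  obtain C where C: "\<And>n. seq_closed (C n)" "\<And>n. A n = parity ` C n"
    using assms unfolding analytic_def by metis
  define w where "w x = (\<lambda>m. x (Suc m) div 2)" for x :: "nat \<Rightarrow> nat"
  define E where "E = {x. w x \<in> C (x 0 div 2)} \<inter> {x. \<forall>m. odd (w x m) = odd (x m)}"
  have "seq_closed {x. w x \<in> C n}" for n
    unfolding w_def by (rule seq_closed_vimage[OF C(1)])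
  then have "seq_closed {x. w x \<in> C (x 0 div 2)}"
    by (rule seq_closed_cases)
  moreover have "seq_closed {x. odd (w x m) = odd (x m)}" for m
    by (rule seq_closed_finite_dep[of "Suc (Suc m)"]) (auto simp: w_def)
  ultimately have "seq_closed E"
    unfolding E_def by (intro seq_closed_Int seq_closed_all)
  moreover have "(\<Union>n. A n) = parity ` E"
  proof (intro equalityI subsetI)
    fix b assume "b \<in> (\<Union>n. A n)"
    then obtain n x where x: "x \<in> C n" "parity x = b" using C(2) by auto
    define y where "y k = of_bool (b k) + 2 * (case k of 0 \<Rightarrow> n | Suc m \<Rightarrow> x m)" for k
    have wy: "w y = x" by (auto simp: w_def y_def)
    have y: "parity y = b" by (auto simp: parity_def y_def)
    have "odd (x m) = odd (y m)" for m
      using x(2) y unfolding parity_def by metis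
    moreover have "y 0 div 2 = n" by (simp add: y_def)
    ultimately have "y \<in> E" unfolding E_def using x(1) by (simp add: wy)
    then show "b \<in> parity ` E" using y by blast
  next
    fix b assume "b \<in> parity ` E"
    then obtain y where y: "y \<in> E" "b = parity y" by blast
    then have "w y \<in> C (y 0 div 2)" "parity (w y) = b"
      by (auto simp: E_def parity_def)
    then show "b \<in> (\<Union>n. A n)" using C(2) by blast
  qed
  ultimately show ?thesis unfolding analytic_def by blast
qed

lemma analytic_reindex:
  assumes "analytic A"
  shows "analytic ((\<lambda>b. b \<circ> \<sigma>) ` A)"
proof -
  obtain C where C: "seq_closed C" "A = parity ` C"
    using assms unfolding analytic_def by metis
  define w where "w x = (\<lambda>m. x m div 2)" for x :: "nat \<Rightarrow> nat"
  define E where "E = {x. w x \<in> C} \<inter> {x. \<forall>m. odd (w x (\<sigma> m)) = odd (x m)}"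
  have "seq_closed {x. w x \<in> C}"
    unfolding w_def by (rule seq_closed_vimage[OF C(1)])
  moreover have "seq_closed {x. odd (w x (\<sigma> m)) = odd (x m)}" for m
    by (rule seq_closed_finite_dep[of "Suc (\<sigma> m + m)"]) (auto simp: w_def)
  ultimately have "seq_closed E"
    unfolding E_def by (intro seq_closed_Int seq_closed_all)
  moreover have "(\<lambda>b. b \<circ> \<sigma>) ` A = parity ` E"
  proof (intro equalityI subsetI)
    fix b assume "b \<in> (\<lambda>b. b \<circ> \<sigma>) ` A"
    then obtain x where x: "x \<in> C" "parity x \<circ> \<sigma> = b" using C(2) by auto
    define y where "y k = of_bool (b k) + 2 * x k" for k
    have wy: "w y = x" by (auto simp: w_def y_def)
    have y: "parity y = b" by (auto simp: parity_def y_def)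
    have "odd (x (\<sigma> m)) = odd (y m)" for m
      using x(2) y unfolding parity_def by (metis comp_apply)
    then have "y \<in> E" unfolding E_def using x(1) by (simp add: wy)
    then show "b \<in> parity ` E" using y by blast
  next
    fix b assume "b \<in> parity ` E"
    then obtain y where y: "y \<in> E" "b = parity y" by blast
    then have "w y \<in> C" "b = parity (w y) \<circ> \<sigma>"
      by (auto simp: E_def parity_def)
    then show "b \<in> (\<lambda>b. b \<circ> \<sigma>) ` A" using C(2) by blast
  qed
  ultimately show ?thesis unfolding analytic_def by blast
qed

lemma analytic_empty: "analytic {}"
  unfolding analytic_def seq_closed_def by (intro exI[of _ "{}"]) auto

text \<open>In this form the Borel sets are open to induction from the sets that fix one
  bit.\<close>

lemma sets_cantor:
  "sets (cantor :: ('i \<Rightarrow> bool) measure) = sigma_sets UNIV {{b. b i = v} | i v. True}"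
proof (rule antisym)
  show "sets (cantor :: ('i \<Rightarrow> bool) measure) \<subseteq> sigma_sets UNIV {{b. b i = v} | i v. True}"
  proof -
    let ?N = "sigma UNIV {{b. b i = v} | i v. True} :: ('i \<Rightarrow> bool) measure"
    have "{x \<in> space ?N. x i \<in> V} \<in> sets ?N" for i :: 'i and V :: "bool set"
    proof -
      have "{x. x i \<in> V} = (\<Union>v\<in>V. {x. x i = v})" by auto
      also have "\<dots> \<in> sets ?N"
        by (intro sets.finite_UN) (auto intro: finite_subset)
      finally show ?thesis by simp
    qed
    then have "sets cantor \<subseteq> sets ?N"
      by (intro sets_PiM_in_sets) auto
    then show ?thesis by simp
  qed
  have "{b. b i = v} \<in> sets cantor" for i :: 'i and v
  proof -
    have "{b. b i = v} = {b \<in> space cantor. b i = v}" by simp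
    also have "\<dots> \<in> sets cantor" by measurable
    finally show ?thesis .
  qed
  then show "sigma_sets UNIV {{b. b i = v} | i v. True} \<subseteq> sets (cantor :: ('i \<Rightarrow> bool) measure)"
    by (intro sets.sigma_sets_subset[of _ cantor, simplified]) blast
qed

text \<open>Complements are carried along in the induction, because analytic sets are not closed
  under them.\<close>

lemma borel_analytic:
  assumes "A \<in> sets cantor"
  shows "analytic A"
proof -
  have "analytic A \<and> analytic (- A)"
    using assms unfolding sets_cantor
  proof (induction rule: sigma_sets.induct)
    case (Basic a)
    then obtain i v where "a = {b. b i = v}" by blast
    moreover have "- {b. b i = v} = {b. b i = (\<not> v)}" for i :: nat and v by auto
    ultimately show ?case using analytic_coordinate by simp
  next
    case Empty
    \<comment> \<open>The whole space as a countable union of subbasic sets: the parity of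
      \<open>n\<close> runs through both values of the bit.\<close>
    have "(\<Union>n. {b. b (0::nat) = odd (n::nat)}) = UNIV"
    proof -
      have "b \<in> (\<Union>n. {b. b (0::nat) = odd (n::nat)})" for b :: "nat \<Rightarrow> bool"
        by (rule UN_I[of "of_bool (b 0)"]) auto
      then show ?thesis by blast
    qed
    then show ?case
      using analytic_UN[of "\<lambda>n. {b. b (0::nat) = odd (n::nat)}"] analytic_coordinate analytic_empty by simp
  next
    case (Compl a)
    then show ?case by (simp add: Compl_eq_Diff_UNIV[symmetric])
  next
    case (Union a)
    then show ?case using analytic_UN[of a] analytic_INT[of "\<lambda>n. - a n"] by simp
  qed
  then show ?thesis ..
qed

section \<open>Lusin separation and Borel images under bijections\<close>

definition borel_separated :: "('i \<Rightarrow> bool) set \<Rightarrow> ('i \<Rightarrow> bool) set \<Rightarrow> bool" where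
  "borel_separated P Q \<longleftrightarrow> (\<exists>B\<in>sets cantor. P \<subseteq> B \<and> Q \<inter> B = {})"

text \<open>Intersect the separators over \<open>m\<close>, then unite over \<open>n\<close>. It is
  applied contrapositively: an inseparable pair of unions has an inseparable pair of
  members.\<close>

lemma borel_separated_UN:
  assumes "\<And>n m. borel_separated (P n) (Q m)"
  shows "borel_separated (\<Union>n::nat. P n) (\<Union>m::nat. Q m)"
proof -
  obtain B where B: "\<And>n m. B n m \<in> sets cantor" "\<And>n m. P n \<subseteq> B n m" "\<And>n m. Q m \<inter> B n m = {}"
    using assms unfolding borel_separated_def by metis
  show ?thesis
    unfolding borel_separated_def
  proof (intro bexI conjI)
    show "(\<Union>n. \<Inter>m. B n m) \<in> sets cantor" using B(1) by auto
    show "(\<Union>n. P n) \<subseteq> (\<Union>n. \<Inter>m. B n m)" using B(2) by blast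
    show "(\<Union>m. Q m) \<inter> (\<Union>n. \<Inter>m. B n m) = {}" using B(3) by blast
  qed
qed

definition cyl :: "nat list \<Rightarrow> (nat \<Rightarrow> nat) set" where
  "cyl s = {x. \<forall>i<length s. x i = s ! i}"

lemma cyl_split: "C \<inter> cyl s = (\<Union>n. C \<inter> cyl (s @ [n]))"
proof -
  have "x \<in> cyl s \<longleftrightarrow> (\<exists>n. x \<in> cyl (s @ [n]))" for x
    by (auto simp: cyl_def nth_append less_Suc_eq)
  then show ?thesis by blast
qed

text \<open>Lusin's separation theorem. If the sets are inseparable, both cylinders can be refined
  coordinate by coordinate while the pieces stay inseparable. The two branches obtained have
  different parities at some \<open>j\<close>, since \<open>A\<close> and \<open>B\<close> are
  disjoint; but then fixing bit \<open>j\<close> separates the pieces of depth j+1.\<close>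

lemma analytic_separation:
  assumes "analytic A" "analytic B" "A \<inter> B = {}"
  shows "borel_separated A B"
proof (rule ccontr)
  assume neg: "\<not> borel_separated A B"
  obtain C D where C: "seq_closed C" "A = parity ` C" and D: "seq_closed D" "B = parity ` D"
    using assms unfolding analytic_def by blast
  define bad where "bad s t \<longleftrightarrow> \<not> borel_separated (parity ` (C \<inter> cyl s)) (parity ` (D \<inter> cyl t))" for s t
  have step: "\<exists>n m. bad (s @ [n]) (t @ [m])" if b: "bad s t" for s t
  proof (rule ccontr)
    assume "\<not> (\<exists>n m. bad (s @ [n]) (t @ [m]))"
    then have "borel_separated (\<Union>n. parity ` (C \<inter> cyl (s @ [n]))) (\<Union>m. parity ` (D \<inter> cyl (t @ [m])))"
      by (intro borel_separated_UN) (auto simp: bad_def)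
    then show False
      using b unfolding bad_def cyl_split[of C s] cyl_split[of D t] image_UN by blast
  qed
  have bad0: "bad [] []" using neg C D by (simp add: bad_def cyl_def)
  obtain f where f: "f 0 = ([], [])" "\<And>k. bad (fst (f k)) (snd (f k))"
    "\<And>k. \<exists>n m. f (Suc k) = (fst (f k) @ [n], snd (f k) @ [m])"
  proof -
    have "\<exists>f. \<forall>k. (bad (fst (f k)) (snd (f k)) \<and> (k = 0 \<longrightarrow> f k = ([], []))) \<and>
        (\<exists>n m. f (Suc k) = (fst (f k) @ [n], snd (f k) @ [m]))"
    proof (rule dependent_nat_choice)
      fix p :: "nat list \<times> nat list" and k :: nat
      assume "bad (fst p) (snd p) \<and> (k = 0 \<longrightarrow> p = ([], []))"
      then obtain n m where "bad (fst p @ [n]) (snd p @ [m])" using step by blast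
      then show "\<exists>q. (bad (fst q) (snd q) \<and> (Suc k = 0 \<longrightarrow> q = ([], []))) \<and>
          (\<exists>n m. q = (fst p @ [n], snd p @ [m]))"
        by (intro exI[of _ "(fst p @ [n], snd p @ [m])"]) auto
    qed (use bad0 in auto)
    then show ?thesis using that by blast
  qed
  have len: "length (fst (f k)) = k \<and> length (snd (f k)) = k" for k
  proof (induction k)
    case (Suc k) then show ?case using f(3)[of k] by auto
  qed (simp add: f(1))
  define x where "x k = fst (f (Suc k)) ! k" for k
  define y where "y k = snd (f (Suc k)) ! k" for k
  have nth: "fst (f k) ! i = x i \<and> snd (f k) ! i = y i" if "i < k" for i k
    using that
  proof (induction k)
    case (Suc k)
    obtain n m where nm: "f (Suc k) = (fst (f k) @ [n], snd (f k) @ [m])" using f(3) by blast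
    show ?case
    proof (cases "i = k")
      case False
      then have "i < k" using Suc.prems by simp
      then show ?thesis using Suc.IH len[of k] nm by (simp add: nth_append)
    qed (simp add: x_def y_def)
  qed simp
  have cx: "cyl (fst (f k)) = {z. \<forall>i<k. z i = x i}" "cyl (snd (f k)) = {z. \<forall>i<k. z i = y i}" for k
    using len[of k] nth by (auto simp: cyl_def)
  have ne: "C \<inter> cyl (fst (f k)) \<noteq> {}" "D \<inter> cyl (snd (f k)) \<noteq> {}" for k
  proof -
    have "borel_separated {} Q" "borel_separated Q {}" for Q :: "(nat \<Rightarrow> bool) set"
      unfolding borel_separated_def
      by (rule bexI[of _ "{}"]; simp) (rule bexI[of _ UNIV]; simp add: sets.top[of cantor, simplified])
    then show "C \<inter> cyl (fst (f k)) \<noteq> {}" "D \<inter> cyl (snd (f k)) \<noteq> {}"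
      using f(2)[of k] unfolding bad_def by auto
  qed
  \<comment> \<open>No piece is empty, as the empty set is separated from everything. So each
    initial segment of the branch occurs in the closed set.\<close>
  have "x \<in> C" using C(1) ne(1) unfolding seq_closed_def cx by blast
  moreover have "y \<in> D" using D(1) ne(2) unfolding seq_closed_def cx by blast
  ultimately have "parity x \<noteq> parity y" using assms(3) C D by blast
  then obtain j where j: "odd (x j) \<noteq> odd (y j)" by (auto simp: parity_def)
  have "{b. b j = odd (x j)} = {b \<in> space cantor. b j = odd (x j)}" by simp
  also have "\<dots> \<in> sets cantor" by measurable
  finally have m: "{b. b j = odd (x j)} \<in> sets cantor" .
  have "borel_separated (parity ` (C \<inter> cyl (fst (f (Suc j))))) (parity ` (D \<inter> cyl (snd (f (Suc j)))))"
    unfolding borel_separated_def by (rule bexI[OF _ m]) (use j in \<open>auto simp: cx parity_def\<close>)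
  then show False using f(2)[of "Suc j"] by (simp add: bad_def)
qed

text \<open>With argument and value interleaved in the even and the odd bits, the graph of
  \<open>f\<close> over \<open>A\<close> is a Borel set. The image is its projection to the odd
  bits, which is a mere reindexing.\<close>

lemma analytic_image:
  fixes f :: "(nat \<Rightarrow> bool) \<Rightarrow> nat \<Rightarrow> bool"
  assumes A: "A \<in> sets cantor" and f: "f \<in> cantor \<rightarrow>\<^sub>M cantor"
  shows "analytic (f ` A)"
proof -
  have [measurable]: "Measurable.pred cantor (\<lambda>b. f b k)" for k
    using measurable_cantorD[OF f] .
  define l r where "l b = b \<circ> (\<lambda>n. 2 * n)" and "r b = b \<circ> (\<lambda>n. 2 * n + 1)" for b :: "nat \<Rightarrow> bool"
  have l[measurable]: "l \<in> cantor \<rightarrow>\<^sub>M cantor" unfolding l_def by (rule measurable_cantor_reindex)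
  have fl: "(\<lambda>b. f (l b)) \<in> cantor \<rightarrow>\<^sub>M cantor" using measurable_compose[OF l f] .
  have [measurable]: "Measurable.pred cantor (\<lambda>b. f (l b) k)" "Measurable.pred cantor (\<lambda>b. r b k)" for k
    using measurable_cantorD[OF fl] measurable_cantorD[OF measurable_cantor_reindex] unfolding r_def by auto
  have "{b \<in> space cantor. l b \<in> A \<and> (\<forall>k. f (l b) k = r b k)} \<in> sets cantor"
    using A by measurable
  then have "analytic {b. l b \<in> A \<and> f (l b) = r b}"
    by (intro borel_analytic) (simp add: fun_eq_iff)
  then have "analytic (r ` {b. l b \<in> A \<and> f (l b) = r b})"
    unfolding r_def by (rule analytic_reindex)
  moreover have "f ` A = r ` {b. l b \<in> A \<and> f (l b) = r b}"
  proof (intro equalityI subsetI)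
    fix c assume "c \<in> f ` A"
    then obtain a where a: "a \<in> A" "c = f a" by blast
    define b where "b n = (if even n then a (n div 2) else c (n div 2))" for n
    have "l b = a" "r b = c" by (auto simp: l_def r_def b_def)
    then show "c \<in> r ` {b. l b \<in> A \<and> f (l b) = r b}" using a by (intro image_eqI[of _ _ b]) auto
  next
    fix c assume "c \<in> r ` {b. l b \<in> A \<and> f (l b) = r b}"
    then obtain b where "l b \<in> A" "c = f (l b)" by auto
    then show "c \<in> f ` A" by blast
  qed
  ultimately show ?thesis by simp
qed

text \<open>The Lusin-Souslin theorem for bijections. Written as bits, the images of a set and of
  its complement are disjoint analytic sets; as the two images fill the space, a separating Borel
  set cuts out exactly the first. This makes the inverse of a Borel automorphism Borel.\<close>

lemma borel_bijection_inverse: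
  assumes M: "standard_borel M" and f: "f \<in> M \<rightarrow>\<^sub>M M" and bij: "bij_betw f (space M) (space M)"
    and A: "A \<in> sets M"
  shows "f ` A \<in> sets M"
proof (cases "space M = {}")
  case True
  then show ?thesis using A sets.sets_into_space[OF A] by simp
next
  case False
  obtain e :: "_ \<Rightarrow> nat \<Rightarrow> bool" and c where e: "e \<in> M \<rightarrow>\<^sub>M cantor" and c: "c \<in> cantor \<rightarrow>\<^sub>M M"
    and ce: "\<And>x. x \<in> space M \<Longrightarrow> c (e x) = x"
    using standard_borel_coding[OF M False] by auto
  define \<phi> where "\<phi> = (\<lambda>b. e (f (c b)))"
  have \<phi>: "\<phi> \<in> cantor \<rightarrow>\<^sub>M cantor"
    unfolding \<phi>_def using measurable_compose[OF measurable_compose[OF c f] e] .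
  \<comment> \<open>More sequences may decode into \<open>B\<close> than those of the form
    \<open>e x\<close>, but \<open>\<phi>\<close> depends only on the decoded point, so the image is
    unaffected.\<close>
  have im: "\<phi> ` (c -` B) = e ` f ` B" if "B \<subseteq> space M" for B
  proof (intro equalityI subsetI)
    fix z assume "z \<in> e ` f ` B"
    then obtain x where x: "x \<in> B" "z = e (f x)" by blast
    then have "c (e x) = x" using ce that by blast
    then show "z \<in> \<phi> ` (c -` B)" using x unfolding \<phi>_def by (intro image_eqI[of _ _ "e x"]) auto
  qed (auto simp: \<phi>_def)
  have an: "analytic (e ` f ` B)" if "B \<in> sets M" for B
  proof -
    have "c -` B \<in> sets cantor" using measurable_sets[OF c that] by simp
    then show ?thesis using analytic_image[OF _ \<phi>] im sets.sets_into_space[OF that] by metis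
  qed
  have sub: "A \<subseteq> space M" using sets.sets_into_space[OF A] .
  have inj_e: "inj_on e (space M)" by (metis ce inj_onI)
  have fim: "f ` space M = space M" "inj_on f (space M)" using bij by (auto simp: bij_betw_def)
  have "e ` f ` A \<inter> e ` f ` (space M - A) = {}"
  proof -
    have "f ` A \<inter> f ` (space M - A) = {}" using fim(2) sub by (auto simp: inj_on_def)
    moreover have "f ` A \<subseteq> space M" "f ` (space M - A) \<subseteq> space M" using fim sub by auto
    ultimately show ?thesis using inj_on_image_Int[OF inj_e] by (metis image_empty)
  qed
  then obtain B where B: "B \<in> sets cantor" "e ` f ` A \<subseteq> B" "e ` f ` (space M - A) \<inter> B = {}"
    using analytic_separation[OF an[OF A] an[of "space M - A"]] A unfolding borel_separated_def by blast
  have "f ` A = e -` B \<inter> space M"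
  proof (intro equalityI subsetI)
    fix y assume y: "y \<in> e -` B \<inter> space M"
    then obtain x where x: "x \<in> space M" "y = f x" using fim(1) by blast
    then have "x \<in> A" using B(3) y by blast
    then show "y \<in> f ` A" using x by blast
  qed (use B(2) sub fim in auto)
  then show ?thesis using measurable_sets[OF e B(1)] by simp
qed

section \<open>Extending a lift to a larger countable subgroup\<close>

text \<open>A point lies in the image exactly if \<open>L\<close> sends it into \<open>B\<close> and
  \<open>F\<close> brings it back, which is a Borel condition.\<close>

lemma retract_image_sets:
  assumes N: "N \<in> sets M" and F: "F \<in> M \<rightarrow>\<^sub>M M" and L: "L \<in> M \<rightarrow>\<^sub>M M"
    and LF: "\<And>x. x \<in> N \<Longrightarrow> L (F x) = x" and eq: "Measurable.pred M (\<lambda>x. F (L x) = x)"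
    and B: "B \<in> sets M" "B \<subseteq> N"
  shows "F ` B \<in> sets M"
proof -
  have "F ` B = {x \<in> space M. L x \<in> B \<and> F (L x) = x}"
    using B LF sets.sets_into_space[OF B(1)] measurable_space[OF F]
    by (auto intro!: image_eqI[of _ F] simp: subset_iff)
  also have "\<dots> \<in> sets M"
    using B(1) L eq by measurable
  finally show ?thesis .
qed

text \<open>Since \<open>D\<close> lies in \<open>N\<close>, it suffices to move
  \<open>N - D\<close> and its iterated images by \<open>F\<close> and to fix the rest. Equivariance
  is stated for one map \<open>t\<close> at a time and is applied to each group element: if
  \<open>t\<close> commutes with \<open>F\<close> and preserves \<open>N - D\<close>, it preserves
  every iterated image.\<close>

lemma equivariant_schroeder_bernstein:
  assumes N: "N \<in> sets M" and D: "D \<in> sets M" and DN: "D \<subseteq> N"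
    and F: "F \<in> M \<rightarrow>\<^sub>M M" and L: "L \<in> M \<rightarrow>\<^sub>M M" and FN: "F ` N \<subseteq> D"
    and LF: "\<And>x. x \<in> N \<Longrightarrow> L (F x) = x" and eq: "Measurable.pred M (\<lambda>x. F (L x) = x)"
  shows "\<exists>\<Gamma> \<Lambda>. \<Gamma> \<in> M \<rightarrow>\<^sub>M M \<and> \<Lambda> \<in> M \<rightarrow>\<^sub>M M \<and> (\<forall>x\<in>N. \<Gamma> x \<in> D \<and> \<Lambda> (\<Gamma> x) = x) \<and>
    (\<forall>y\<in>D. \<Lambda> y \<in> N \<and> \<Gamma> (\<Lambda> y) = y) \<and>
    (\<forall>t. bij_betw t N N \<longrightarrow> (\<forall>x\<in>N. t x \<in> D \<longleftrightarrow> x \<in> D) \<longrightarrow> (\<forall>x\<in>N. F (t x) = t (F x)) \<longrightarrow>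
      (\<forall>x\<in>N. \<Gamma> (t x) = t (\<Gamma> x)))"
proof -
  define A where "A n = ((\<lambda>B. F ` B) ^^ n) (N - D)" for n
  have A0: "A 0 = N - D" and ASuc: "A (Suc n) = F ` A n" for n by (simp_all add: A_def)
  have A: "A n \<in> sets M \<and> A n \<subseteq> N" for n
  proof (induction n)
    case (Suc n)
    then show ?case
      using retract_image_sets[OF N F L LF eq, of "A n"] FN DN by (auto simp: ASuc)
  qed (use N D in \<open>auto simp: A0\<close>)
  define Q where "Q = (\<Union>n. A n)"
  have Q[measurable]: "Q \<in> sets M" using A by (auto simp: Q_def)
  have QN: "Q \<subseteq> N" using A by (auto simp: Q_def)
  have FQ: "F x \<in> Q" if "x \<in> Q" for x
    using that ASuc unfolding Q_def by blast
  have QD: "\<exists>x\<in>Q. y = F x" if y: "y \<in> Q" "y \<in> D" for y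
  proof -
    obtain n where n: "y \<in> A n" using y unfolding Q_def by blast
    then obtain m where "n = Suc m" using y A0 by (cases n) auto
    then show ?thesis using n ASuc unfolding Q_def by blast
  qed
  have LFQ: "L (F x) = x" if "x \<in> Q" for x
    using LF QN that by blast
  have notQ: "x \<in> D" if "x \<in> N" "x \<notin> Q" for x
    using that A0 unfolding Q_def by blast
  define \<Gamma> where "\<Gamma> x = (if x \<in> Q then F x else x)" for x
  define \<Lambda> where "\<Lambda> y = (if y \<in> Q then L y else y)" for y
  have equiv: "\<Gamma> (t x) = t (\<Gamma> x)"
    if t: "bij_betw t N N" "\<forall>x\<in>N. t x \<in> D \<longleftrightarrow> x \<in> D" "\<forall>x\<in>N. F (t x) = t (F x)" and x: "x \<in> N" for t x
  proof -
    have tN: "t y \<in> N" if "y \<in> N" for y using t(1) that by (auto simp: bij_betw_def)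
    \<comment> \<open>The fixed part has to be invariant too, hence an equivalence. Its backward
      direction pulls a preimage under \<open>F\<close> through \<open>t\<close>, which is where
      bijectivity of \<open>t\<close> enters.\<close>
    have inA: "t y \<in> A n \<longleftrightarrow> y \<in> A n" if "y \<in> N" for y n
      using that
    proof (induction n arbitrary: y)
      case 0
      then show ?case using t(2) tN by (auto simp: A0)
    next
      case (Suc n)
      show ?case
      proof
        assume "y \<in> A (Suc n)"
        then obtain w where w: "w \<in> A n" "y = F w" by (auto simp: ASuc)
        then have "w \<in> N" using A by blast
        then have "t y = F (t w)" "t w \<in> A n" using Suc.IH w t(3) by auto
        then show "t y \<in> A (Suc n)" by (simp add: ASuc)
      next
        assume "t y \<in> A (Suc n)"
        then obtain v where v: "v \<in> A n" "t y = F v" by (auto simp: ASuc)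
        then have "v \<in> N" using A by blast
        then obtain w where w: "w \<in> N" "v = t w" using t(1) by (auto simp: bij_betw_def)
        then have "w \<in> A n" using Suc.IH v by blast
        have "t y = t (F w)" using v w t(3) by auto
        then have "y = F w"
          using t(1) Suc.prems w FN DN by (auto simp: bij_betw_def dest!: inj_onD)
        then show "y \<in> A (Suc n)" using \<open>w \<in> A n\<close> by (simp add: ASuc)
      qed
    qed
    then have "t x \<in> Q \<longleftrightarrow> x \<in> Q" using x unfolding Q_def by blast
    then show ?thesis using t(3) x by (simp add: \<Gamma>_def)
  qed
  show ?thesis
  proof (intro exI conjI ballI allI impI)
    show "\<Gamma> \<in> M \<rightarrow>\<^sub>M M" "\<Lambda> \<in> M \<rightarrow>\<^sub>M M"
      unfolding \<Gamma>_def \<Lambda>_def using F L by measurable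
    show "\<Gamma> x \<in> D" "\<Lambda> (\<Gamma> x) = x" if "x \<in> N" for x
      using that FN notQ FQ LF by (auto simp: \<Gamma>_def \<Lambda>_def)
    show "\<Lambda> y \<in> N" "\<Gamma> (\<Lambda> y) = y" if "y \<in> D" for y
      using QD[of y] that QN DN by (auto simp: LFQ subset_iff \<Gamma>_def \<Lambda>_def)
  qed (use equiv in blast)
qed

text \<open>Dividing \<open>k\<close> by the representative of its right coset commutes with left
  multiplication by \<open>H\<close>. The representative of \<open>H\<close> itself may differ from
  \<one>, so the value \<one> is taken at \<open>inv (s \<one>)\<close>.\<close>

lemma (in group) coset_section:
  assumes H: "subgroup H G" and K: "subgroup K G" and HK: "H \<subseteq> K"
  shows "\<exists>s. (\<forall>k\<in>K. s k \<in> H) \<and> (\<forall>h\<in>H. \<forall>k\<in>K. s (h \<otimes> k) = h \<otimes> s k) \<and> (\<exists>k\<in>K. s k = \<one>)"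
proof -
  interpret H: subgroup H G by fact
  interpret K: subgroup K G by fact
  define rep where "rep k = (SOME r. r \<in> H #> k)" for k
  have rep: "rep k \<in> H #> k" if "k \<in> K" for k
    unfolding rep_def by (rule someI[of _ k]) (use that H.one_closed in \<open>auto simp: r_coset_def intro!: bexI[of _ \<one>]\<close>)
  define s where "s k = k \<otimes> inv (rep k)" for k
  have s: "s k \<in> H" "rep k \<in> carrier G" if k: "k \<in> K" for k
  proof -
    obtain h where h: "h \<in> H" "rep k = h \<otimes> k" using rep[OF k] by (auto simp: r_coset_def)
    have "s k = inv h" using h k by (simp add: s_def inv_mult_group m_assoc[symmetric])
    then show "s k \<in> H" "rep k \<in> carrier G" using h k by simp_all
  qed
  have equiv: "s (h \<otimes> k) = h \<otimes> s k" if "h \<in> H" "k \<in> K" for h k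
  proof -
    have "H #> (h \<otimes> k) = H #> k"
      using that coset_mult_assoc[OF H.subset, of h k] H.rcos_const[OF is_group] by simp
    then have "rep (h \<otimes> k) = rep k" by (simp add: rep_def)
    then show ?thesis using that s by (simp add: s_def m_assoc)
  qed
  have "s (inv (s \<one>) \<otimes> \<one>) = \<one>"
    using equiv[of "inv (s \<one>)" \<one>] s[of \<one>] by simp
  moreover have "inv (s \<one>) \<otimes> \<one> \<in> K" using s[of \<one>] HK by auto
  ultimately show ?thesis using s equiv by blast
qed

text \<open>This is left translation on \<open>K\<close> times the naturals, transported to the
  naturals; the second factor makes the set infinite even when \<open>K\<close> is finite. The
  section tells later which translate of a point coordinate \<open>n\<close> has to store, and
  coordinate \<open>n0\<close> stores the point itself.\<close>

lemma (in group) free_action_on_nat: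
  assumes H: "subgroup H G" and K: "subgroup K G" and HK: "H \<subseteq> K" and cK: "countable K"
  shows "\<exists>(p :: 'a \<Rightarrow> nat \<Rightarrow> nat) s n0. (\<forall>n. p \<one> n = n) \<and>
    (\<forall>g\<in>K. \<forall>h\<in>K. \<forall>n. p (g \<otimes> h) n = p g (p h n)) \<and> (\<forall>n. s n \<in> H) \<and>
    (\<forall>h\<in>H. \<forall>n. s (p h n) = h \<otimes> s n) \<and> s n0 = \<one>"
proof -
  interpret K: subgroup K G by fact
  obtain s k0 where s: "\<And>k. k \<in> K \<Longrightarrow> s k \<in> H" "\<And>h k. h \<in> H \<Longrightarrow> k \<in> K \<Longrightarrow> s (h \<otimes> k) = h \<otimes> s k"
    "k0 \<in> K" "s k0 = \<one>"
    using coset_section[OF H K HK] by blast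
  let ?E = "K \<times> (UNIV :: nat set)"
  define b where "b = from_nat_into ?E"
  have "infinite ?E"
    using K.one_closed finite_cartesian_productD2[of K "UNIV :: nat set"] infinite_UNIV_nat by blast
  then have b: "bij_betw b UNIV ?E"
    unfolding b_def using cK by (intro bij_betw_from_nat_into) auto
  define b' where "b' = inv_into UNIV b"
  have bb': "b (b' q) = q" if "q \<in> ?E" for q
    using b that unfolding b'_def by (metis bij_betw_inv_into_right)
  have b'b: "b' (b n) = n" for n
    using b unfolding b'_def by (metis UNIV_I bij_betw_inv_into_left)
  have bE: "fst (b n) \<in> K" for n
    using b by (metis UNIV_I bij_betwE mem_Times_iff)
  define p where "p g n = b' (g \<otimes> fst (b n), snd (b n))" for g n
  have bp: "b (p g n) = (g \<otimes> fst (b n), snd (b n))" if "g \<in> K" for g n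
    unfolding p_def using bE that by (intro bb') auto
  show ?thesis
  proof (intro exI conjI allI ballI)
    show "p \<one> n = n" for n using bE K.mem_carrier by (simp add: p_def b'b)
    show "p (g \<otimes> h) n = p g (p h n)" if "g \<in> K" "h \<in> K" for g h n
      using that bE[of n] K.mem_carrier by (simp add: p_def[of g] p_def[of "g \<otimes> h"] bp m_assoc)
    show "s (fst (b n)) \<in> H" for n using s bE by blast
    show "s (fst (b (p h n))) = h \<otimes> s (fst (b n))" if "h \<in> H" for h n
      using that HK s bE by (simp add: bp subset_iff)
    show "s (fst (b (b' (k0, 0)))) = \<one>" using s by (simp add: bb')
  qed
qed

lemma pred_countable_Ball:
  assumes X: "countable X" and P: "\<And>i. i \<in> X \<Longrightarrow> Measurable.pred M (P i)"
  shows "Measurable.pred M (\<lambda>x. \<forall>i\<in>X. P i x)"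
proof (cases "X = {}")
  case False
  have "(\<lambda>i. {x \<in> space M. P i x}) ` X \<subseteq> sets M" using P by (auto simp: pred_def)
  then have "(\<Inter>i\<in>X. {x \<in> space M. P i x}) \<in> sets M" using X False by (intro sets.countable_INT') auto
  moreover have "(\<Inter>i\<in>X. {x \<in> space M. P i x}) = {x \<in> space M. \<forall>i\<in>X. P i x}" using False by auto
  ultimately show ?thesis by (simp add: pred_def)
qed simp

section \<open>Near-homomorphisms, codes and the reserve\<close>

type_synonym index = "(nat \<times> nat) + (nat \<times> nat) + (nat \<times> nat \<times> nat)"

text \<open>The common form of near-actions and of homomorphisms to Aut(X,\<mu>): Borel
  representatives that multiply correctly off null sets. A single \<open>u g\<close> may fail to be
  bijective.\<close>

locale near_hom = group G + prob_space M
  for G :: "('g, 'b) monoid_scheme" (structure) and M :: "'x measure" +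
  fixes u :: "'g \<Rightarrow> 'x \<Rightarrow> 'x"
  assumes u_meas: "\<And>g. g \<in> carrier G \<Longrightarrow> u g \<in> M \<rightarrow>\<^sub>M M"
    and u_distr: "\<And>g. g \<in> carrier G \<Longrightarrow> distr M M (u g) = M"
    and u_one: "AE x in M. u \<one> x = x"
    and u_mult: "\<And>g h. g \<in> carrier G \<Longrightarrow> h \<in> carrier G \<Longrightarrow> AE x in M. u (g \<otimes> h) x = u g (u h x)"

lemma (in near_hom) AE_pullback:
  assumes "g \<in> carrier G" "AE x in M. P x"
  shows "AE x in M. P (u g x)"
proof -
  have "AE x in distr M M (u g). P x" using assms(2) unfolding u_distr[OF assms(1)] .
  then show ?thesis by (rule AE_distrD[OF u_meas[OF assms(1)]])
qed

text \<open>
  A point \<open>z\<close> of the reserve codes \<open>\<phi>\<close> by \<open>\<phi> i k = z (Inl (i, k))\<close>, the \<open>n\<close>-th name by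
  \<open>z (Inr (Inl (n, k)))\<close>, and the relation attached to it by \<open>z (Inr (Inr (n, i, j)))\<close>.
\<close>

locale near_hom_reserve = near_hom G M u
  for G :: "('g, 'b) monoid_scheme" (structure) and M :: "'x measure" and u +
  fixes e :: "'x \<Rightarrow> nat \<Rightarrow> bool" and c :: "(nat \<Rightarrow> bool) \<Rightarrow> 'x"
    and \<iota> :: "(index \<Rightarrow> bool) \<Rightarrow> 'x" and \<delta> :: "'x \<Rightarrow> index \<Rightarrow> bool" and Z0 :: "'x set"
    and nm :: "'g \<Rightarrow> nat \<Rightarrow> bool"
  assumes e_meas: "e \<in> M \<rightarrow>\<^sub>M cantor" and c_meas: "c \<in> cantor \<rightarrow>\<^sub>M M"
    and ce: "\<And>x. x \<in> space M \<Longrightarrow> c (e x) = x"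
    and \<iota>_meas: "\<iota> \<in> cantor \<rightarrow>\<^sub>M M" and \<delta>_meas: "\<delta> \<in> M \<rightarrow>\<^sub>M cantor"
    and \<delta>\<iota>: "\<And>z. \<delta> (\<iota> z) = z" and Z0: "Z0 \<in> null_sets M" "range \<iota> \<subseteq> Z0"
    and nm: "inj_on nm (carrier G)"
begin

text \<open>A code may name an element in several rows or in none, so the relations of all its rows
  are united.\<close>

definition table :: "(index \<Rightarrow> bool) \<Rightarrow> 'g \<Rightarrow> nat \<Rightarrow> nat \<Rightarrow> bool" where
  "table z g i j \<longleftrightarrow> (\<exists>n. (\<forall>k. z (Inr (Inl (n, k))) = nm g k) \<and> z (Inr (Inr (n, i, j))))"

text \<open>Only rows of elements of \<open>H\<close> are inspected, so validity passes to smaller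
  sets, and for countable \<open>H\<close> it is a Borel condition. When \<open>H\<close> is a
  subgroup, functions composing in this way are automatically permutations.\<close>

definition valid :: "'g set \<Rightarrow> (index \<Rightarrow> bool) \<Rightarrow> bool" where
  "valid H z \<longleftrightarrow> (\<forall>g\<in>H. \<forall>i. \<exists>!j. table z g i j) \<and> (\<forall>i. table z \<one> i i) \<and>
    (\<forall>g\<in>H. \<forall>h\<in>H. \<forall>i j k. table z h i j \<longrightarrow> table z g j k \<longrightarrow> table z (g \<otimes> h) i k)"

text \<open>The least witness is a measurable function of the code, valid or not.\<close>

definition perm :: "(index \<Rightarrow> bool) \<Rightarrow> 'g \<Rightarrow> nat \<Rightarrow> nat" where
  "perm z g i = (LEAST j. table z g i j)"

definition reindex :: "(nat \<Rightarrow> nat) \<Rightarrow> (index \<Rightarrow> bool) \<Rightarrow> index \<Rightarrow> bool" where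
  "reindex p z a = (case a of Inl (i, k) \<Rightarrow> z (Inl (p i, k)) | Inr b \<Rightarrow> z (Inr b))"

text \<open>Reindexing reverses composition, hence the inverse. The bits under \<open>Inr\<close>
  stay in place, so the table that governs the shift is itself unchanged by it.\<close>

definition shift :: "'g \<Rightarrow> (index \<Rightarrow> bool) \<Rightarrow> index \<Rightarrow> bool" where
  "shift g z = reindex (perm z (inv g)) z"

lemma reindex_simps [simp]:
  "reindex p z (Inl (i, k)) = z (Inl (p i, k))" "reindex p z (Inr b) = z (Inr b)"
  by (simp_all add: reindex_def)

lemma reindex_id: "reindex (\<lambda>n. n) z = z"
  by (auto simp: reindex_def fun_eq_iff split: sum.splits)

lemma reindex_comp: "reindex p (reindex q z) = reindex (\<lambda>n. q (p n)) z"
  by (auto simp: reindex_def fun_eq_iff split: sum.splits)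

lemma table_cong: "(\<And>b. z (Inr b) = z' (Inr b)) \<Longrightarrow> table z = table z'"
  by (simp add: table_def fun_eq_iff)

lemma table_reindex [simp]: "table (reindex p z) = table z"
  by (rule table_cong) simp

lemma perm_reindex [simp]: "perm (reindex p z) = perm z"
  by (simp add: perm_def fun_eq_iff)

lemma valid_reindex [simp]: "valid H (reindex p z) \<longleftrightarrow> valid H z"
  by (simp add: valid_def)

lemma valid_mono:
  assumes "valid K z" "H \<subseteq> K"
  shows "valid H z"
proof -
  have *: "\<forall>g\<in>K. \<forall>i. \<exists>!j. table z g i j" "\<forall>i. table z \<one> i i"
    "\<forall>g\<in>K. \<forall>h\<in>K. \<forall>i j k. table z h i j \<longrightarrow> table z g j k \<longrightarrow> table z (g \<otimes> h) i k"
    using assms(1) by (simp_all add: valid_def)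
  show ?thesis
    unfolding valid_def by (intro conjI ballI) (use * assms(2) in \<open>simp_all add: subset_iff\<close>)
qed

lemma perm_eqI:
  assumes "valid H z" "g \<in> H" "table z g i j"
  shows "perm z g i = j"
proof -
  have "\<exists>!j. table z g i j" using assms by (simp add: valid_def)
  then have "\<And>j'. table z g i j' \<Longrightarrow> j' = j" using assms(3) by blast
  then show ?thesis unfolding perm_def using assms(3) by (metis (mono_tags, lifting) LeastI)
qed

lemma table_perm:
  assumes "valid H z" "g \<in> H"
  shows "table z g i (perm z g i)"
proof -
  obtain j where "table z g i j" using assms unfolding valid_def by blast
  then show ?thesis using perm_eqI[OF assms] by metis
qed

lemma shift_one:
  assumes "valid H z" "\<one> \<in> H"
  shows "shift \<one> z = z"
proof -
  have "perm z \<one> i = i" for i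
    using assms perm_eqI[OF assms] by (simp add: valid_def)
  then have "perm z (inv \<one>) = (\<lambda>n. n)" by (auto simp: fun_eq_iff)
  then show ?thesis by (simp add: shift_def reindex_id)
qed

lemma shift_mult:
  assumes z: "valid H z" and H: "subgroup H G" and g: "g \<in> H" and h: "h \<in> H"
  shows "shift (g \<otimes> h) z = shift g (shift h z)"
proof -
  interpret H: subgroup H G by fact
  have "perm z (inv h \<otimes> inv g) i = perm z (inv h) (perm z (inv g) i)" for i
  proof (rule perm_eqI[OF z])
    show "table z (inv h \<otimes> inv g) i (perm z (inv h) (perm z (inv g) i))"
      using z table_perm[OF z, of "inv g" i] table_perm[OF z, of "inv h" "perm z (inv g) i"] g h H.m_inv_closed
      unfolding valid_def by blast
  qed (use g h in auto)
  moreover have "inv (g \<otimes> h) = inv h \<otimes> inv g"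
    using g h by (simp add: inv_mult_group)
  ultimately have "perm z (inv (g \<otimes> h)) = (\<lambda>i. perm z (inv h) (perm z (inv g) i))"
    by (simp add: fun_eq_iff)
  then show ?thesis by (simp add: shift_def reindex_comp)
qed

lemma valid_shift [simp]: "valid H (shift g z) \<longleftrightarrow> valid H z"
  by (simp add: shift_def)

lemma table_measurable [measurable]: "Measurable.pred cantor (\<lambda>z. table z g i j)"
  unfolding table_def by measurable

lemma valid_measurable:
  assumes "countable H"
  shows "Measurable.pred cantor (valid H)"
  unfolding valid_def Ex1_def using assms by measurable

lemma shift_measurable: "shift g \<in> cantor \<rightarrow>\<^sub>M cantor"
proof (rule measurable_cantorI)
  fix a :: index
  have p: "(\<lambda>z. perm z (inv g) i) \<in> cantor \<rightarrow>\<^sub>M count_space UNIV" for i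
    unfolding perm_def by measurable
  show "Measurable.pred cantor (\<lambda>z. shift g z a)"
  proof (cases a)
    case (Inl q)
    obtain i k where q: "q = (i, k)" by (cases q)
    have "Measurable.pred cantor (\<lambda>z. (\<lambda>j z. z (Inl (j, k))) (perm z (inv g) i) z)"
      by (rule measurable_compose_countable[OF _ p]) simp
    then show ?thesis by (simp add: shift_def Inl q)
  qed (simp add: shift_def)
qed

lemma reindex_measurable: "reindex p \<in> cantor \<rightarrow>\<^sub>M cantor"
proof (rule measurable_cantorI)
  show "Measurable.pred cantor (\<lambda>z. reindex p z a)" for a
    by (cases a) (auto split: prod.splits simp: reindex_def)
qed

lemma pred_eq_M:
  assumes f: "f \<in> N \<rightarrow>\<^sub>M M" and g: "g \<in> N \<rightarrow>\<^sub>M M"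
  shows "Measurable.pred N (\<lambda>x. f x = g x)"
proof -
  have [measurable]: "Measurable.pred N (\<lambda>x. e (f x) k)" "Measurable.pred N (\<lambda>x. e (g x) k)" for k
    using measurable_cantorD[OF measurable_compose[OF f e_meas]]
      measurable_cantorD[OF measurable_compose[OF g e_meas]] by auto
  have "(f x = g x) = (\<forall>k. e (f x) k = e (g x) k)" if x: "x \<in> space N" for x
  proof
    assume "\<forall>k. e (f x) k = e (g x) k"
    then have "e (f x) = e (g x)" by (simp add: fun_eq_iff)
    then have "c (e (f x)) = c (e (g x))" by simp
    then show "f x = g x" using ce measurable_space[OF f x] measurable_space[OF g x] by simp
  qed simp
  then have "Measurable.pred N (\<lambda>x. f x = g x) = Measurable.pred N (\<lambda>x. \<forall>k. e (f x) k = e (g x) k)"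
    by (intro measurable_cong)
  also have "\<dots>" by measurable
  finally show ?thesis .
qed

lemma \<iota>_in: "\<iota> z \<in> space M"
  using measurable_space[OF \<iota>_meas] by simp

text \<open>The range of \<open>\<iota>\<close>, written as the fixed points of
  \<open>\<iota>\<close> after \<open>\<delta>\<close> so that it is seen to be Borel.\<close>

definition Z :: "'x set" where
  "Z = {x \<in> space M. \<iota> (\<delta> x) = x}"

lemma Z_eq: "Z = range \<iota>"
proof (intro equalityI subsetI)
  fix x assume "x \<in> Z"
  then show "x \<in> range \<iota>" by (metis (mono_tags, lifting) Z_def mem_Collect_eq rangeI)
qed (auto simp: Z_def \<delta>\<iota> \<iota>_in)

lemma Z_sets: "Z \<in> sets M"
proof -
  have "Measurable.pred M (\<lambda>x. \<iota> (\<delta> x) = x)"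
    by (rule pred_eq_M[OF measurable_compose[OF \<delta>_meas \<iota>_meas]]) simp
  then show ?thesis by (simp add: Z_def pred_def)
qed

lemma Z_null: "Z \<in> null_sets M"
  using null_sets_subset[OF Z0(1) Z_sets] Z0(2) Z_eq by simp

text \<open>The last clause is the requirement on the reserve. A larger set has fewer valid codes,
  so on elements of \<open>H\<close> it never asks for more than the clause for \<open>H\<close>
  did.\<close>

definition partial_lift :: "'g set \<Rightarrow> ('g \<Rightarrow> 'x \<Rightarrow> 'x) \<Rightarrow> bool" where
  "partial_lift H h \<longleftrightarrow> (\<forall>g\<in>H. h g \<in> M \<rightarrow>\<^sub>M M) \<and> (\<forall>x\<in>space M. h \<one> x = x) \<and>
    (\<forall>g\<in>H. \<forall>g'\<in>H. \<forall>x\<in>space M. h (g \<otimes> g') x = h g (h g' x)) \<and>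
    (\<forall>g\<in>H. AE x in M. h g x = u g x) \<and> (\<forall>g\<in>H. \<forall>z. valid H z \<longrightarrow> h g (\<iota> z) = \<iota> (shift g z))"

text \<open>The rows follow an enumeration of \<open>H\<close>, possibly with repetitions, and each
  carries the graph of \<open>p\<close>. As names are distinct on the group, elements outside
  \<open>H\<close> receive no row.\<close>

lemma reserve_row:
  assumes H: "H \<subseteq> carrier G" "countable H" "H \<noteq> {}"
  shows "\<exists>r. (\<forall>z. (\<forall>b. z (Inr b) = r b) \<longrightarrow>
    (\<forall>g\<in>H. \<forall>i j. table z g i j \<longleftrightarrow> p g i = j) \<and> (\<forall>g\<in>carrier G - H. \<forall>i j. \<not> table z g i j))"
proof -
  define hh where "hh = from_nat_into H"
  have hh: "hh n \<in> H" for n unfolding hh_def by (rule from_nat_into[OF H(3)])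
  define r where "r b = (case b of Inl (n, k) \<Rightarrow> nm (hh n) k | Inr (n, i, j) \<Rightarrow> p (hh n) i = j)" for b
  have tab: "table z g i j \<longleftrightarrow> (\<exists>n. hh n = g \<and> p g i = j)"
    if z: "\<forall>b. z (Inr b) = r b" and g: "g \<in> carrier G" for z g i j
  proof -
    have "(\<forall>k. nm (hh n) k = nm g k) \<longleftrightarrow> hh n = g" for n
      using nm g hh[of n] H(1) by (auto simp: inj_on_def fun_eq_iff)
    then show ?thesis using z by (auto simp: table_def r_def)
  qed
  have "(\<exists>n. hh n = g) \<longleftrightarrow> g \<in> H" for g
    using hh from_nat_into_surj[OF H(2)] unfolding hh_def by metis
  then show ?thesis using tab H(1) by (intro exI[of _ r]) auto
qed

end

section \<open>The extension step\<close>

context near_hom_reserve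
begin

text \<open>The space splits into three pieces invariant under \<open>H\<close>. On the conull set
  \<open>X1\<close> the maps \<open>u g\<close> already form an action of \<open>K\<close> extending
  \<open>h\<close>; on \<open>ZK\<close> the requirement for \<open>K\<close> dictates the action;
  on the remaining set \<open>N\<close> the action of \<open>H\<close> must be extended. There
  \<open>D\<close> consists of codes that name exactly \<open>H\<close>.\<close>

lemma extend_partial_lift:
  assumes H: "subgroup H G" and K: "subgroup K G" and HK: "H \<subseteq> K" and neq: "H \<noteq> K"
    and cK: "countable K" and h: "partial_lift H h"
  shows "\<exists>k. partial_lift K k \<and> (\<forall>g\<in>H. k g = h g)"
proof -
  interpret H: subgroup H G by fact
  interpret K: subgroup K G by fact
  have cH: "countable H" using cK HK countable_subset by blast
  have HG: "g \<in> carrier G" if "g \<in> H" for g using that by simp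
  have KG: "g \<in> carrier G" if "g \<in> K" for g using that by simp
  have h_meas: "h g \<in> M \<rightarrow>\<^sub>M M" if "g \<in> H" for g
    using h that by (simp add: partial_lift_def)
  have h_one: "h \<one> x = x" if "x \<in> space M" for x
    using h that by (simp add: partial_lift_def)
  have h_mult: "h (g \<otimes> g') x = h g (h g' x)" if "g \<in> H" "g' \<in> H" "x \<in> space M" for g g' x
    using h that by (simp add: partial_lift_def)
  have h_AE: "AE x in M. h g x = u g x" if "g \<in> H" for g
    using h that by (simp add: partial_lift_def)
  have h_res: "h g (\<iota> z) = \<iota> (shift g z)" if "g \<in> H" "valid H z" for g z
    using h that by (simp add: partial_lift_def)
  have h_in: "h g x \<in> space M" if "g \<in> H" "x \<in> space M" for g x
    using measurable_space[OF h_meas] that by blast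
  have u_in: "u g x \<in> space M" if "g \<in> K" "x \<in> space M" for g x
    using measurable_space[OF u_meas] that KG by blast
  have h_inv: "h (inv g) (h g x) = x" "h g (h (inv g) x) = x" if "g \<in> H" "x \<in> space M" for g x
    using h_mult[of "inv g" g x] h_mult[of g "inv g" x] h_one that by auto

  \<comment> \<open>Every condition is imposed along the whole orbit under \<open>K\<close>, which
    makes \<open>X1\<close> invariant. Keeping orbits off \<open>Z\<close> leaves the entire reserve
    in the complement.\<close>
  define X1 where "X1 = {x \<in> space M. u \<one> x = x \<and> (\<forall>g\<in>K. u g x \<notin> Z \<and>
     (\<forall>g'\<in>K. u g (u g' x) = u (g \<otimes> g') x) \<and> (\<forall>g'\<in>H. h g' (u g x) = u g' (u g x)))}"
  have X1_sp: "x \<in> space M" if "x \<in> X1" for x using that by (simp add: X1_def)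
  have X1_AE: "AE x in M. x \<in> X1"
  proof -
    have 1: "AE x in M. u g x \<notin> Z" if "g \<in> K" for g
      using AE_pullback[OF KG[OF that] AE_not_in[OF Z_null]] .
    have 2: "AE x in M. \<forall>g'\<in>K. u g (u g' x) = u (g \<otimes> g') x" if g: "g \<in> K" for g
    proof (rule AE_ball_countable'[OF _ cK])
      fix g' assume "g' \<in> K"
      then show "AE x in M. u g (u g' x) = u (g \<otimes> g') x"
        using u_mult[OF KG[OF g] KG[of g']] by (simp add: eq_commute)
    qed
    have 3: "AE x in M. \<forall>g'\<in>H. h g' (u g x) = u g' (u g x)" if g: "g \<in> K" for g
    proof (rule AE_ball_countable'[OF _ cH])
      fix g' assume "g' \<in> H"
      then show "AE x in M. h g' (u g x) = u g' (u g x)"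
        using AE_pullback[OF KG[OF g] h_AE] by simp
    qed
    have "AE x in M. \<forall>g\<in>K. u g x \<notin> Z \<and>
     (\<forall>g'\<in>K. u g (u g' x) = u (g \<otimes> g') x) \<and> (\<forall>g'\<in>H. h g' (u g x) = u g' (u g x))"
      by (rule AE_ball_countable'[OF _ cK]) (intro AE_conjI 1 2 3)
    then show ?thesis using u_one by (auto simp: X1_def)
  qed
  have X1_sets: "X1 \<in> sets M"
  proof -
    have 1: "Measurable.pred M (\<lambda>x. u \<one> x = x)"
      by (rule pred_eq_M) (auto intro: u_meas)
    have 2: "Measurable.pred M (\<lambda>x. u g x \<notin> Z)" if "g \<in> K" for g
      using measurable_sets[OF u_meas[OF KG[OF that]] Z_sets] Z_sets u_meas[OF KG[OF that]] by measurable
    have 3: "Measurable.pred M (\<lambda>x. u g (u g' x) = u (g \<otimes> g') x)" if "g \<in> K" "g' \<in> K" for g g'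
      by (rule pred_eq_M[OF measurable_compose[OF u_meas u_meas] u_meas]) (use that KG in auto)
    have 4: "Measurable.pred M (\<lambda>x. h g' (u g x) = u g' (u g x))" if "g \<in> K" "g' \<in> H" for g g'
      by (rule pred_eq_M[OF measurable_compose[OF u_meas h_meas] measurable_compose[OF u_meas u_meas]])
        (use that KG HG in auto)
    have "Measurable.pred M (\<lambda>x. u \<one> x = x \<and> (\<forall>g\<in>K. u g x \<notin> Z \<and>
     (\<forall>g'\<in>K. u g (u g' x) = u (g \<otimes> g') x) \<and> (\<forall>g'\<in>H. h g' (u g x) = u g' (u g x))))"
      by (intro pred_intros_logic pred_countable_Ball[OF cK] pred_countable_Ball[OF cH] 1 2 3 4)
    then show ?thesis by (simp add: X1_def pred_def)
  qed
  have X1_one: "u \<one> x = x" if "x \<in> X1" for x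
    using that unfolding X1_def by blast
  have X1_uZ: "u g x \<notin> Z" if "x \<in> X1" "g \<in> K" for x g
    using that unfolding X1_def by blast
  have X1_mult: "u (g \<otimes> g') x = u g (u g' x)" if "x \<in> X1" "g \<in> K" "g' \<in> K" for x g g'
    using that unfolding X1_def by simp
  have X1_uh: "h g' (u g x) = u g' (u g x)" if "x \<in> X1" "g \<in> K" "g' \<in> H" for x g g'
    using that unfolding X1_def by blast
  have X1_inv: "u k x \<in> X1" if x: "x \<in> X1" and k: "k \<in> K" for x k
  proof -
    have eq: "u g (u k x) = u (g \<otimes> k) x" if "g \<in> K" for g
      using X1_mult[OF x that k] by simp
    have "u (g \<otimes> g') (u k x) = u g (u g' (u k x))" if g: "g \<in> K" "g' \<in> K" for g g'
      using g k eq X1_mult[OF x, of g "g' \<otimes> k"] KG by (simp add: m_assoc)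
    moreover have "u \<one> (u k x) = u k x" using eq[of \<one>] k KG by simp
    ultimately show ?thesis
      using u_in[OF k X1_sp[OF x]] X1_uZ[OF x] X1_uh[OF x] k by (simp add: X1_def eq)
  qed
  have X1_h: "h g x = u g x" if "x \<in> X1" "g \<in> H" for x g
    using X1_uh[OF that(1) K.one_closed that(2)] X1_one[OF that(1)] by simp
  have X1_Z: "x \<notin> Z" if "x \<in> X1" for x
    using X1_uZ[OF that K.one_closed] X1_one[OF that] by simp

  define ZK where "ZK = {x \<in> Z. valid K (\<delta> x)}"
  have ZK_sets: "ZK \<in> sets M"
  proof -
    have "Measurable.pred M (\<lambda>x. valid K (\<delta> x))"
      using measurable_compose[OF \<delta>_meas valid_measurable[OF cK]] .
    then have "Z \<inter> {x \<in> space M. valid K (\<delta> x)} \<in> sets M"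
      using Z_sets by (auto simp: pred_def)
    moreover have "ZK = Z \<inter> {x \<in> space M. valid K (\<delta> x)}" by (auto simp: ZK_def Z_def)
    ultimately show ?thesis by simp
  qed
  have ZK_iff: "x \<in> ZK \<longleftrightarrow> (\<exists>z. valid K z \<and> x = \<iota> z)" for x
  proof
    assume "x \<in> ZK"
    then show "\<exists>z. valid K z \<and> x = \<iota> z"
      unfolding ZK_def Z_def by (intro exI[of _ "\<delta> x"]) simp
  qed (auto simp: ZK_def Z_def \<delta>\<iota> \<iota>_in)
  have ZK_h: "h g x \<in> ZK" if "g \<in> H" "x \<in> ZK" for g x
  proof -
    obtain z where z: "valid K z" "x = \<iota> z" using \<open>x \<in> ZK\<close> ZK_iff by blast
    then have "h g x = \<iota> (shift g z)" using h_res[OF \<open>g \<in> H\<close> valid_mono[OF _ HK]] by simp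
    moreover have "valid K (shift g z)" using z by simp
    ultimately show ?thesis using ZK_iff by blast
  qed
  define N where "N = space M - X1 - ZK"
  have N_sets: "N \<in> sets M" using X1_sets ZK_sets by (auto simp: N_def)
  have N_sp: "x \<in> space M" if "x \<in> N" for x using that by (simp add: N_def)
  have N_h: "h g x \<in> N" if g: "g \<in> H" and x: "x \<in> N" for g x
  proof -
    have sp: "x \<in> space M" using N_sp[OF x] .
    have ig: "inv g \<in> H" using g by simp
    have "h g x \<notin> X1"
    proof
      assume a: "h g x \<in> X1"
      have "x = u (inv g) (h g x)" using X1_h[OF a ig] h_inv(1)[OF g sp] by simp
      then have "x \<in> X1" using X1_inv[OF a, of "inv g"] ig HK by auto
      then show False using x by (simp add: N_def)
    qed
    moreover have "h g x \<notin> ZK" using ZK_h[OF ig, of "h g x"] h_inv(1)[OF g sp] x by (auto simp: N_def)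
    ultimately show ?thesis using h_in[OF g sp] by (simp add: N_def)
  qed
  have N_bij: "bij_betw (h g) N N" if g: "g \<in> H" for g
    by (rule bij_betw_byWitness[where f' = "h (inv g)"])
      (use g h_inv[OF g N_sp] N_h in auto)

  obtain p :: "'g \<Rightarrow> nat \<Rightarrow> nat" and s n0 where p_one: "\<And>n. p \<one> n = n"
    and p_mult: "\<And>g g' n. g \<in> K \<Longrightarrow> g' \<in> K \<Longrightarrow> p (g \<otimes> g') n = p g (p g' n)"
    and s_in: "\<And>n. s n \<in> H" and s_p: "\<And>g n. g \<in> H \<Longrightarrow> s (p g n) = g \<otimes> s n" and s_n0: "s n0 = \<one>"
    using free_action_on_nat[OF H K HK cK] by blast
  have "H \<noteq> {}" using H.one_closed by blast
  from reserve_row[OF H.subset cH this, of p] obtain r where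
    rr: "\<forall>z. (\<forall>b. z (Inr b) = r b) \<longrightarrow> (\<forall>g\<in>H. \<forall>i j. table z g i j \<longleftrightarrow> p g i = j) \<and>
      (\<forall>g\<in>carrier G - H. \<forall>i j. \<not> table z g i j)"
    by (elim exE)
  define slice where "slice z \<longleftrightarrow> (\<forall>b. z (Inr b) = r b)" for z :: "index \<Rightarrow> bool"
  have slice_valid: "valid H z" if z: "slice z" for z
  proof -
    have tab: "table z g i j \<longleftrightarrow> p g i = j" if "g \<in> H" for g i j
      using rr z that by (simp add: slice_def)
    show ?thesis
      unfolding valid_def using p_one p_mult HK by (auto simp: tab subset_iff)
  qed
  have slice_shift: "shift g z = reindex (p (inv g)) z" if z: "slice z" and g: "g \<in> H" for g z
  proof -
    have "perm z (inv g) i = p (inv g) i" for i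
      by (rule perm_eqI[OF slice_valid[OF z]]) (use rr z g in \<open>simp_all add: slice_def\<close>)
    then have "perm z (inv g) = p (inv g)" by (simp add: fun_eq_iff)
    then show ?thesis by (simp add: shift_def)
  qed
  \<comment> \<open>An element of \<open>K\<close> outside \<open>H\<close> has no row, so the
    requirement for \<open>K\<close> is silent about the slice. This is what places \<open>D\<close>
    inside \<open>N\<close>.\<close>
  have slice_not_valid: "\<not> valid K z" if z: "slice z" for z
  proof
    assume v: "valid K z"
    obtain g where g: "g \<in> K" "g \<notin> H" using HK neq by blast
    then obtain j where "table z g 0 j" using v unfolding valid_def by blast
    then show False using rr z g KG by (simp add: slice_def)
  qed
  have slice_reindex: "slice (reindex q z) \<longleftrightarrow> slice z" for q z
    by (simp add: slice_def)
  define D where "D = {x \<in> Z. slice (\<delta> x)}"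
  have D_iff: "x \<in> D \<longleftrightarrow> (\<exists>z. slice z \<and> x = \<iota> z)" for x
  proof
    assume "x \<in> D"
    then show "\<exists>z. slice z \<and> x = \<iota> z"
      unfolding D_def Z_def by (intro exI[of _ "\<delta> x"]) simp
  qed (auto simp: D_def Z_def \<delta>\<iota> \<iota>_in)
  have D_sets: "D \<in> sets M"
  proof -
    have "Measurable.pred M (\<lambda>x. slice (\<delta> x))"
      unfolding slice_def using \<delta>_meas by measurable
    then have "Z \<inter> {x \<in> space M. slice (\<delta> x)} \<in> sets M"
      using Z_sets by (auto simp: pred_def)
    moreover have "D = Z \<inter> {x \<in> space M. slice (\<delta> x)}" by (auto simp: D_def Z_def)
    ultimately show ?thesis by simp
  qed
  have D_N: "D \<subseteq> N"
  proof
    fix x assume "x \<in> D"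
    then have "x \<in> Z" "x \<notin> ZK" using slice_not_valid by (auto simp: D_def ZK_def)
    then show "x \<in> N" using X1_Z by (auto simp: N_def Z_def)
  qed
  \<comment> \<open>The table of a code in \<open>D\<close> knows only \<open>H\<close>, but its
    relations come from the action \<open>p\<close> of all of \<open>K\<close>. Reindexing by
    \<open>p\<close> therefore extends the action of \<open>H\<close> on \<open>D\<close> to
    \<open>K\<close>.\<close>
  define \<beta> where "\<beta> g x = \<iota> (reindex (p (inv g)) (\<delta> x))" for g x
  have \<beta>_meas: "\<beta> g \<in> M \<rightarrow>\<^sub>M M" for g
    unfolding \<beta>_def using measurable_compose[OF measurable_compose[OF \<delta>_meas reindex_measurable] \<iota>_meas] .
  have \<beta>_D: "\<beta> g x \<in> D" if "x \<in> D" for g x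
  proof -
    have "slice (reindex (p (inv g)) (\<delta> x))" using that slice_reindex by (simp add: D_def)
    then show ?thesis unfolding D_iff \<beta>_def by blast
  qed
  have \<beta>_one: "\<beta> \<one> x = x" if "x \<in> D" for x
  proof -
    have "p (inv \<one>) = (\<lambda>n. n)" using p_one by auto
    then show ?thesis using that by (simp add: \<beta>_def reindex_id D_def Z_def)
  qed
  have \<beta>_mult: "\<beta> (g \<otimes> g') x = \<beta> g (\<beta> g' x)" if "g \<in> K" "g' \<in> K" for g g' x
  proof -
    have "inv (g \<otimes> g') = inv g' \<otimes> inv g" using that KG by (simp add: inv_mult_group)
    then have "p (inv (g \<otimes> g')) = (\<lambda>n. p (inv g') (p (inv g) n))"
      using that p_mult by (simp add: fun_eq_iff)
    then show ?thesis by (simp add: \<beta>_def \<delta>\<iota> reindex_comp)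
  qed
  have \<beta>_h: "h g x = \<beta> g x" if "g \<in> H" "x \<in> D" for g x
  proof -
    obtain z where z: "slice z" "x = \<iota> z" using \<open>x \<in> D\<close> D_iff by blast
    then have "h g x = \<iota> (shift g z)" using h_res[OF \<open>g \<in> H\<close> slice_valid] by simp
    then show ?thesis using z slice_shift[OF z(1) \<open>g \<in> H\<close>] by (simp add: \<beta>_def \<delta>\<iota>)
  qed

  \<comment> \<open>The orbit map into the shift: coordinate \<open>n\<close> stores the translate
    of \<open>y\<close> by the inverse of \<open>s n\<close>. Equivariance is the identity
    \<open>s (p g n) = g \<otimes> s n\<close>, and \<open>L\<close> recovers \<open>y\<close> from
    coordinate \<open>n0\<close>, where \<open>s n0 = \<one>\<close>.\<close>
  define F where "F y = \<iota> (\<lambda>a. case a of Inl (n, k) \<Rightarrow> e (h (inv (s n)) y) k | Inr b \<Rightarrow> r b)" for y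
  define L where "L x = c (\<lambda>k. \<delta> x (Inl (n0, k)))" for x
  have F_meas: "F \<in> M \<rightarrow>\<^sub>M M"
    unfolding F_def
  proof (rule measurable_compose[OF measurable_cantorI \<iota>_meas])
    fix a :: index
    show "Measurable.pred M (\<lambda>y. case a of Inl (n, k) \<Rightarrow> e (h (inv (s n)) y) k | Inr b \<Rightarrow> r b)"
    proof (cases a)
      case (Inl q)
      obtain n k where q: "q = (n, k)" by (cases q)
      have "h (inv (s n)) \<in> M \<rightarrow>\<^sub>M M" using h_meas s_in by simp
      then have "Measurable.pred M (\<lambda>y. e (h (inv (s n)) y) k)"
        using measurable_cantorD[OF measurable_compose[OF _ e_meas]] by blast
      then show ?thesis by (simp add: Inl q)
    qed simp
  qed
  have L_meas: "L \<in> M \<rightarrow>\<^sub>M M"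
    unfolding L_def
    by (rule measurable_compose[OF measurable_cantorI c_meas]) (use \<delta>_meas in measurable)
  have F_D: "F y \<in> D" for y
    unfolding D_iff F_def
    by (intro exI[of _ "\<lambda>a. case a of Inl (n, k) \<Rightarrow> e (h (inv (s n)) y) k | Inr b \<Rightarrow> r b"]) (simp add: slice_def)
  have LF: "L (F y) = y" if "y \<in> space M" for y
    using ce[OF that] h_one[OF that] by (simp add: L_def F_def \<delta>\<iota> s_n0)
  have F_equiv: "F (h g y) = h g (F y)" if g: "g \<in> H" and y: "y \<in> space M" for g y
  proof -
    have "h (inv (s (p (inv g) n))) y = h (inv (s n)) (h g y)" for n
    proof -
      have "s (p (inv g) n) = inv g \<otimes> s n" using s_p g by simp
      then have "inv (s (p (inv g) n)) = inv (s n) \<otimes> g"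
        using g s_in[of n] HG by (simp add: inv_mult_group)
      then show ?thesis using h_mult[of "inv (s n)" g y] g y s_in by simp
    qed
    moreover have "h g (F y) = \<beta> g (F y)" using \<beta>_h[OF g F_D] .
    ultimately show ?thesis
      by (auto simp: \<beta>_def F_def \<delta>\<iota> reindex_def intro!: arg_cong[where f = \<iota>] split: sum.splits)
  qed
  have "Measurable.pred M (\<lambda>x. F (L x) = x)"
    by (rule pred_eq_M[OF measurable_compose[OF L_meas F_meas]]) simp
  then have "\<exists>\<Gamma> \<Lambda>. \<Gamma> \<in> M \<rightarrow>\<^sub>M M \<and> \<Lambda> \<in> M \<rightarrow>\<^sub>M M \<and> (\<forall>x\<in>N. \<Gamma> x \<in> D \<and> \<Lambda> (\<Gamma> x) = x) \<and>
    (\<forall>y\<in>D. \<Lambda> y \<in> N \<and> \<Gamma> (\<Lambda> y) = y) \<and>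
    (\<forall>t. bij_betw t N N \<longrightarrow> (\<forall>x\<in>N. t x \<in> D \<longleftrightarrow> x \<in> D) \<longrightarrow> (\<forall>x\<in>N. F (t x) = t (F x)) \<longrightarrow>
      (\<forall>x\<in>N. \<Gamma> (t x) = t (\<Gamma> x)))"
    by (intro equivariant_schroeder_bernstein[OF N_sets D_sets D_N F_meas L_meas])
      (use F_D LF N_sp in auto)
  then obtain \<Gamma> \<Lambda> where \<Gamma>_meas: "\<Gamma> \<in> M \<rightarrow>\<^sub>M M" and \<Lambda>_meas: "\<Lambda> \<in> M \<rightarrow>\<^sub>M M"
    and \<Gamma>': "\<forall>x\<in>N. \<Gamma> x \<in> D \<and> \<Lambda> (\<Gamma> x) = x"
    and \<Lambda>': "\<forall>y\<in>D. \<Lambda> y \<in> N \<and> \<Gamma> (\<Lambda> y) = y"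
    and equiv: "\<forall>t. bij_betw t N N \<longrightarrow> (\<forall>x\<in>N. t x \<in> D \<longleftrightarrow> x \<in> D) \<longrightarrow> (\<forall>x\<in>N. F (t x) = t (F x)) \<longrightarrow>
      (\<forall>x\<in>N. \<Gamma> (t x) = t (\<Gamma> x))"
    by (elim exE conjE)
  have \<Gamma>: "\<Gamma> x \<in> D" "\<Lambda> (\<Gamma> x) = x" if "x \<in> N" for x using \<Gamma>' that by auto
  have \<Lambda>: "\<Lambda> y \<in> N" "\<Gamma> (\<Lambda> y) = y" if "y \<in> D" for y using \<Lambda>' that by auto
  have \<Gamma>_h: "\<Gamma> (h g x) = h g (\<Gamma> x)" if g: "g \<in> H" and x: "x \<in> N" for g x
  proof (rule equiv[rule_format, OF N_bij[OF g] _ _ x])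
    have "h g' y \<in> D" if "g' \<in> H" "y \<in> D" for g' y
      using that \<beta>_h \<beta>_D by simp
    then show "h g y \<in> D \<longleftrightarrow> y \<in> D" if "y \<in> N" for y
      using g h_inv(1)[OF g N_sp[OF that]] by (metis H.m_inv_closed)
    show "F (h g y) = h g (F y)" if "y \<in> N" for y using F_equiv g N_sp[OF that] by blast
  qed

  \<comment> \<open>On \<open>N\<close> the action of \<open>K\<close> on \<open>D\<close> is
    transported along \<open>\<Gamma>\<close>. Off the space \<open>k\<close> copies
    \<open>h\<close>, so that the two are equal as functions for elements of
    \<open>H\<close>.\<close>
  define k where "k g x = (if x \<notin> space M then h g x else if x \<in> X1 then u g x
    else if x \<in> ZK then \<iota> (shift g (\<delta> x)) else \<Lambda> (\<beta> g (\<Gamma> x)))" for g x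
  have k_X1: "k g x = u g x" if "x \<in> X1" for g x
    using that X1_sp by (simp add: k_def)
  have k_ZK: "k g (\<iota> z) = \<iota> (shift g z)" if "valid K z" for g z
  proof -
    have "\<iota> z \<in> ZK" using that ZK_iff by blast
    moreover have "\<iota> z \<notin> X1" using X1_Z[of "\<iota> z"] Z_eq by blast
    ultimately show ?thesis by (simp add: k_def \<iota>_in \<delta>\<iota>)
  qed
  have k_N: "k g x = \<Lambda> (\<beta> g (\<Gamma> x))" if "x \<in> N" for g x
    using that by (simp add: k_def N_def)
  have cases: thesis if "x \<in> space M" "x \<in> X1 \<Longrightarrow> thesis" "\<And>z. valid K z \<Longrightarrow> x = \<iota> z \<Longrightarrow> thesis"
    "x \<in> N \<Longrightarrow> thesis" for x thesis
    using that ZK_iff[of x] unfolding N_def by blast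
  have "partial_lift K k"
    unfolding partial_lift_def
  proof (intro conjI ballI allI impI)
    fix g assume g: "g \<in> K"
    have m1: "(\<lambda>x. \<iota> (shift g (\<delta> x))) \<in> M \<rightarrow>\<^sub>M M"
      using measurable_compose[OF measurable_compose[OF \<delta>_meas shift_measurable] \<iota>_meas] .
    have m2: "(\<lambda>x. \<Lambda> (\<beta> g (\<Gamma> x))) \<in> M \<rightarrow>\<^sub>M M"
      using measurable_compose[OF measurable_compose[OF \<Gamma>_meas \<beta>_meas] \<Lambda>_meas] .
    have "(\<lambda>x. if x \<in> X1 then u g x else if x \<in> ZK then \<iota> (shift g (\<delta> x)) else \<Lambda> (\<beta> g (\<Gamma> x))) \<in> M \<rightarrow>\<^sub>M M"
      using X1_sets ZK_sets u_meas[OF KG[OF g]] m1 m2 by measurable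
    moreover have "k g x = (if x \<in> X1 then u g x else if x \<in> ZK then \<iota> (shift g (\<delta> x)) else \<Lambda> (\<beta> g (\<Gamma> x)))"
      if "x \<in> space M" for x using that by (simp add: k_def)
    ultimately show "k g \<in> M \<rightarrow>\<^sub>M M" by (simp cong: measurable_cong)
    show "AE x in M. k g x = u g x" using X1_AE k_X1 by (auto elim: AE_mp)
    show "k g (\<iota> z) = \<iota> (shift g z)" if "valid K z" for z using k_ZK that by simp
  next
    fix x assume "x \<in> space M"
    then show "k \<one> x = x"
      by (rule cases) (use k_X1 X1_one k_ZK shift_one k_N \<beta>_one \<Gamma> in auto)
  next
    fix g g' x assume g: "g \<in> K" "g' \<in> K" and "x \<in> space M"
    from this(3) show "k (g \<otimes> g') x = k g (k g' x)"
    proof (rule cases)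
      assume "x \<in> X1"
      then show ?thesis using k_X1 X1_mult X1_inv g by simp
    next
      fix z assume "valid K z" "x = \<iota> z"
      then show ?thesis using k_ZK shift_mult[OF _ K g] by simp
    next
      assume x: "x \<in> N"
      then have "\<Lambda> (\<beta> g' (\<Gamma> x)) \<in> N" using \<Gamma> \<beta>_D \<Lambda> by simp
      then show ?thesis using k_N x \<Gamma> \<Lambda> \<beta>_D \<beta>_mult g by simp
    qed
  qed
  moreover have "k g x = h g x" if g: "g \<in> H" for g x
  proof (cases "x \<in> space M")
    case True
    then show ?thesis
    proof (rule cases)
      assume "x \<in> X1"
      then show ?thesis using k_X1 X1_h g by simp
    next
      fix z assume "valid K z" "x = \<iota> z"
      then show ?thesis using k_ZK h_res[OF g valid_mono[OF _ HK]] by simp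
    next
      assume x: "x \<in> N"
      have "\<Lambda> (\<beta> g (\<Gamma> x)) = \<Lambda> (\<Gamma> (h g x))" using \<Gamma>_h[OF g x] \<beta>_h[OF g \<Gamma>(1)[OF x]] by simp
      also have "\<dots> = h g x" using \<Gamma>(2) N_h[OF g x] by simp
      finally show ?thesis using k_N[OF x] by simp
    qed
  qed (simp add: k_def)
  ultimately show ?thesis by (intro exI[of _ k]) (simp add: fun_eq_iff)
qed

end

section \<open>Lifting along a well-order\<close>

lemma (in group) countable_generate:
  assumes I: "I \<subseteq> carrier G" "countable I"
  shows "countable (generate G I)"
proof -
  let ?A = "I \<union> (\<lambda>g. inv g) ` I"
  define w where "w xs = foldr (\<otimes>) xs \<one>" for xs
  have A: "?A \<subseteq> carrier G" using I by auto
  have w: "w xs \<in> carrier G" if "set xs \<subseteq> ?A" for xs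
    using that A unfolding w_def by (induction xs) auto
  have app: "w (xs @ ys) = w xs \<otimes> w ys" if "set xs \<subseteq> ?A" "set ys \<subseteq> ?A" for xs ys
    using that(1)
  proof (induction xs)
    case Nil
    then show ?case using w[OF that(2)] by (simp add: w_def)
  next
    case (Cons x xs)
    then have "x \<in> carrier G" "w xs \<in> carrier G" using A w by auto
    moreover have "w (x # xs @ ys) = x \<otimes> w (xs @ ys)" "w (x # xs) = x \<otimes> w xs" by (simp_all add: w_def)
    ultimately show ?case using Cons w[OF that(2)] by (simp add: m_assoc)
  qed
  have "\<exists>xs\<in>lists ?A. g = w xs" if "g \<in> generate G I" for g
    using that
  proof (induction rule: generate.induct)
    case one
    then show ?case by (intro bexI[of _ "[]"]) (auto simp: w_def)
  next
    case (incl h)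
    then show ?case using I by (intro bexI[of _ "[h]"]) (auto simp: w_def)
  next
    case (inv h)
    then show ?case using I by (intro bexI[of _ "[inv h]"]) (auto simp: w_def)
  next
    case (eng h1 h2)
    then obtain xs ys where "xs \<in> lists ?A" "ys \<in> lists ?A" "h1 = w xs" "h2 = w ys" by blast
    then show ?case using app[of xs ys] by (intro bexI[of _ "xs @ ys"]) (auto simp: lists_eq_set)
  qed
  then have "generate G I \<subseteq> w ` lists ?A" by blast
  moreover have "countable (w ` lists ?A)" using I by (intro countable_image countable_lists) auto
  ultimately show ?thesis by (rule countable_subset)
qed

context near_hom_reserve
begin

lemma partial_lift_trivial: "partial_lift (generate G {}) (\<lambda>g x. x)"
proof -
  have "generate G {} = {\<one>}" by (rule generate_empty)
  then show ?thesis
    using u_one shift_one[of "{\<one>}"] unfolding partial_lift_def by (auto simp: eq_commute)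
qed

text \<open>Zorn's lemma takes the place of a transfinite recursion. A segment that misses an
  element is countable and so generates a countable subgroup, to which the extension step applies.
  At unions, a code valid for the union is valid for each member, so the requirement on the reserve
  persists.\<close>

lemma exists_full_lift:
  assumes card: "card_le_aleph1 (carrier G)"
  shows "\<exists>h. partial_lift (carrier G) h"
proof -
  \<comment> \<open>A cardinal order: the strict predecessors of an element have smaller cardinality
    than the group, hence are countable.\<close>
  define r where "r = |carrier G|"
  have wo: "well_order_on (carrier G) r" unfolding r_def by (rule card_of_well_order_on)
  have Fr: "Field r = carrier G" unfolding r_def by (rule Field_card_of)
  have cnt: "countable (underS r a)" if "a \<in> carrier G" for a
  proof -
    have "Card_order r" unfolding r_def by (rule card_of_Card_order)
    then have "|underS r a| <o r"
      by (rule card_of_underS) (use that Fr in blast)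
    then have "|underS r a| <o cardSuc natLeq"
      using card unfolding card_le_aleph1_def r_def by (rule ordLess_ordLeq_trans)
    then show ?thesis
      using cardSuc_ordLeq_ordLess[OF natLeq_Card_order card_of_Card_order[of "underS r a"]]
      unfolding countable_card_le_natLeq by blast
  qed
  define seg where "seg I \<longleftrightarrow> I \<subseteq> carrier G \<and> (\<forall>a\<in>I. \<forall>b. (b, a) \<in> r \<longrightarrow> b \<in> I)" for I
  \<comment> \<open>The segment is recorded next to the graph of the lift, so that inclusion orders both.\<close>
  define pack where "pack I h = Inl ` I \<union> (\<lambda>g. Inr (g, h g)) ` generate G I" for I and h :: "'g \<Rightarrow> 'x \<Rightarrow> 'x"
  define \<A> where "\<A> = {pack I h | I h. seg I \<and> partial_lift (generate G I) h}"
  have pack_mono: "g \<in> generate G J \<and> k g = h g"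
    if "pack I h \<subseteq> pack J k" "g \<in> generate G I" for I J h k g
  proof -
    have "Inr (g, h g) \<in> pack I h" using that(2) unfolding pack_def by blast
    then have "Inr (g, h g) \<in> pack J k" using that(1) by blast
    then show ?thesis unfolding pack_def by auto
  qed
  have "\<exists>m\<in>\<A>. \<forall>X\<in>\<A>. m \<subseteq> X \<longrightarrow> X = m"
  proof (rule subset_Zorn_nonempty)
    have "seg {}" by (simp add: seg_def)
    then show "\<A> \<noteq> {}" using partial_lift_trivial unfolding \<A>_def by blast
  next
    fix \<C> assume ne: "\<C> \<noteq> {}" and ch: "subset.chain \<A> \<C>"
    have "\<forall>Y\<in>\<C>. \<exists>I h. Y = pack I h \<and> seg I \<and> partial_lift (generate G I) h"
      using ch unfolding subset.chain_def \<A>_def by blast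
    then obtain I h where Ih: "\<And>Y. Y \<in> \<C> \<Longrightarrow> Y = pack (I Y) (h Y)" "\<And>Y. Y \<in> \<C> \<Longrightarrow> seg (I Y)"
      "\<And>Y. Y \<in> \<C> \<Longrightarrow> partial_lift (generate G (I Y)) (h Y)"
      by metis
    define H where "H Y = generate G (I Y)" for Y
    have pl: "partial_lift (H Y) (h Y)" if "Y \<in> \<C>" for Y
      unfolding H_def using Ih(3)[OF that] .
    have sg: "subgroup (H Y) G" if "Y \<in> \<C>" for Y
      unfolding H_def using Ih(2)[OF that] by (intro generate_is_subgroup) (simp add: seg_def)
    have lin: "Y \<subseteq> Y' \<or> Y' \<subseteq> Y" if "Y \<in> \<C>" "Y' \<in> \<C>" for Y Y'
      using ch that unfolding subset.chain_def by blast
    have mono: "g \<in> H Y' \<and> h Y' g = h Y g" if "Y \<in> \<C>" "Y' \<in> \<C>" "Y \<subseteq> Y'" "g \<in> H Y" for Y Y' g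
      using pack_mono[of "I Y" "h Y" "I Y'" "h Y'" g] Ih(1) that unfolding H_def by metis
    \<comment> \<open>The choice is immaterial, since two members of a chain agree on the smaller
      subgroup.\<close>
    define h' where "h' g = h (SOME Y. Y \<in> \<C> \<and> g \<in> H Y) g" for g
    have h': "h' g = h Y g" if Y: "Y \<in> \<C>" "g \<in> H Y" for Y g
    proof -
      define Y' where "Y' = (SOME Y. Y \<in> \<C> \<and> g \<in> H Y)"
      have Y': "Y' \<in> \<C>" "g \<in> H Y'" using someI[of "\<lambda>Y. Y \<in> \<C> \<and> g \<in> H Y" Y] Y unfolding Y'_def by auto
      then show ?thesis using lin[OF Y(1) Y'(1)] mono Y unfolding h'_def Y'_def[symmetric] by metis
    qed
    have two: "\<exists>Y\<in>\<C>. g \<in> H Y \<and> g' \<in> H Y" if gg: "g \<in> \<Union>(H ` \<C>)" "g' \<in> \<Union>(H ` \<C>)" for g g'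
    proof -
      obtain Y Y' where Y: "Y \<in> \<C>" "g \<in> H Y" and Y': "Y' \<in> \<C>" "g' \<in> H Y'" using gg by auto
      from lin[OF Y(1) Y'(1)] show ?thesis
      proof
        assume "Y \<subseteq> Y'"
        then show ?thesis using mono[OF Y(1) Y'(1) _ Y(2)] Y' by blast
      next
        assume "Y' \<subseteq> Y"
        then show ?thesis using mono[OF Y'(1) Y(1) _ Y'(2)] Y by blast
      qed
    qed
    have sgU: "subgroup (\<Union>(H ` \<C>)) G"
    proof (rule subgroupI)
      show "\<Union>(H ` \<C>) \<subseteq> carrier G" using subgroup.subset[OF sg] by blast
      show "\<Union>(H ` \<C>) \<noteq> {}" using ne subgroup.one_closed[OF sg] by blast
      show "inv a \<in> \<Union>(H ` \<C>)" if "a \<in> \<Union>(H ` \<C>)" for a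
        using that subgroup.m_inv_closed[OF sg] by blast
      show "a \<otimes> b \<in> \<Union>(H ` \<C>)" if "a \<in> \<Union>(H ` \<C>)" "b \<in> \<Union>(H ` \<C>)" for a b
        using two[OF that] subgroup.m_closed[OF sg] by blast
    qed
    have gen: "generate G (\<Union>(I ` \<C>)) = \<Union>(H ` \<C>)"
    proof (rule antisym)
      have "I Y \<subseteq> H Y" for Y unfolding H_def by (auto intro: generate.incl)
      then have "\<Union>(I ` \<C>) \<subseteq> \<Union>(H ` \<C>)" by blast
      then show "generate G (\<Union>(I ` \<C>)) \<subseteq> \<Union>(H ` \<C>)" using sgU by (rule generate_subgroup_incl)
      show "\<Union>(H ` \<C>) \<subseteq> generate G (\<Union>(I ` \<C>))"
        unfolding H_def by (intro UN_least mono_generate) blast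
    qed
    have "seg (\<Union>(I ` \<C>))"
      unfolding seg_def
    proof (intro conjI ballI allI impI)
      show "\<Union>(I ` \<C>) \<subseteq> carrier G" using Ih(2) by (auto simp: seg_def)
      fix a b assume "a \<in> \<Union>(I ` \<C>)" and ba: "(b, a) \<in> r"
      then obtain Y where Y: "Y \<in> \<C>" "a \<in> I Y" by blast
      then have "b \<in> I Y" using Ih(2)[OF Y(1)] ba unfolding seg_def by blast
      then show "b \<in> \<Union>(I ` \<C>)" using Y by blast
    qed
    moreover have "partial_lift (\<Union>(H ` \<C>)) h'"
      unfolding partial_lift_def
    proof (intro conjI ballI allI impI)
      fix g assume "g \<in> \<Union>(H ` \<C>)"
      then obtain Y where Y: "Y \<in> \<C>" "g \<in> H Y" by blast
      note p = pl[OF Y(1), unfolded partial_lift_def]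
      show "h' g \<in> M \<rightarrow>\<^sub>M M" "AE x in M. h' g x = u g x" using p Y h'[OF Y] by simp_all
      show "h' g (\<iota> z) = \<iota> (shift g z)" if "valid (\<Union>(H ` \<C>)) z" for z
      proof -
        have "valid (H Y) z" by (rule valid_mono[OF that]) (use Y in blast)
        then show ?thesis using p Y h'[OF Y] by simp
      qed
    next
      fix x assume x: "x \<in> space M"
      obtain Y where Y: "Y \<in> \<C>" using ne by blast
      have "\<one> \<in> H Y" using sg[OF Y] by (rule subgroup.one_closed)
      then show "h' \<one> x = x" using h'[OF Y] pl[OF Y] x unfolding partial_lift_def by simp
    next
      fix g g' x assume g: "g \<in> \<Union>(H ` \<C>)" "g' \<in> \<Union>(H ` \<C>)" and x: "x \<in> space M"
      obtain Y where Y: "Y \<in> \<C>" "g \<in> H Y" "g' \<in> H Y" using two[OF g] by blast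
      have "g \<otimes> g' \<in> H Y" using sg[OF Y(1)] Y by (simp add: subgroup.m_closed)
      then show "h' (g \<otimes> g') x = h' g (h' g' x)"
        using h'[OF Y(1)] Y x pl[OF Y(1), unfolded partial_lift_def] by simp
    qed
    moreover have "\<Union>\<C> = pack (\<Union>(I ` \<C>)) h'"
    proof -
      have Yeq: "Y = Inl ` I Y \<union> (\<lambda>g. Inr (g, h' g)) ` H Y" if Y: "Y \<in> \<C>" for Y
      proof -
        have "(\<lambda>g. Inr (g, h' g) :: 'g + _) ` H Y = (\<lambda>g. Inr (g, h Y g)) ` H Y" using h'[OF Y] by (intro image_cong) auto
        then show ?thesis using Ih(1)[OF Y] unfolding pack_def H_def by simp
      qed
      have "\<Union>\<C> = (\<Union>Y\<in>\<C>. Y)" by simp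
      also have "\<dots> = (\<Union>Y\<in>\<C>. Inl ` I Y \<union> (\<lambda>g. Inr (g, h' g)) ` H Y)"
        by (rule SUP_cong[OF refl]) (rule Yeq)
      also have "\<dots> = pack (\<Union>(I ` \<C>)) h'" unfolding pack_def gen by (simp add: UN_Un_distrib image_UN)
      finally show ?thesis .
    qed
    ultimately show "\<Union>\<C> \<in> \<A>"
      unfolding \<A>_def gen[symmetric] by blast
  qed
  then obtain m where m: "m \<in> \<A>" and mx: "\<forall>X\<in>\<A>. m \<subseteq> X \<longrightarrow> X = m" by (elim bexE)
  from m obtain I h where mIh: "m = pack I h" and I: "seg I" and h: "partial_lift (generate G I) h"
    unfolding \<A>_def by blast
  have max: "pack J k = pack I h" if "seg J" "partial_lift (generate G J) k" "pack I h \<subseteq> pack J k" for J k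
  proof -
    have "pack J k \<in> \<A>" using that unfolding \<A>_def by blast
    then show ?thesis using mx that(3) unfolding mIh by blast
  qed
  have IG: "I \<subseteq> carrier G" using I by (simp add: seg_def)
  have "I = carrier G"
  proof (rule ccontr)
    assume "I \<noteq> carrier G"
    then have "carrier G - I \<noteq> {}" using IG by blast
    moreover have "wf (r - Id)" using wo by (simp add: well_order_on_def)
    ultimately obtain a where "a \<in> carrier G - I" and amin: "\<And>b. (b, a) \<in> r - Id \<Longrightarrow> b \<notin> carrier G - I"
      using wfE_min[of "r - Id" _ "carrier G - I"] by blast
    then have a: "a \<in> carrier G" "a \<notin> I" by auto
    have lin: "linear_order_on (carrier G) r" using wo by (simp add: well_order_on_def)
    have rsub: "b \<in> carrier G" if "(b, c) \<in> r" for b c using that Fr by (auto simp: Field_def)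
    have "I \<subseteq> underS r a"
    proof
      fix b assume b: "b \<in> I"
      then have "(a, b) \<notin> r" "a \<noteq> b" using I a unfolding seg_def by auto
      then have "(b, a) \<in> r"
        using lin a b IG unfolding linear_order_on_def total_on_def by auto
      then show "b \<in> underS r a" using \<open>a \<noteq> b\<close> by (simp add: underS_def)
    qed
    then have cI: "countable I" using cnt[OF a(1)] countable_subset by blast
    let ?J = "insert a I"
    have J: "seg ?J"
      unfolding seg_def
    proof (intro conjI ballI allI impI)
      show "?J \<subseteq> carrier G" using a IG by blast
      fix x b assume x: "x \<in> ?J" and b: "(b, x) \<in> r"
      show "b \<in> ?J"
      proof (cases "x = a")
        case True
        then show ?thesis using amin[of b] b rsub[OF b] by auto
      next
        case False
        then show ?thesis using x b I unfolding seg_def by blast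
      qed
    qed
    have JG: "?J \<subseteq> carrier G" using a IG by blast
    have sub: "generate G I \<subseteq> generate G ?J" by (rule mono_generate) blast
    have "\<exists>k. partial_lift (generate G ?J) k \<and> (\<forall>g\<in>generate G I. k g = h g)"
    \<comment> \<open>The element \<open>a\<close> may already lie in the subgroup generated by
      \<open>I\<close>. Then the lift is kept and only the segment grows, which still contradicts
      maximality.\<close>
    proof (cases "generate G I = generate G ?J")
      case True
      then show ?thesis using h by auto
    next
      case False
      show ?thesis
        by (rule extend_partial_lift[OF generate_is_subgroup[OF IG] generate_is_subgroup[OF JG] sub False])
          (use countable_generate[OF JG] cI h in auto)
    qed
    then obtain k where k: "partial_lift (generate G ?J) k" "\<forall>g\<in>generate G I. k g = h g" by blast
    have "pack I h \<subseteq> pack ?J k" using k(2) sub unfolding pack_def by auto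
    then have "pack ?J k = pack I h" using max J k(1) by blast
    then have "Inl a \<in> pack I h" unfolding pack_def by auto
    then show False using a(2) unfolding pack_def by auto
  qed
  then have "generate G I = carrier G"
    using generate_incl[of I] generate.incl[of _ I G] by auto
  then show ?thesis using h by auto
qed

end

text \<open>By Cantor's theorem the successor of aleph_0 is at most the continuum.\<close>

lemma card_le_aleph1_names:
  assumes "card_le_aleph1 A"
  shows "\<exists>nm :: 'a \<Rightarrow> nat \<Rightarrow> bool. inj_on nm A"
proof -
  have "natLeq <o |Pow (UNIV :: nat set)|"
    using card_of_Pow[of "UNIV :: nat set"] card_of_nat ordIso_ordLess_trans ordIso_symmetric by blast
  then have "cardSuc natLeq \<le>o |Pow (UNIV :: nat set)|"
    by (intro cardSuc_least natLeq_Card_order card_of_Card_order)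
  then have "|A| \<le>o |Pow (UNIV :: nat set)|"
    using assms unfolding card_le_aleph1_def using ordLeq_transitive by blast
  then obtain f :: "'a \<Rightarrow> nat set" where f: "inj_on f A" unfolding card_of_ordLeq[symmetric] by blast
  have "inj_on (\<lambda>a k. k \<in> f a) A"
    using f by (auto simp: inj_on_def fun_eq_iff set_eq_iff)
  then show ?thesis by blast
qed

theorem (in near_hom) pointwise_lift:
  assumes "standard_borel M" "nonatomic M" "card_le_aleph1 (carrier G)"
  shows "\<exists>h. (\<forall>g\<in>carrier G. h g \<in> M \<rightarrow>\<^sub>M M) \<and> (\<forall>x\<in>space M. h \<one> x = x) \<and>
    (\<forall>g\<in>carrier G. \<forall>g'\<in>carrier G. \<forall>x\<in>space M. h (g \<otimes> g') x = h g (h g' x)) \<and>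
    (\<forall>g\<in>carrier G. AE x in M. h g x = u g x)"
proof -
  obtain e :: "'x \<Rightarrow> nat \<Rightarrow> bool" and c where e: "e \<in> M \<rightarrow>\<^sub>M cantor" and c: "c \<in> cantor \<rightarrow>\<^sub>M M"
    and ce: "\<forall>x\<in>space M. c (e x) = x"
    using standard_borel_coding[OF assms(1) not_empty] by auto
  have "\<exists>(\<iota> :: (index \<Rightarrow> bool) \<Rightarrow> 'x) \<delta> N. \<iota> \<in> cantor \<rightarrow>\<^sub>M M \<and> \<delta> \<in> M \<rightarrow>\<^sub>M cantor \<and>
    (\<forall>b. \<delta> (\<iota> b) = b) \<and> N \<in> null_sets M \<and> range \<iota> \<subseteq> N"
    using prob_space_axioms assms by (intro null_cantor_set)
  then obtain \<iota> :: "(index \<Rightarrow> bool) \<Rightarrow> 'x" and \<delta> N where r: "\<iota> \<in> cantor \<rightarrow>\<^sub>M M" "\<delta> \<in> M \<rightarrow>\<^sub>M cantor"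
    "\<forall>b. \<delta> (\<iota> b) = b" "N \<in> null_sets M" "range \<iota> \<subseteq> N"
    by (elim exE conjE)
  obtain nm :: "'g \<Rightarrow> nat \<Rightarrow> bool" where nm: "inj_on nm (carrier G)"
    using card_le_aleph1_names[OF assms(3)] by blast
  interpret R: near_hom_reserve G M u e c \<iota> \<delta> N nm
    by unfold_locales (use e c ce r nm in auto)
  obtain h where "R.partial_lift (carrier G) h" using R.exists_full_lift[OF assms(3)] by blast
  then show ?thesis unfolding R.partial_lift_def by blast
qed

section \<open>Near-actions and measure preserving automorphisms\<close>

text \<open>Each bit of \<open>e (f x)\<close> is the indicator of a set in the completion.
  Replacing these countably many sets by their Borel main parts and decoding changes
  \<open>f\<close> only on a null set.\<close>

lemma borel_version:
  assumes M: "standard_borel M" "space M \<noteq> {}" and f: "f \<in> space M \<rightarrow> space M"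
    and pre: "\<And>B. B \<in> sets M \<Longrightarrow> f -` B \<inter> space M \<in> sets (completion M)"
  shows "\<exists>u\<in>M \<rightarrow>\<^sub>M M. AE x in M. f x = u x"
proof -
  obtain e :: "'a \<Rightarrow> nat \<Rightarrow> bool" and c where e: "e \<in> M \<rightarrow>\<^sub>M cantor" and c: "c \<in> cantor \<rightarrow>\<^sub>M M"
    and ce: "\<forall>x\<in>space M. c (e x) = x"
    using standard_borel_coding[OF M] by auto
  define S where "S k = {x \<in> space M. e (f x) k}" for k
  have S: "S k \<in> sets (completion M)" for k
  proof -
    have "{x \<in> space M. e x k} \<in> sets M" using measurable_cantorD[OF e] by (simp add: pred_def)
    moreover have "S k = f -` {x \<in> space M. e x k} \<inter> space M" using f by (auto simp: S_def)
    ultimately show ?thesis using pre[of "{x \<in> space M. e x k}"] by argo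
  qed
  define u where "u x = c (\<lambda>k. x \<in> main_part M (S k))" for x
  have "u \<in> M \<rightarrow>\<^sub>M M"
    unfolding u_def
  proof (rule measurable_compose[OF measurable_cantorI c])
    show "Measurable.pred M (\<lambda>x. x \<in> main_part M (S k))" for k
      using main_part_sets[OF S[of k]] by measurable
  qed
  moreover have "AE x in M. \<forall>k. x \<notin> null_part M (S k)"
    using AE_notin_null_part[OF S] by (simp add: AE_all_countable)
  then have "AE x in M. f x = u x"
  proof (rule AE_mp, intro AE_I2 impI)
    fix x assume x: "x \<in> space M" and n: "\<forall>k. x \<notin> null_part M (S k)"
    have "(x \<in> main_part M (S k)) = e (f x) k" for k
      using main_part_null_part_Un[OF S[of k]] n x by (auto simp: S_def)
    then have "u x = c (e (f x))" by (simp add: u_def)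
    moreover have "f x \<in> space M" using f x by blast
    ultimately show "f x = u x" using ce by simp
  qed
  ultimately show ?thesis by blast
qed

text \<open>Near-actions are constrained on images, whereas measurability concerns preimages. The
  preimage under \<open>f\<close> and the image under its near-inverse \<open>v\<close> differ only
  inside a null set.\<close>

lemma near_inverse_preimage:
  assumes f: "f \<in> space M \<rightarrow> space M" and v: "v \<in> space M \<rightarrow> space M"
    and vf: "AE x in M. v (f x) = x" and fv: "AE x in M. f (v x) = x"
    and mp: "image_measure_preserving M v" and B: "B \<in> sets M"
  shows "f -` B \<inter> space M \<in> sets (completion M) \<and>
    emeasure (completion M) (f -` B \<inter> space M) = emeasure M B"
proof -
  let ?T = "f -` B \<inter> space M" and ?W = "v ` B"
  have W: "?W \<in> sets (completion M)" "emeasure (completion M) ?W = emeasure M B"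
    using mp B by (auto simp: image_measure_preserving_def)
  obtain N1 where N1: "N1 \<in> null_sets M" "{x \<in> space M. v (f x) \<noteq> x} \<subseteq> N1"
    using vf by (auto simp: eventually_ae_filter)
  obtain N2 where N2: "N2 \<in> null_sets M" "{x \<in> space M. f (v x) \<noteq> x} \<subseteq> N2"
    using fv by (auto simp: eventually_ae_filter)
  \<comment> \<open>Points of the image may come from the exceptional set \<open>N2\<close>; their
    images are negligible because \<open>v\<close> preserves the measure of images.\<close>
  have "v ` N2 \<in> null_sets (completion M)"
    using mp N2(1) by (auto simp: image_measure_preserving_def null_sets_def)
  then have N: "N1 \<union> v ` N2 \<in> null_sets (completion M)" (is "?N \<in> _")
    using null_sets_completionI[OF N1(1)] by (rule null_sets.Un[rotated])
  have BS: "B \<subseteq> space M" using sets.sets_into_space[OF B] .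
  have sub1: "x \<in> ?W" if "x \<in> ?T" "x \<notin> ?N" for x
  proof -
    have "v (f x) = x" using that N1(2) by auto
    then show ?thesis using that by force
  qed
  have sub2: "x \<in> ?T" if "x \<in> ?W" "x \<notin> ?N" for x
  proof -
    obtain y where y: "y \<in> B" "x = v y" using \<open>x \<in> ?W\<close> by blast
    then have "y \<notin> N2" using that by blast
    then have "f (v y) = y" using N2(2) y BS by auto
    then show ?thesis using y v BS by auto
  qed
  have eq: "?T = (?W - ?N) \<union> (?T \<inter> ?N)" using sub1 sub2 by blast
  have TN: "?T \<inter> ?N \<in> null_sets (completion M)"
    by (rule null_sets_completion_subset[OF _ N]) blast
  have WN: "?W - ?N \<in> sets (completion M)" using W(1) N by auto
  have "?T \<in> sets (completion M)" by (subst eq) (use WN TN in auto)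
  moreover have "emeasure (completion M) ?T = emeasure (completion M) (?W - ?N)"
    by (subst eq) (rule emeasure_Un_null_set[OF WN TN])
  ultimately show ?thesis using emeasure_Diff_null_set[OF N W(1)] W(2) by simp
qed

lemma distr_eq_if_preserving:
  assumes "u \<in> M \<rightarrow>\<^sub>M M" "\<And>B. B \<in> sets M \<Longrightarrow> emeasure M (u -` B \<inter> space M) = emeasure M B"
  shows "distr M M u = M"
  by (rule measure_eqI) (use assms in \<open>auto simp: emeasure_distr\<close>)

lemma near_action_near_hom:
  fixes G (structure)
  assumes G: "group G" and P: "prob_space M" and M: "standard_borel M" and \<eta>: "mp_near_action G M \<eta>"
  shows "\<exists>u. near_hom G M u \<and> (\<forall>g\<in>carrier G. AE x in M. \<eta> g x = u g x)"
proof -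
  interpret group G by fact
  interpret prob_space M by fact
  have fs: "\<eta> g \<in> space M \<rightarrow> space M" if "g \<in> carrier G" for g
    using \<eta> that by (simp add: mp_near_action_def)
  have one: "AE x in M. \<eta> \<one> x = x" using \<eta> by (simp add: mp_near_action_def)
  have mult: "AE x in M. \<eta> (g \<otimes> h) x = \<eta> g (\<eta> h x)" if "g \<in> carrier G" "h \<in> carrier G" for g h
    using \<eta> that by (simp add: mp_near_action_def)
  have imp: "image_measure_preserving M (\<eta> g)" if "g \<in> carrier G" for g
    using \<eta> that by (simp add: mp_near_action_def)
  have inv1: "AE x in M. \<eta> (inv g) (\<eta> g x) = x" if g: "g \<in> carrier G" for g
    using mult[of "inv g" g] one g by (auto elim: AE_mp)
  have inv2: "AE x in M. \<eta> g (\<eta> (inv g) x) = x" if g: "g \<in> carrier G" for g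
    using mult[of g "inv g"] one g by (auto elim: AE_mp)
  have pre: "\<eta> g -` B \<inter> space M \<in> sets (completion M) \<and>
      emeasure (completion M) (\<eta> g -` B \<inter> space M) = emeasure M B"
    if g: "g \<in> carrier G" and B: "B \<in> sets M" for g B
    by (rule near_inverse_preimage[OF fs fs inv1 inv2 imp B]) (use g in auto)
  have "\<forall>g\<in>carrier G. \<exists>u. u \<in> M \<rightarrow>\<^sub>M M \<and> (AE x in M. \<eta> g x = u x)"
  proof
    fix g assume g: "g \<in> carrier G"
    have "\<exists>u\<in>M \<rightarrow>\<^sub>M M. AE x in M. \<eta> g x = u x"
      by (rule borel_version[OF M not_empty fs[OF g]]) (use pre[OF g] in blast)
    then show "\<exists>u. u \<in> M \<rightarrow>\<^sub>M M \<and> (AE x in M. \<eta> g x = u x)" by blast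
  qed
  then obtain u where u: "\<And>g. g \<in> carrier G \<Longrightarrow> u g \<in> M \<rightarrow>\<^sub>M M"
    "\<And>g. g \<in> carrier G \<Longrightarrow> AE x in M. \<eta> g x = u g x"
    by metis
  have distr: "distr M M (u g) = M" if g: "g \<in> carrier G" for g
  proof (rule distr_eq_if_preserving[OF u(1)[OF g]])
    fix B assume B: "B \<in> sets M"
    have m: "u g -` B \<inter> space M \<in> sets M" using measurable_sets[OF u(1)[OF g] B] .
    have "AE x in completion M. \<eta> g x = u g x" using AE_completion[OF u(2)[OF g]] .
    then have "emeasure (completion M) (u g -` B \<inter> space M) = emeasure (completion M) (\<eta> g -` B \<inter> space M)"
      by (intro emeasure_eq_AE) (use m pre[OF g B] in auto)
    then show "emeasure M (u g -` B \<inter> space M) = emeasure M B"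
      using pre[OF g B] m by simp
  qed
  have "near_hom G M u"
  proof unfold_locales
    show "AE x in M. u \<one> x = x" using u(2)[OF one_closed] one by (auto elim: AE_mp)
    fix g h assume g: "g \<in> carrier G" and h: "h \<in> carrier G"
    \<comment> \<open>The equality of \<open>\<eta> g\<close> and \<open>u g\<close> is needed at
      \<open>u h x\<close>, not at \<open>x\<close>, so it is pulled back along the measure
      preserving map \<open>u h\<close>.\<close>
    have "AE x in distr M M (u h). \<eta> g x = u g x" using u(2)[OF g] unfolding distr[OF h] .
    then have "AE x in M. \<eta> g (u h x) = u g (u h x)" by (rule AE_distrD[OF u(1)[OF h]])
    then show "AE x in M. u (g \<otimes> h) x = u g (u h x)"
      using u(2)[OF h] mult[OF g h] u(2)[OF m_closed[OF g h]] by eventually_elim simp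
  qed (use u distr in auto)
  then show ?thesis using u by blast
qed

section \<open>The group of measure preserving Borel automorphisms\<close>

lemma G_mp_simps:
  "carrier (G_mp M) = {f \<in> Bij (space M). f \<in> M \<rightarrow>\<^sub>M M \<and>
     (\<forall>A\<in>sets M. emeasure M (f -` A \<inter> space M) = emeasure M A)}"
  "mult (G_mp M) = mult (BijGroup (space M))" "one (G_mp M) = one (BijGroup (space M))"
  by (simp_all add: G_mp_def)

lemma G_mp_mult:
  assumes "f \<in> carrier (G_mp M)" "g \<in> carrier (G_mp M)"
  shows "f \<otimes>\<^bsub>G_mp M\<^esub> g = compose (space M) f g"
  using assms by (simp add: G_mp_simps BijGroup_def)

text \<open>Preservation is defined by preimages. Once the image is known to be Borel, injectivity
  makes \<open>B\<close> its preimage, and the two measures agree.\<close>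

lemma G_mp_image:
  assumes M: "standard_borel M" and f: "f \<in> carrier (G_mp M)" and B: "B \<in> sets M"
  shows "f ` B \<in> sets M" "emeasure M (f ` B) = emeasure M B"
proof -
  have bij: "bij_betw f (space M) (space M)" and m: "f \<in> M \<rightarrow>\<^sub>M M"
    using f by (auto simp: G_mp_simps Bij_def)
  show im: "f ` B \<in> sets M" by (rule borel_bijection_inverse[OF M m bij B])
  have "f -` f ` B \<inter> space M = B"
    using bij sets.sets_into_space[OF B] by (auto simp: bij_betw_def inj_on_def)
  then show "emeasure M (f ` B) = emeasure M B" using f im by (auto simp: G_mp_simps)
qed

lemma G_mp_distr:
  assumes "f \<in> carrier (G_mp M)"
  shows "distr M M f = M"
  by (rule distr_eq_if_preserving) (use assms in \<open>auto simp: G_mp_simps\<close>)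

lemma G_mp_AE:
  assumes "f \<in> carrier (G_mp M)" "AE x in M. P x"
  shows "AE x in M. P (f x)"
proof -
  have "f \<in> M \<rightarrow>\<^sub>M M" using assms by (simp add: G_mp_simps)
  moreover have "AE x in distr M M f. P x" using assms(2) unfolding G_mp_distr[OF assms(1)] .
  ultimately show ?thesis by (rule AE_distrD)
qed

lemma subgroup_G_mp:
  assumes M: "standard_borel M"
  shows "subgroup (carrier (G_mp M)) (BijGroup (space M))"
proof -
  interpret B: group "BijGroup (space M)" by (rule group_BijGroup)
  show ?thesis
  proof (rule B.subgroupI)
    show "carrier (G_mp M) \<subseteq> carrier (BijGroup (space M))" by (auto simp: G_mp_simps BijGroup_def)
    have id: "(\<lambda>x\<in>space M. x) \<in> M \<rightarrow>\<^sub>M M" by (subst measurable_cong[of _ _ "\<lambda>x. x"]) auto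
    have "(\<lambda>x\<in>space M. x) -` A \<inter> space M = A" if "A \<in> sets M" for A
      using sets.sets_into_space[OF that] by auto
    then have "(\<lambda>x\<in>space M. x) \<in> carrier (G_mp M)" using id by (simp add: G_mp_simps id_Bij)
    then show "carrier (G_mp M) \<noteq> {}" by blast
  next
    fix f assume f: "f \<in> carrier (G_mp M)"
    then have fB: "f \<in> Bij (space M)" by (simp add: G_mp_simps)
    then have bij: "bij_betw f (space M) (space M)" by (simp add: Bij_def)
    let ?i = "\<lambda>x\<in>space M. inv_into (space M) f x"
    have iB: "?i \<in> Bij (space M)" by (rule restrict_inv_into_Bij[OF fB])
    have pre: "?i -` A \<inter> space M = f ` A" if "A \<in> sets M" for A
    proof -
      have A: "A \<subseteq> space M" using sets.sets_into_space[OF that] .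
      have inv: "inv_into (space M) f (f x) = x" "f x \<in> space M" if "x \<in> space M" for x
        using bij that by (auto simp: bij_betw_def inv_into_f_f)
      have "f (inv_into (space M) f x) = x" if "x \<in> space M" for x
        using bij that by (auto simp: bij_betw_def f_inv_into_f)
      then show ?thesis using A inv by (auto simp: subset_iff) (metis image_eqI)
    qed
    have "?i \<in> M \<rightarrow>\<^sub>M M"
      by (rule measurableI) (use pre G_mp_image(1)[OF M f] Bij_inv_into_mem[OF fB] in auto)
    then have "?i \<in> carrier (G_mp M)"
      using iB pre G_mp_image(2)[OF M f] by (simp add: G_mp_simps)
    then show "inv\<^bsub>BijGroup (space M)\<^esub> f \<in> carrier (G_mp M)"
      using inv_BijGroup[OF fB] by simp
  next
    fix f g assume fg: "f \<in> carrier (G_mp M)" "g \<in> carrier (G_mp M)"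
    have m: "f \<in> M \<rightarrow>\<^sub>M M" "g \<in> M \<rightarrow>\<^sub>M M" using fg by (auto simp: G_mp_simps)
    have "(\<lambda>x. f (g x)) \<in> M \<rightarrow>\<^sub>M M" using measurable_compose[OF m(2,1)] .
    then have c: "compose (space M) f g \<in> M \<rightarrow>\<^sub>M M"
      by (subst measurable_cong[of _ _ "\<lambda>x. f (g x)"]) (auto simp: compose_def)
    have "emeasure M (compose (space M) f g -` A \<inter> space M) = emeasure M A" if A: "A \<in> sets M" for A
    proof -
      have pre: "\<forall>B\<in>sets M. emeasure M (f -` B \<inter> space M) = emeasure M B"
        "\<forall>B\<in>sets M. emeasure M (g -` B \<inter> space M) = emeasure M B"
        using fg by (simp_all add: G_mp_simps)
      have "compose (space M) f g -` A \<inter> space M = g -` (f -` A \<inter> space M) \<inter> space M"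
        using measurable_space[OF m(2)] by (auto simp: compose_def)
      then have "emeasure M (compose (space M) f g -` A \<inter> space M) = emeasure M (g -` (f -` A \<inter> space M) \<inter> space M)"
        by (rule arg_cong)
      also have "\<dots> = emeasure M (f -` A \<inter> space M)" using pre(2) measurable_sets[OF m(1) A] by blast
      also have "\<dots> = emeasure M A" using pre(1) A by blast
      finally show ?thesis .
    qed
    then show "f \<otimes>\<^bsub>BijGroup (space M)\<^esub> g \<in> carrier (G_mp M)"
      using fg c compose_Bij[of f "space M" g] by (simp add: G_mp_simps BijGroup_def)
  qed
qed

lemma group_G_mp: "standard_borel M \<Longrightarrow> group (G_mp M)"
proof -
  assume M: "standard_borel M"
  have "G_mp M = BijGroup (space M)\<lparr>carrier := carrier (G_mp M)\<rparr>"
    by (simp add: G_mp_def)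
  then show ?thesis
    using subgroup.subgroup_is_group[OF subgroup_G_mp[OF M] group_BijGroup] by simp
qed

text \<open>The maps of a genuine action are bijections, and almost everywhere equality with
  \<open>u g\<close> carries over the preservation of measure. Restriction to the space gives the
  representation used in \<open>BijGroup\<close>.\<close>

theorem (in near_hom) hom_lift:
  assumes M: "standard_borel M" "nonatomic M" and card: "card_le_aleph1 (carrier G)"
  shows "\<exists>h\<in>hom G (G_mp M). \<forall>g\<in>carrier G. AE x in M. h g x = u g x"
proof -
  obtain h where h: "\<forall>g\<in>carrier G. h g \<in> M \<rightarrow>\<^sub>M M" "\<forall>x\<in>space M. h \<one> x = x"
    "\<forall>g\<in>carrier G. \<forall>g'\<in>carrier G. \<forall>x\<in>space M. h (g \<otimes> g') x = h g (h g' x)"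
    "\<forall>g\<in>carrier G. AE x in M. h g x = u g x"
    using pointwise_lift[OF assms] by (elim exE conjE)
  note h_meas = h(1)[rule_format] and h_one = h(2)[rule_format]
    and h_mult = h(3)[rule_format] and h_AE = h(4)[rule_format]
  define k where "k g = restrict (h g) (space M)" for g
  have k: "k g \<in> carrier (G_mp M)" if g: "g \<in> carrier G" for g
  proof -
    have sp: "h g' x \<in> space M" if "g' \<in> carrier G" "x \<in> space M" for g' x
      using measurable_space[OF h_meas] that by blast
    have "h (inv g) (h g x) = x" "h g (h (inv g) x) = x" if "x \<in> space M" for x
      using h_mult[of "inv g" g x] h_mult[of g "inv g" x] h_one g that by auto
    then have "bij_betw (h g) (space M) (space M)"
      by (intro bij_betw_byWitness[where f' = "h (inv g)"]) (use sp g in auto)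
    then have "k g \<in> Bij (space M)" by (simp add: k_def Bij_def cong: bij_betw_cong)
    moreover have km: "k g \<in> M \<rightarrow>\<^sub>M M"
      unfolding k_def by (subst measurable_cong[of _ _ "h g"]) (use h_meas[OF g] in auto)
    moreover have "emeasure M (k g -` A \<inter> space M) = emeasure M A" if A: "A \<in> sets M" for A
    proof -
      have "AE x in M. k g x = u g x" using h_AE[OF g] by (auto simp: k_def)
      then have "emeasure M (k g -` A \<inter> space M) = emeasure M (u g -` A \<inter> space M)"
        by (intro emeasure_eq_AE)
          (use measurable_sets[OF km A] measurable_sets[OF u_meas[OF g] A] in auto)
      also have "\<dots> = emeasure (distr M M (u g)) A" using u_meas[OF g] A by (simp add: emeasure_distr)
      finally show ?thesis by (simp add: u_distr[OF g])
    qed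
    ultimately show ?thesis by (simp add: G_mp_simps)
  qed
  have "k \<in> hom G (G_mp M)"
  proof (rule homI)
    fix g g' assume g: "g \<in> carrier G" "g' \<in> carrier G"
    have "k (g \<otimes> g') = compose (space M) (k g) (k g')"
      using h_mult[OF g] measurable_space[OF h_meas[OF g(2)]] by (auto simp: k_def compose_def restrict_def fun_eq_iff)
    then show "k (g \<otimes> g') = k g \<otimes>\<^bsub>G_mp M\<^esub> k g'" using G_mp_mult[OF k k] g by simp
  qed (use k in auto)
  moreover have "\<forall>g\<in>carrier G. AE x in M. k g x = u g x"
    using h_AE by (auto simp: k_def)
  ultimately show ?thesis by blast
qed

lemma spatial_model_of_hom:
  assumes G: "group G" and M: "standard_borel M" and h: "h \<in> hom G (G_mp M)"
    and ae: "\<And>g. g \<in> carrier G \<Longrightarrow> AE x in M. \<eta> g x = h g x"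
  shows "spatial_model G M \<eta> h \<and> acts_by_borel_automorphisms G M h"
proof -
  have hc: "h g \<in> carrier (G_mp M)" if "g \<in> carrier G" for g
    using h that by (auto simp: hom_def)
  have "h \<in> hom G (BijGroup (space M))"
    using h by (auto simp: hom_def G_mp_simps BijGroup_def Pi_iff)
  then have "group_action G (space M) h"
    using G group_BijGroup by (simp add: group_action_def group_hom_def group_hom_axioms_def)
  moreover have "image_measure_preserving M (h g)" if "g \<in> carrier G" for g
    using G_mp_image[OF M hc[OF that]] by (simp add: image_measure_preserving_def)
  moreover have "h g \<in> M \<rightarrow>\<^sub>M M" if "g \<in> carrier G" for g
    using hc[OF that] by (simp add: G_mp_simps)
  ultimately show ?thesis
    using ae by (simp add: spatial_model_def acts_by_borel_automorphisms_def)
qed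

text \<open>Representatives of the cosets \<open>f g\<close> form a near-homomorphism, and elements
  of \<open>G_mp M\<close> that agree almost everywhere lie in the same coset.\<close>

lemma hom_Aut_lift:
  fixes G (structure)
  assumes G: "group G" and P: "prob_space M" and M: "standard_borel M" "nonatomic M"
    and card: "card_le_aleph1 (carrier G)" and f: "f \<in> hom G (Aut_mp M)"
  shows "\<exists>h\<in>hom G (G_mp M). \<forall>g\<in>carrier G. quotient_mp M (h g) = f g"
proof -
  interpret group G by fact
  interpret prob_space M by fact
  interpret A: group "G_mp M" by (rule group_G_mp[OF M(1)])
  let ?I = "I_mp M"
  have I: "i \<in> carrier (G_mp M)" "AE x in M. i x = x" if "i \<in> ?I" for i
    using that by (auto simp: I_mp_def)
  have oneI: "\<one>\<^bsub>G_mp M\<^esub> \<in> ?I"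
    using A.one_closed by (auto simp: I_mp_def) (simp add: G_mp_simps BijGroup_def)
  have meas: "a \<in> M \<rightarrow>\<^sub>M M" if "a \<in> carrier (G_mp M)" for a
    using that by (simp add: G_mp_simps)
  have mult: "(a \<otimes>\<^bsub>G_mp M\<^esub> b) x = a (b x)"
    if "a \<in> carrier (G_mp M)" "b \<in> carrier (G_mp M)" "x \<in> space M" for a b x
    using G_mp_mult[OF that(1,2)] that(3) by (simp add: compose_def)
  have "\<forall>g\<in>carrier G. \<exists>a. a \<in> carrier (G_mp M) \<and> f g = ?I #>\<^bsub>G_mp M\<^esub> a"
    using f by (auto simp: hom_def Aut_mp_def FactGroup_def RCOSETS_def Pi_iff)
  then obtain u where u: "\<And>g. g \<in> carrier G \<Longrightarrow> u g \<in> carrier (G_mp M)"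
    "\<And>g. g \<in> carrier G \<Longrightarrow> f g = ?I #>\<^bsub>G_mp M\<^esub> u g"
    by metis
  have umult: "AE x in M. u (g \<otimes> h) x = u g (u h x)" if g: "g \<in> carrier G" "h \<in> carrier G" for g h
  proof -
    have "u k \<in> f k" if "k \<in> carrier G" for k
      using u[OF that] oneI A.l_one[of "u k"] by (auto simp: r_coset_def intro!: bexI[OF _ oneI])
    then have "u g \<otimes>\<^bsub>G_mp M\<^esub> u h \<in> f g <#>\<^bsub>G_mp M\<^esub> f h"
      using g by (auto simp: set_mult_def)
    also have "f g <#>\<^bsub>G_mp M\<^esub> f h = f (g \<otimes> h)"
      using hom_mult[OF f g] by (simp add: Aut_mp_def FactGroup_def)
    finally obtain i where i: "i \<in> ?I" "u g \<otimes>\<^bsub>G_mp M\<^esub> u h = i \<otimes>\<^bsub>G_mp M\<^esub> u (g \<otimes> h)"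
      using u(2)[OF m_closed[OF g]] by (auto simp: r_coset_def)
    have "AE x in M. i (u (g \<otimes> h) x) = u (g \<otimes> h) x"
      using G_mp_AE[OF u(1)[OF m_closed[OF g]] I(2)[OF i(1)]] .
    then show ?thesis
    proof (rule AE_mp, intro AE_I2 impI)
      fix x assume x: "x \<in> space M" and e: "i (u (g \<otimes> h) x) = u (g \<otimes> h) x"
      have "u g (u h x) = i (u (g \<otimes> h) x)"
        using i(2) mult[OF u(1) u(1) x, of g h] mult[OF I(1)[OF i(1)] u(1)[OF m_closed[OF g]] x] g by simp
      then show "u (g \<otimes> h) x = u g (u h x)" using e by simp
    qed
  qed
  have uone: "AE x in M. u \<one> x = x"
  proof -
    \<comment> \<open>The map \<open>u \<one>\<close> is almost everywhere idempotent; being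
      injective, it is almost everywhere the identity.\<close>
    have "AE x in M. u \<one> x = u \<one> (u \<one> x)" using umult[of \<one> \<one>] by simp
    then show ?thesis
    proof (rule AE_mp, intro AE_I2 impI)
      fix x assume x: "x \<in> space M" and e: "u \<one> x = u \<one> (u \<one> x)"
      have "inj_on (u \<one>) (space M)" using u(1)[OF one_closed] by (auto simp: G_mp_simps Bij_def bij_betw_def)
      moreover have "u \<one> x \<in> space M" using measurable_space[OF meas[OF u(1)[OF one_closed]] x] .
      ultimately show "u \<one> x = x" using e x by (metis inj_onD)
    qed
  qed
  interpret near_hom G M u
  proof unfold_locales
    show "u g \<in> M \<rightarrow>\<^sub>M M" "distr M M (u g) = M" if "g \<in> carrier G" for g
      using meas[OF u(1)[OF that]] G_mp_distr[OF u(1)[OF that]] by auto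
  qed (fact uone umult)+
  obtain h where h: "h \<in> hom G (G_mp M)" "\<forall>g\<in>carrier G. AE x in M. h g x = u g x"
    using hom_lift[OF M card] by blast
  have coset_mono: "?I #>\<^bsub>G_mp M\<^esub> a \<subseteq> ?I #>\<^bsub>G_mp M\<^esub> b"
    if a: "a \<in> carrier (G_mp M)" and b: "b \<in> carrier (G_mp M)" and ab: "AE x in M. a x = b x" for a b
  proof
    fix z assume "z \<in> ?I #>\<^bsub>G_mp M\<^esub> a"
    then obtain i where i: "i \<in> ?I" "z = i \<otimes>\<^bsub>G_mp M\<^esub> a" by (auto simp: r_coset_def)
    let ?b = "inv\<^bsub>G_mp M\<^esub> b"
    \<comment> \<open>The factor that turns \<open>b\<close> into \<open>z\<close>. It fixes almost
      every point, because \<open>a\<close> and \<open>b\<close> agree at almost every point of the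
      form \<open>?b x\<close>.\<close>
    let ?j = "i \<otimes>\<^bsub>G_mp M\<^esub> a \<otimes>\<^bsub>G_mp M\<^esub> ?b"
    have bi: "?b \<in> carrier (G_mp M)" using b by simp
    have "AE x in M. a (?b x) = b (?b x)" using G_mp_AE[OF bi ab] .
    then have "AE x in M. ?j x = x"
      using I(2)[OF i(1)]
    proof (rule AE_mp[OF _ AE_mp], intro AE_I2 impI)
      fix x assume x: "x \<in> space M" and e1: "i x = x" and e2: "a (?b x) = b (?b x)"
      have "b (?b x) = x"
        using mult[OF b bi x] A.r_inv[OF b] x by (simp add: G_mp_simps(3)) (simp add: BijGroup_def)
      moreover have "?j x = i (a (?b x))"
        using mult[OF A.m_closed[OF I(1)[OF i(1)] a] bi x] mult[OF I(1)[OF i(1)] a, of "?b x"]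
          measurable_space[OF meas[OF bi] x] by simp
      ultimately show "?j x = x" using e1 e2 by simp
    qed
    then have "?j \<in> ?I" using I(1)[OF i(1)] a bi by (simp add: I_mp_def)
    moreover have "z = ?j \<otimes>\<^bsub>G_mp M\<^esub> b"
      using i I(1)[OF i(1)] a b by (simp add: A.m_assoc)
    ultimately show "z \<in> ?I #>\<^bsub>G_mp M\<^esub> b" by (auto simp: r_coset_def)
  qed
  have "quotient_mp M (h g) = f g" if g: "g \<in> carrier G" for g
  proof -
    have hg: "h g \<in> carrier (G_mp M)" using h(1) g by (auto simp: hom_def)
    have ae: "AE x in M. h g x = u g x" using h(2) g by blast
    then have "AE x in M. u g x = h g x" by (simp add: eq_commute)
    then show ?thesis
      using coset_mono[OF hg u(1)[OF g] ae] coset_mono[OF u(1)[OF g] hg] u(2)[OF g]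
      by (auto simp: quotient_mp_def)
  qed
  then show ?thesis using h(1) by blast
qed

section \<open>Groups of arbitrary cardinality under the continuum hypothesis\<close>

text \<open>There are at most continuum many Borel maps up to null sets. Such a map is determined by
  the measures of the preimages of single bits, intersected with a countable generating family
  closed under intersection; each of these reals is recorded by the rationals above it.\<close>

lemma standard_borel_AE_code:
  assumes P: "prob_space M" and M: "standard_borel M"
  shows "\<exists>code :: ('x \<Rightarrow> 'x) \<Rightarrow> nat set. \<forall>f\<in>M \<rightarrow>\<^sub>M M. \<forall>g\<in>M \<rightarrow>\<^sub>M M.
    code f = code g \<longrightarrow> (AE x in M. f x = g x)"
proof -
  interpret prob_space M by fact
  obtain e :: "'x \<Rightarrow> nat \<Rightarrow> bool" and c where e: "e \<in> M \<rightarrow>\<^sub>M cantor" and c: "c \<in> cantor \<rightarrow>\<^sub>M M"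
    and ce: "\<forall>x\<in>space M. c (e x) = x"
    using standard_borel_coding[OF M not_empty] by auto
  have [measurable]: "Measurable.pred M (\<lambda>x. e x k)" for k using measurable_cantorD[OF e] .
  define E where "E s = {x \<in> space M. \<forall>i\<in>set s. e x i}" for s
  have E_sets: "E s \<in> sets M" for s unfolding E_def by measurable
  \<comment> \<open>The map \<open>e\<close> is measurable for the generated sigma-algebra, hence so
    is \<open>c\<close> after \<open>e\<close>. That is the identity on the space, so every Borel
    set is its own preimage.\<close>
  have gen: "sets M = sigma_sets (space M) (range E)"
  proof (rule antisym)
    have rE: "range E \<subseteq> Pow (space M)" by (auto simp: E_def)
    let ?N = "sigma (space M) (range E)"
    have sN: "space ?N = space M" "sets ?N = sigma_sets (space M) (range E)" using rE by auto
    have "e \<in> ?N \<rightarrow>\<^sub>M cantor"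
    proof (rule measurable_cantorI)
      fix k
      have "{x \<in> space ?N. e x k} = {x \<in> space M. e x k}" by (simp only: sN)
      also have "\<dots> = E [k]" by (simp add: E_def)
      finally have "{x \<in> space ?N. e x k} = E [k]" .
      then show "Measurable.pred ?N (\<lambda>x. e x k)" by (simp add: pred_def sN)
    qed
    then have ceN: "(\<lambda>x. c (e x)) \<in> ?N \<rightarrow>\<^sub>M M" using c by (rule measurable_compose)
    show "sets M \<subseteq> sigma_sets (space M) (range E)"
    proof
      fix B assume B: "B \<in> sets M"
      have "(\<lambda>x. c (e x)) -` B \<inter> space ?N = B"
        using ce sets.sets_into_space[OF B] by (auto simp: sN)
      then show "B \<in> sigma_sets (space M) (range E)" using measurable_sets[OF ceN B] sN by simp
    qed
    show "sigma_sets (space M) (range E) \<subseteq> sets M"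
      using E_sets by (intro sets.sigma_sets_subset) auto
  qed
  \<comment> \<open>The measure restricted to \<open>A\<close> and that restricted to
    \<open>A'\<close> agree on the generating family, hence on all Borel sets; evaluating them at
    the two differences shows these to be null.\<close>
  have AE_eq: "AE x in M. x \<in> A \<longleftrightarrow> x \<in> A'"
    if A: "A \<in> sets M" and A': "A' \<in> sets M" and eq: "\<And>s. measure M (A \<inter> E s) = measure M (A' \<inter> E s)" for A A'
  proof -
    have "density M (indicator A) = density M (indicator A')"
    proof (rule measure_eqI_generator_eq)
      show "Int_stable (range E)"
        unfolding Int_stable_def
      proof (intro ballI)
        fix a b assume "a \<in> range E" "b \<in> range E"
        then obtain s t where "a = E s" "b = E t" by blast
        then have "a \<inter> b = E (s @ t)" by (auto simp: E_def)
        then show "a \<inter> b \<in> range E" by blast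
      qed
      show "range E \<subseteq> Pow (space M)" by (auto simp: E_def)
      show "sets (density M (indicator A)) = sigma_sets (space M) (range E)" using gen by simp
      show "sets (density M (indicator A')) = sigma_sets (space M) (range E)" using gen by simp
      show "range (\<lambda>_::nat. E []) \<subseteq> range E" by blast
      show "(\<Union>i::nat. E []) = space M" by (auto simp: E_def)
      show "emeasure (density M (indicator A)) (E []) \<noteq> \<infinity>"
        using emeasure_restricted[OF A E_sets] by simp
      fix X assume "X \<in> range E"
      then obtain s where X: "X = E s" by blast
      have "emeasure M (A \<inter> E s) = emeasure M (A' \<inter> E s)" using eq[of s] by (simp add: emeasure_eq_measure)
      then show "emeasure (density M (indicator A)) X = emeasure (density M (indicator A')) X"
        using emeasure_restricted[OF A E_sets] emeasure_restricted[OF A' E_sets] by (simp add: X)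
    qed
    then have eqB: "emeasure M (A \<inter> B) = emeasure M (A' \<inter> B)" if "B \<in> sets M" for B
      using emeasure_restricted[OF A that] emeasure_restricted[OF A' that] by simp
    have "A - A' \<in> null_sets M" "A' - A \<in> null_sets M"
    proof -
      have *: "A \<inter> (A - A') = A - A'" "A' \<inter> (A - A') = {}" "A \<inter> (A' - A) = {}" "A' \<inter> (A' - A) = A' - A"
        by auto
      show "A - A' \<in> null_sets M" "A' - A \<in> null_sets M"
        using eqB[of "A - A'"] eqB[of "A' - A"] A A' unfolding * by (auto simp: null_sets_def)
    qed
    then have "AE x in M. x \<notin> A - A'" "AE x in M. x \<notin> A' - A" by (blast intro: AE_not_in)+
    then show ?thesis by eventually_elim auto
  qed
  define pre where "pre f k = {x \<in> space M. e (f x) k}" for f :: "'x \<Rightarrow> 'x" and k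
  define code where "code f = to_nat ` {(s, k, q :: rat). measure M (pre f k \<inter> E s) < of_rat q}" for f
  have "AE x in M. f x = g x" if f: "f \<in> M \<rightarrow>\<^sub>M M" and g: "g \<in> M \<rightarrow>\<^sub>M M" and eq: "code f = code g" for f g
  proof -
    have pre_sets: "pre h k \<in> sets M" if "h \<in> M \<rightarrow>\<^sub>M M" for h k
      using measurable_cantorD[OF measurable_compose[OF that e], of k] by (simp add: pre_def pred_def)
    have "{(s, k, q :: rat). measure M (pre f k \<inter> E s) < of_rat q} = {(s, k, q). measure M (pre g k \<inter> E s) < of_rat q}"
      using eq unfolding code_def by (simp add: inj_image_eq_iff)
    then have lt: "measure M (pre f k \<inter> E s) < of_rat q \<longleftrightarrow> measure M (pre g k \<inter> E s) < of_rat q" for s k and q :: rat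
      by (auto simp: set_eq_iff)
    have meq: "measure M (pre f k \<inter> E s) = measure M (pre g k \<inter> E s)" for s k
    proof (rule ccontr)
      assume "measure M (pre f k \<inter> E s) \<noteq> measure M (pre g k \<inter> E s)"
      then consider "measure M (pre f k \<inter> E s) < measure M (pre g k \<inter> E s)"
        | "measure M (pre g k \<inter> E s) < measure M (pre f k \<inter> E s)" by linarith
      then show False
        using of_rat_dense lt by cases (metis less_asym)+
    qed
    have "AE x in M. \<forall>k. x \<in> pre f k \<longleftrightarrow> x \<in> pre g k"
      unfolding AE_all_countable using AE_eq[OF pre_sets[OF f] pre_sets[OF g] meq] by blast
    then show ?thesis
    proof (rule AE_mp, intro AE_I2 impI)
      fix x assume x: "x \<in> space M" and "\<forall>k. x \<in> pre f k \<longleftrightarrow> x \<in> pre g k"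
      then have "e (f x) = e (g x)" by (auto simp: pre_def fun_eq_iff)
      then show "f x = g x" using ce measurable_space[OF f x] measurable_space[OF g x] by metis
    qed
  qed
  then show ?thesis by blast
qed

section \<open>The kernel of a near-homomorphism and its quotient\<close>

definition (in near_hom) AE_eq :: "'g \<Rightarrow> 'g \<Rightarrow> bool" where
  "AE_eq g h \<longleftrightarrow> (AE x in M. u g x = u h x)"

context near_hom
begin

lemma AE_eq_refl [simp]: "AE_eq g g"
  by (simp add: AE_eq_def)

lemma AE_eq_sym: "AE_eq g h \<Longrightarrow> AE_eq h g"
  by (simp add: AE_eq_def eq_commute)

lemma AE_eq_trans:
  assumes "AE_eq g h" "AE_eq h k"
  shows "AE_eq g k"
  using assms unfolding AE_eq_def by eventually_elim simp

lemma AE_eq_left: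
  assumes "g \<in> carrier G" "h \<in> carrier G" "k \<in> carrier G" "AE_eq h k"
  shows "AE_eq (g \<otimes> h) (g \<otimes> k)"
  using u_mult[OF assms(1,2)] u_mult[OF assms(1,3)] assms(4) unfolding AE_eq_def
  by eventually_elim simp

text \<open>Here the equality of \<open>u h\<close> and \<open>u k\<close> is used at
  \<open>u g x\<close>, so it is pulled back along \<open>u g\<close>.\<close>

lemma AE_eq_right:
  assumes "g \<in> carrier G" "h \<in> carrier G" "k \<in> carrier G" "AE_eq h k"
  shows "AE_eq (h \<otimes> g) (k \<otimes> g)"
  using u_mult[OF assms(2,1)] u_mult[OF assms(3,1)] AE_pullback[OF assms(1) assms(4)[unfolded AE_eq_def]]
  unfolding AE_eq_def by eventually_elim simp

definition ker :: "'g set" where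
  "ker = {g \<in> carrier G. AE_eq g \<one>}"

lemma normal_ker: "ker \<lhd> G"
proof (rule normal_invI)
  show "subgroup ker G"
  proof (rule subgroupI)
    show "ker \<subseteq> carrier G" "ker \<noteq> {}" by (auto simp: ker_def)
    show "inv a \<in> ker" if "a \<in> ker" for a
      using AE_eq_sym[OF AE_eq_left[of "inv a" a \<one>]] that by (auto simp: ker_def)
    show "a \<otimes> b \<in> ker" if "a \<in> ker" "b \<in> ker" for a b
      using AE_eq_trans[OF AE_eq_right[of b a \<one>], of \<one>] that by (auto simp: ker_def)
  qed
  fix x h assume x: "x \<in> carrier G" and h: "h \<in> ker"
  then have hG: "h \<in> carrier G" "AE_eq h \<one>" by (auto simp: ker_def)
  have "AE_eq (x \<otimes> h) (x \<otimes> \<one>)" using AE_eq_left[OF x hG(1) one_closed hG(2)] .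
  then have "AE_eq (x \<otimes> h \<otimes> inv x) (x \<otimes> \<one> \<otimes> inv x)" by (intro AE_eq_right) (use x hG in auto)
  then show "x \<otimes> h \<otimes> inv x \<in> ker" using x hG by (simp add: ker_def)
qed

lemma ker_coset_AE_eq:
  assumes "g \<in> carrier G" "k \<in> ker #> g"
  shows "k \<in> carrier G" "AE_eq k g"
proof -
  obtain n where n: "n \<in> carrier G" "AE_eq n \<one>" "k = n \<otimes> g"
    using assms by (auto simp: r_coset_def ker_def)
  then show "k \<in> carrier G" "AE_eq k g" using AE_eq_right[of g n \<one>] assms by auto
qed

definition rep :: "'g set \<Rightarrow> 'g" where
  "rep A = (SOME k. k \<in> A)"

lemma rep_coset:
  assumes "g \<in> carrier G"
  shows "rep (ker #> g) \<in> carrier G" "AE_eq (rep (ker #> g)) g"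
proof -
  interpret N: normal ker G by (rule normal_ker)
  have "g \<in> ker #> g" using assms by (rule rcos_self) (rule N.is_subgroup)
  then have "rep (ker #> g) \<in> ker #> g" unfolding rep_def by (rule someI)
  then show "rep (ker #> g) \<in> carrier G" "AE_eq (rep (ker #> g)) g"
    using ker_coset_AE_eq assms by auto
qed

lemma carrier_Mod_ker: "A \<in> carrier (G Mod ker) \<longleftrightarrow> (\<exists>g\<in>carrier G. A = ker #> g)"
  by (auto simp: FactGroup_def RCOSETS_def)

text \<open>All members of a coset of the kernel have the same map up to null sets, so products of
  chosen members may be compared with the chosen member of the product.\<close>

lemma near_hom_Mod: "near_hom (G Mod ker) M (\<lambda>A. u (rep A))"
proof -
  interpret N: normal ker G by (rule normal_ker)
  interpret Q: group "G Mod ker" by (rule N.factorgroup_is_group)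
  show ?thesis
  proof unfold_locales
    show "u (rep A) \<in> M \<rightarrow>\<^sub>M M" "distr M M (u (rep A)) = M" if "A \<in> carrier (G Mod ker)" for A
      using that u_meas u_distr rep_coset(1) by (auto simp: carrier_Mod_ker)
    have "\<one>\<^bsub>G Mod ker\<^esub> = ker #> \<one>" using N.subset by (simp add: FactGroup_def)
    then have "AE x in M. u (rep \<one>\<^bsub>G Mod ker\<^esub>) x = u \<one> x"
      using rep_coset(2)[of \<one>] by (simp add: AE_eq_def)
    then show "AE x in M. u (rep \<one>\<^bsub>G Mod ker\<^esub>) x = x" using u_one by eventually_elim simp
    fix A B assume "A \<in> carrier (G Mod ker)" "B \<in> carrier (G Mod ker)"
    then obtain a b where a: "a \<in> carrier G" "A = ker #> a" and b: "b \<in> carrier G" "B = ker #> b"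
      by (auto simp: carrier_Mod_ker)
    have AB: "A \<otimes>\<^bsub>G Mod ker\<^esub> B = ker #> (a \<otimes> b)"
      using a b N.rcos_sum by (simp add: FactGroup_def)
    have "AE_eq (rep (ker #> (a \<otimes> b))) (a \<otimes> b)" using rep_coset a b by simp
    moreover have "AE_eq (a \<otimes> b) (rep A \<otimes> b)"
      using AE_eq_sym[OF AE_eq_right[OF b(1) rep_coset(1)[OF a(1)] a(1) rep_coset(2)[OF a(1)]]] a by simp
    moreover have "AE_eq (rep A \<otimes> b) (rep A \<otimes> rep B)"
      using AE_eq_sym[OF AE_eq_left[OF rep_coset(1)[OF a(1)] rep_coset(1)[OF b(1)] b(1) rep_coset(2)[OF b(1)]]] a b by simp
    ultimately have "AE_eq (rep (A \<otimes>\<^bsub>G Mod ker\<^esub> B)) (rep A \<otimes> rep B)"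
      using AE_eq_trans unfolding AB by blast
    moreover have "AE x in M. u (rep A \<otimes> rep B) x = u (rep A) (u (rep B) x)"
      using u_mult rep_coset(1) a b by simp
    ultimately show "AE x in M. u (rep (A \<otimes>\<^bsub>G Mod ker\<^esub> B)) x = u (rep A) (u (rep B) x)"
      unfolding AE_eq_def by eventually_elim simp
  qed
qed

text \<open>Distinct cosets act differently on a set of positive measure, so the quotient injects
  into sets of naturals; CH turns this bound into aleph_1.\<close>

lemma card_Mod_ker:
  assumes CH: continuum_hypothesis and M: "standard_borel M"
  shows "card_le_aleph1 (carrier (G Mod ker))"
proof -
  interpret N: normal ker G by (rule normal_ker)
  obtain code :: "('x \<Rightarrow> 'x) \<Rightarrow> nat set" where
    code: "\<forall>f\<in>M \<rightarrow>\<^sub>M M. \<forall>g\<in>M \<rightarrow>\<^sub>M M. code f = code g \<longrightarrow> (AE x in M. f x = g x)"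
    using standard_borel_AE_code[OF prob_space_axioms M] by blast
  have "inj_on (\<lambda>A. code (u (rep A))) (carrier (G Mod ker))"
  proof (rule inj_onI)
    fix A B assume "A \<in> carrier (G Mod ker)" "B \<in> carrier (G Mod ker)" and eq: "code (u (rep A)) = code (u (rep B))"
    then obtain a b where a: "a \<in> carrier G" "A = ker #> a" and b: "b \<in> carrier G" "B = ker #> b"
      by (auto simp: carrier_Mod_ker)
    have "AE_eq (rep A) (rep B)"
      unfolding AE_eq_def using code eq u_meas rep_coset(1) a b by blast
    then have ab: "AE_eq a b"
      using AE_eq_trans[OF AE_eq_sym[OF rep_coset(2)[OF a(1)]] AE_eq_trans[OF _ rep_coset(2)[OF b(1)]]]
      unfolding a(2) b(2) by blast
    have "AE_eq (a \<otimes> inv b) (b \<otimes> inv b)"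
      by (rule AE_eq_right[OF inv_closed[OF b(1)] a(1) b(1) ab])
    then have "AE_eq (a \<otimes> inv b) \<one>" unfolding r_inv[OF b(1)] .
    then have "a \<otimes> inv b \<in> ker" unfolding ker_def by (intro CollectI conjI m_closed inv_closed a(1) b(1))
    moreover have "a = (a \<otimes> inv b) \<otimes> b"
      using inv_solve_right'[OF m_closed[OF a(1) inv_closed[OF b(1)]] a(1) b(1)] by blast
    ultimately have "a \<in> ker #> b" unfolding r_coset_def by blast
    then have "ker #> b = ker #> a" by (rule repr_independence[OF _ b(1) N.is_subgroup])
    then show "A = B" unfolding a(2) b(2) ..
  qed
  then have "|carrier (G Mod ker)| \<le>o |UNIV :: nat set set|"
    unfolding card_of_ordLeq[symmetric] by blast
  then show ?thesis
    using CH unfolding continuum_hypothesis_def card_le_aleph1_def by (rule ordLeq_ordIso_trans)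
qed

text \<open>The quotient is lifted and the lift composed with the projection, so elements of one
  coset receive the same automorphism.\<close>

lemma hom_lift_CH:
  assumes CH: continuum_hypothesis and M: "standard_borel M" "nonatomic M"
  shows "\<exists>h\<in>hom G (G_mp M). \<forall>g\<in>carrier G. AE x in M. h g x = u g x"
proof -
  interpret N: normal ker G by (rule normal_ker)
  interpret Q: near_hom "G Mod ker" M "\<lambda>A. u (rep A)" by (rule near_hom_Mod)
  obtain h where h: "h \<in> hom (G Mod ker) (G_mp M)"
    "\<forall>A\<in>carrier (G Mod ker). AE x in M. h A x = u (rep A) x"
    using Q.hom_lift[OF M card_Mod_ker[OF CH M(1)]] by blast
  have "compose (carrier G) h (\<lambda>a. ker #> a) \<in> hom G (G_mp M)"
    using hom_compose[OF N.r_coset_hom_Mod h(1)] .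
  moreover have "AE x in M. compose (carrier G) h (\<lambda>a. ker #> a) g x = u g x" if g: "g \<in> carrier G" for g
  proof -
    have "ker #> g \<in> carrier (G Mod ker)" using g by (auto simp: carrier_Mod_ker)
    then have "AE x in M. h (ker #> g) x = u (rep (ker #> g)) x" using h(2) by blast
    then show ?thesis using rep_coset(2)[OF g] unfolding AE_eq_def compose_eq[OF g] by eventually_elim simp
  qed
  ultimately show ?thesis by blast
qed

end

theorem theorem1p4:
  fixes G :: "('g, 'b) monoid_scheme"
    and K :: "('k, 'c) monoid_scheme"
    and M :: "'x measure"
  assumes "prob_space M" and "standard_borel M" and "nonatomic M"
  shows "(group G \<and> card_le_aleph1 (carrier G) \<longrightarrow>
            (\<forall>\<eta>. mp_near_action G M \<eta> \<longrightarrow>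
               (\<exists>\<rho>. spatial_model G M \<eta> \<rho> \<and> acts_by_borel_automorphisms G M \<rho>)) \<and>
            (\<forall>f\<in>hom G (Aut_mp M). \<exists>h\<in>hom G (G_mp M).
               \<forall>g\<in>carrier G. quotient_mp M (h g) = f g)) \<and>
         (continuum_hypothesis \<longrightarrow> group K \<longrightarrow>
            (\<forall>\<eta>. mp_near_action K M \<eta> \<longrightarrow>
               (\<exists>\<rho>. spatial_model K M \<eta> \<rho> \<and> acts_by_borel_automorphisms K M \<rho>)))"
proof (intro conjI impI allI ballI)
  fix \<eta> assume G: "group G \<and> card_le_aleph1 (carrier G)" and \<eta>: "mp_near_action G M \<eta>"
  obtain u where u: "near_hom G M u" "\<forall>g\<in>carrier G. AE x in M. \<eta> g x = u g x"
    using near_action_near_hom[OF _ assms(1,2) \<eta>] G by blast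
  obtain h where h: "h \<in> hom G (G_mp M)" "\<forall>g\<in>carrier G. AE x in M. h g x = u g x"
    using near_hom.hom_lift[OF u(1) assms(2,3)] G by blast
  have "AE x in M. \<eta> g x = h g x" if "g \<in> carrier G" for g
    using u(2)[rule_format, OF that] h(2)[rule_format, OF that] by eventually_elim simp
  then show "\<exists>\<rho>. spatial_model G M \<eta> \<rho> \<and> acts_by_borel_automorphisms G M \<rho>"
    using spatial_model_of_hom[OF _ assms(2) h(1)] G by blast
next
  fix f assume "group G \<and> card_le_aleph1 (carrier G)" and "f \<in> hom G (Aut_mp M)"
  then show "\<exists>h\<in>hom G (G_mp M). \<forall>g\<in>carrier G. quotient_mp M (h g) = f g"
    using hom_Aut_lift[OF _ assms] by blast
next
  fix \<eta> assume CH: continuum_hypothesis and K: "group K" and \<eta>: "mp_near_action K M \<eta>"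
  obtain u where u: "near_hom K M u" "\<forall>g\<in>carrier K. AE x in M. \<eta> g x = u g x"
    using near_action_near_hom[OF K assms(1,2) \<eta>] by blast
  obtain h where h: "h \<in> hom K (G_mp M)" "\<forall>g\<in>carrier K. AE x in M. h g x = u g x"
    using near_hom.hom_lift_CH[OF u(1) CH assms(2,3)] by blast
  have "AE x in M. \<eta> g x = h g x" if "g \<in> carrier K" for g
    using u(2)[rule_format, OF that] h(2)[rule_format, OF that] by eventually_elim simp
  then show "\<exists>\<rho>. spatial_model K M \<eta> \<rho> \<and> acts_by_borel_automorphisms K M \<rho>"
    using spatial_model_of_hom[OF K assms(2) h(1)] by blast
qed

end
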